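(* Let $\Omega\subset\mathbb{R}^N$ be a connected, open and bounded set. Let $g_1,\dots,g_N:[0,+\infty)\to[0,+\infty)$ be continuous functions satisfying assumptions (L) and (G), and assume that $G(\xi)=+\infty$ for every $\xi>0$, where $$G(\xi)=\int_0^\xi \frac{g_N(\zeta^2/N)}{\zeta}\,d\zeta=\lim_{\hat\xi\to0^+}\int_{\hat\xi}^{\xi}\frac{g_N(\zeta^2/N)}{\zeta}\,d\zeta .$$ Let $u\in W^{1,2}(\Omega)\cap C(\overline{\Omega})$ be a weak solution to $$\sum_{i=1}^N g_i(u_{x_i}^2)\,u_{x_ix_i}\le 0\quad\text{in }\Omega .$$ Suppose that there exists $z\in\partial\Omega$ such that $u(z)<u(x)$ for all $x\in\Omega$, and that $\Omega$ satisfies the interior ball condition at $z$, i.e. there is an open ball $B\subset\Omega$ with $z\in\partial B$. Then $$\frac{\partial u}{\partial\nu}(z)<0,$$ where $\nu$ is the outer unit normal to $B$ at $z$ (and the derivative is assumed to exist).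
   Context: Throughout $N\ge 2$. Assumptions (L): there exists $\overline t>0$ such that (i) on $[0,\overline t]$, for every $i=1,\dots,N-1$, $0\le g_N(t)\le g_i(t)\le 1$; (ii) $g_N$ is continuous on $[0,\overline t]$, and positive and differentiable on $(0,\overline t]$; (iii) on $(0,\overline t]$ the function $t\mapsto g_N(t)+g_N'(t)t$ is non-decreasing. For each $i$, let $f_i$ be a solution on $[0,+\infty)$ of the differential equation $g_i(t)=f_i(t)+5tf_i'(t)+2t^2f_i''(t)$. Assumption (G): each $f_i$ is bounded, and the function $s\mapsto f_i(s^2)s^2$ is strictly convex on $\mathbb{R}$. Set $L(p)=\frac12\sum_{i=1}^N f_i(p_i^2)p_i^2$ for $p\in\mathbb{R}^N$; then $\partial^2L/\partial p_i^2=g_i(p_i^2)$, so formally $\operatorname{div}\nabla L(\nabla u)=\sum_i g_i(u_{x_i}^2)u_{x_ix_i}$. A function $u\in W^{1,2}(\Omega)$ is a weak solution to $\sum_{i=1}^N g_i(u_{x_i}^2)u_{x_ix_i}\le0$ (a weak supersolution) if $\int_\Omega\langle\nabla L(\nabla u(x)),\nabla\eta(x)\rangle\,dx\ge0$ for every $\eta\in C_0^\infty(\Omega)$ with $\eta\ge0$. The normal derivative at the boundary point $z$ is the one-sided derivative $\frac{\partial u}{\partial\nu}(z)=\lim_{h\to0^+}\frac{u(z)-u(z-h\nu)}{h}$. *)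

theory Defs
  imports "HOL-Analysis.Analysis"
begin

definition grad :: "('a::euclidean_space \<Rightarrow> real) \<Rightarrow> 'a \<Rightarrow> 'a" where
  "grad f x = (THE D. GDERIV f x :> D)"

primrec C_class :: "nat \<Rightarrow> ('a::euclidean_space \<Rightarrow> real) \<Rightarrow> bool" where
  "C_class 0 f \<longleftrightarrow> continuous_on UNIV f"
| "C_class (Suc k) f \<longleftrightarrow>
     (\<forall>x. f differentiable (at x)) \<and> (\<forall>b\<in>Basis. C_class k (\<lambda>x. grad f x \<bullet> b))"

definition smooth :: "('a::euclidean_space \<Rightarrow> real) \<Rightarrow> bool" where
  "smooth f \<longleftrightarrow> (\<forall>k. C_class k f)"

text \<open>An element of \<open>C\<^sub>0\<^sup>\<infinity>(\<Omega>)\<close> is represented by its extension by zero to the whole space.\<close>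

definition test_functions :: "'a::euclidean_space set \<Rightarrow> ('a \<Rightarrow> real) set" where
  "test_functions \<Omega> = {\<phi>. smooth \<phi> \<and> compact (closure {x. \<phi> x \<noteq> 0}) \<and> closure {x. \<phi> x \<noteq> 0} \<subseteq> \<Omega>}"

definition L2_on :: "'a::euclidean_space set \<Rightarrow> ('a \<Rightarrow> 'b::euclidean_space) \<Rightarrow> bool" where
  "L2_on \<Omega> f \<longleftrightarrow> set_borel_measurable lebesgue \<Omega> f \<and>
     set_integrable lebesgue \<Omega> (\<lambda>x. (norm (f x))\<^sup>2)"

definition is_weak_gradient ::
  "'a::euclidean_space set \<Rightarrow> ('a \<Rightarrow> real) \<Rightarrow> ('a \<Rightarrow> 'a) \<Rightarrow> bool" where
  "is_weak_gradient \<Omega> u v \<longleftrightarrow> (\<forall>\<phi>\<in>test_functions \<Omega>. \<forall>b\<in>Basis.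
     (LINT x:\<Omega>|lebesgue. u x * (grad \<phi> x \<bullet> b)) = - (LINT x:\<Omega>|lebesgue. (v x \<bullet> b) * \<phi> x))"

definition W12 :: "'a::euclidean_space set \<Rightarrow> ('a \<Rightarrow> real) set" where
  "W12 \<Omega> = {u. L2_on \<Omega> u \<and> (\<exists>v. L2_on \<Omega> v \<and> is_weak_gradient \<Omega> u v)}"

text \<open>Weak gradients are unique up to null sets, so below, where \<open>weak_grad\<close> occurs only under
  an integral sign, the choice of representative is immaterial.\<close>

definition weak_grad :: "'a::euclidean_space set \<Rightarrow> ('a \<Rightarrow> real) \<Rightarrow> 'a \<Rightarrow> 'a" where
  "weak_grad \<Omega> u = (SOME v. L2_on \<Omega> v \<and> is_weak_gradient \<Omega> u v)"

text \<open>The coordinates are indexed by a finite type \<open>'n\<close>; the index \<open>m\<close> plays the role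
  of the last index \<open>N\<close>, and \<open>N = CARD('n)\<close>.\<close>

definition assumption_L :: "'n::finite \<Rightarrow> ('n \<Rightarrow> real \<Rightarrow> real) \<Rightarrow> bool" where
  "assumption_L m g \<longleftrightarrow> (\<exists>T>0.
     (\<forall>t\<in>{0..T}. \<forall>i. i \<noteq> m \<longrightarrow> 0 \<le> g m t \<and> g m t \<le> g i t \<and> g i t \<le> 1) \<and>
     continuous_on {0..T} (g m) \<and>
     (\<forall>t\<in>{0<..T}. 0 < g m t) \<and>
     (\<exists>g'. (\<forall>t\<in>{0<..T}. (g m has_real_derivative g' t) (at t within {0<..T})) \<and>
           mono_on {0<..T} (\<lambda>t. g m t + g' t * t)))"

text \<open>The equation \<open>g = f + 5tf' + 2t\<^sup>2f''\<close> is singular at \<open>t = 0\<close>; a solution is required to be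
  twice differentiable only for \<open>t > 0\<close>, and at \<open>t = 0\<close> the equation says \<open>g 0 = f 0\<close>,
  whatever the value of \<open>deriv\<close> there.\<close>

definition solves_ode :: "(real \<Rightarrow> real) \<Rightarrow> (real \<Rightarrow> real) \<Rightarrow> bool" where
  "solves_ode g f \<longleftrightarrow> continuous_on {0..} f \<and>
     (\<forall>t>0. f differentiable (at t) \<and> deriv f differentiable (at t)) \<and>
     (\<forall>t\<ge>0. g t = f t + 5 * t * deriv f t + 2 * t\<^sup>2 * deriv (deriv f) t)"

definition strictly_convex_on :: "'a::real_vector set \<Rightarrow> ('a \<Rightarrow> real) \<Rightarrow> bool" where
  "strictly_convex_on S F \<longleftrightarrow> convex S \<and> (\<forall>x\<in>S. \<forall>y\<in>S. \<forall>t\<in>{0<..<1}. x \<noteq> y \<longrightarrow>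
     F ((1 - t) *\<^sub>R x + t *\<^sub>R y) < (1 - t) * F x + t * F y)"

definition assumption_G :: "('n::finite \<Rightarrow> real \<Rightarrow> real) \<Rightarrow> bool" where
  "assumption_G f \<longleftrightarrow> (\<forall>i. bounded (f i ` {0..}) \<and>
     strictly_convex_on UNIV (\<lambda>s::real. f i (s\<^sup>2) * s\<^sup>2))"

definition lagrangian :: "('n::finite \<Rightarrow> real \<Rightarrow> real) \<Rightarrow> real^'n \<Rightarrow> real" where
  "lagrangian f p = (1/2) * (\<Sum>i\<in>UNIV. f i ((p $ i)\<^sup>2) * (p $ i)\<^sup>2)"

definition weak_supersolution ::
  "('n::finite \<Rightarrow> real \<Rightarrow> real) \<Rightarrow> (real^'n) set \<Rightarrow> (real^'n \<Rightarrow> real) \<Rightarrow> bool" where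
  "weak_supersolution f \<Omega> u \<longleftrightarrow> u \<in> W12 \<Omega> \<and>
     (\<forall>\<eta>\<in>test_functions \<Omega>. (\<forall>x\<in>\<Omega>. 0 \<le> \<eta> x) \<longrightarrow>
        0 \<le> (LINT x:\<Omega>|lebesgue. grad (lagrangian f) (weak_grad \<Omega> u x) \<bullet> grad \<eta> x))"

text \<open>The integrand is nonnegative, so the limit always exists in \<open>[0,\<infinity>]\<close>.\<close>

definition G_integral :: "'n::finite \<Rightarrow> ('n \<Rightarrow> real \<Rightarrow> real) \<Rightarrow> real \<Rightarrow> ereal" where
  "G_integral m g \<xi> = Lim (at_right 0)
     (\<lambda>\<epsilon>. ereal (integral {\<epsilon>..\<xi>} (\<lambda>\<zeta>. g m (\<zeta>\<^sup>2 / real CARD('n)) / \<zeta>)))"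

definition has_normal_derivative ::
  "('a::real_normed_vector \<Rightarrow> real) \<Rightarrow> real \<Rightarrow> 'a \<Rightarrow> 'a \<Rightarrow> bool" where
  "has_normal_derivative u D \<nu> z \<longleftrightarrow>
     ((\<lambda>h. (u z - u (z - h *\<^sub>R \<nu>)) / h) \<longlongrightarrow> D) (at_right 0)"

end

theory Submission
  imports Defs
begin

text \<open>On the annulus \<open>r/2 < \<bar>x - c\<bar> < r\<close> we compare \<open>u - u z\<close> with a radial barrier \<open>V \<bar>x - c\<bar>\<close>,
  \<open>V' = - W\<close>. By (L) the function \<open>t g\<^sub>N(t)\<close> is convex near \<open>0\<close>, so
  \<open>\<Sum> g\<^sub>N(W\<^sup>2 e\<^sub>i\<^sup>2) e\<^sub>i\<^sup>2 \<ge> g\<^sub>N(W\<^sup>2/N)\<close> for unit vectors \<open>e\<close>, and the barrier is a strict subsolution as soon as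
  \<open>- W' g\<^sub>N(W\<^sup>2/N) / W = N/\<rho>\<close>. This ODE reads \<open>d/d\<rho> (\<Gamma> \<circ> W) = - N/\<rho>\<close> with \<open>\<Gamma>\<close> a primitive of
  \<open>g\<^sub>N(\<zeta>\<^sup>2/N)/\<zeta>\<close>; because \<open>\<Gamma>\<close> diverges at \<open>0\<close>, a solution starting from an arbitrarily small \<open>W (r/2) > 0\<close> stays positive up to \<open>\<rho> = r\<close>. The comparison principle
  then gives \<open>u - u z \<ge> V\<close>, and the normal derivative at \<open>z\<close> is at most \<open>- W r < 0\<close>.

  Since the barrier is a strict subsolution, the comparison needs only monotonicity of \<open>\<nabla>L\<close>. It is obtained
  by testing with functions of a mollification of \<open>u\<close>, whose gradients converge in \<open>L\<^sup>2\<close>.\<close>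

section \<open>Smooth mollifiers\<close>

text \<open>The weak inequality admits smooth test functions, while the natural choice, the positive
  part of \<open>v - u - \<epsilon>\<close>, is merely Sobolev. Mollifying \<open>u\<close> inside
  it and squaring the positive part gives a \<open>C^1\<close> function; a second mollification, of
  the test function itself, makes it smooth. The price is that the test gradient contains the
  gradient of the mollified \<open>u\<close> instead of the weak gradient of \<open>u\<close>, so
  monotonicity leaves an error term without a sign. Strictness pays for it: the strict inequality
  for the barrier, integrated, yields a gain \<open>\<kappa>\<close> that is fixed before the
  mollification radius, because near a point with \<open>v > u\<close> the test function is bounded
  below independently of that radius.

  Strictness comes from the factor N in N/\<rho>: since all g_i are at most 1 near 0, the curvature
  of the spheres costs at most (N-1)/\<rho>, and 1/\<rho> is left over.

  The error estimate needs the flux in L^2, hence linear growth of the derivatives of the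
  Lagrangian. Assumption (G) bounds \<open>f\<close> but says nothing direct about its derivative;
  the growth bound is extracted from convexity.\<close>

lemma grad_eq: "GDERIV f x :> D \<Longrightarrow> grad f x = D"
  unfolding grad_def
proof (rule the_equality)
  fix E assume "GDERIV f x :> D" "GDERIV f x :> E"
  then have "(\<lambda>h. h \<bullet> D) = (\<lambda>h. h \<bullet> E)"
    unfolding gderiv_def by (rule has_derivative_unique)
  then show "E = D"
    by (metis vector_eq_ldot)
qed

lemma GDERIV_grad:
  fixes f :: "'a::euclidean_space \<Rightarrow> real"
  assumes "f differentiable (at x)"
  shows "GDERIV f x :> grad f x"
proof -
  from assms obtain f' where f': "(f has_derivative f') (at x)"
    by (auto simp: differentiable_def)
  then have f'lin: "linear f'" by (rule has_derivative_linear)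
  have "f' h = h \<bullet> (\<Sum>b\<in>Basis. f' b *\<^sub>R b)" for h
  proof -
    have "f' h = f' (\<Sum>b\<in>Basis. (h \<bullet> b) *\<^sub>R b)" by (simp only: euclidean_representation)
    also have "\<dots> = (\<Sum>b\<in>Basis. (h \<bullet> b) * f' b)"
      by (simp only: linear_sum[OF f'lin] linear_cmul[OF f'lin] real_scaleR_def)
    finally show ?thesis by (simp add: inner_sum_right mult.commute)
  qed
  then have "f' = (\<lambda>h. h \<bullet> (\<Sum>b\<in>Basis. f' b *\<^sub>R b))" by (rule ext)
  then have "GDERIV f x :> (\<Sum>b\<in>Basis. f' b *\<^sub>R b)"
    using f' by (metis gderiv_def)
  then show ?thesis using grad_eq[of f x] by simp
qed

lemma GDERIV_differentiable: "GDERIV f x :> D \<Longrightarrow> f differentiable (at x)"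
  by (auto simp: gderiv_def differentiable_def)

section \<open>Calculus of the classes C^k\<close>

text \<open>\<open>grad\<close> is a definite description; this rule trades it for an explicitly
  computed gradient \<open>D\<close>, and all closure properties below go through it.\<close>

lemma C_class_SucI:
  assumes "\<And>x. GDERIV f x :> D x" "\<And>b. b \<in> Basis \<Longrightarrow> C_class k (\<lambda>x. D x \<bullet> b)"
  shows "C_class (Suc k) f"
proof -
  have "grad f = D" using assms(1) grad_eq by blast
  then show ?thesis using assms GDERIV_differentiable by fastforce
qed

lemma C_class_continuous: "C_class k f \<Longrightarrow> continuous_on UNIV f"
  by (cases k) (auto simp: continuous_on_eq_continuous_within differentiable_imp_continuous_within)

lemma C_class_SucD: "C_class (Suc k) f \<Longrightarrow> C_class k f"
proof (induction k arbitrary: f)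
  case 0
  then show ?case using C_class_continuous C_class.simps(1) by blast
next
  case (Suc k)
  then have "\<forall>b\<in>Basis. C_class k (\<lambda>x. grad f x \<bullet> b)"
    by (metis C_class.simps(2))
  moreover have "\<forall>x. f differentiable (at x)" using Suc.prems by simp
  ultimately show ?case by simp
qed

lemma C_class_add: "C_class k f \<Longrightarrow> C_class k g \<Longrightarrow> C_class k (\<lambda>x. f x + g x)"
proof (induction k arbitrary: f g)
  case 0
  then show ?case by (simp add: continuous_on_add)
next
  case (Suc k)
  show ?case
  proof (rule C_class_SucI)
    fix x show "GDERIV (\<lambda>x. f x + g x) x :> grad f x + grad g x"
      using Suc.prems by (simp add: GDERIV_add GDERIV_grad)
  next
    fix b :: 'a assume "b \<in> Basis"
    then show "C_class k (\<lambda>x. (grad f x + grad g x) \<bullet> b)"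
      using Suc by (simp add: inner_add_left)
  qed
qed

lemma C_class_mult: "C_class k f \<Longrightarrow> C_class k g \<Longrightarrow> C_class k (\<lambda>x. f x * g x)"
proof (induction k arbitrary: f g)
  case 0
  then show ?case by (simp add: continuous_on_mult)
next
  case (Suc k)
  show ?case
  proof (rule C_class_SucI)
    fix x show "GDERIV (\<lambda>x. f x * g x) x :> f x *\<^sub>R grad g x + g x *\<^sub>R grad f x"
      using Suc.prems by (simp add: GDERIV_mult GDERIV_grad)
  next
    fix b :: 'a assume "b \<in> Basis"
    then show "C_class k (\<lambda>x. (f x *\<^sub>R grad g x + g x *\<^sub>R grad f x) \<bullet> b)"
      using Suc.prems C_class_SucD[OF Suc.prems(1)] C_class_SucD[OF Suc.prems(2)]
      unfolding inner_add_left inner_scaleR_left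
      by (intro C_class_add Suc.IH) simp_all
  qed
qed

lemma C_class_const: "C_class k (\<lambda>x. c)"
proof (induction k arbitrary: c)
  case (Suc k)
  show ?case by (rule C_class_SucI[OF GDERIV_const]) (simp add: Suc)
qed simp

lemma C_class_prod:
  "finite I \<Longrightarrow> (\<And>i. i \<in> I \<Longrightarrow> C_class k (f i)) \<Longrightarrow> C_class k (\<lambda>x. \<Prod>i\<in>I. f i x)"
  by (induction I rule: finite_induct) (auto intro: C_class_const C_class_mult)

lemma C_class_shift: "C_class k f \<Longrightarrow> C_class k (\<lambda>x. f (x - a))"
proof (induction k arbitrary: f)
  case 0
  then show ?case
    by (auto intro!: continuous_intros continuous_on_compose2[where t=UNIV and g=f])
next
  case (Suc k)
  show ?case
  proof (rule C_class_SucI)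
    fix x
    have "GDERIV f (x - a) :> grad f (x - a)"
      using Suc.prems by (simp add: GDERIV_grad)
    then have "(f has_derivative (\<lambda>h. h \<bullet> grad f (x - a))) (at (x - a))"
      by (simp add: gderiv_def)
    then show "GDERIV (\<lambda>x. f (x - a)) x :> grad f (x - a)"
      unfolding gderiv_def
      by (rule has_derivative_compose[where f="\<lambda>x. x - a", rotated])
         (auto intro!: derivative_eq_intros)
  next
    fix b :: 'a assume "b \<in> Basis"
    then show "C_class k (\<lambda>x. grad f (x - a) \<bullet> b)"
      using Suc.prems by (intro Suc.IH) simp
  qed
qed

section \<open>Flat functions built from exp(-1/t)\<close>

text \<open>The factor \<open>(1 / t) ^ k\<close> makes the family closed under differentiation up
  to linear combinations, so that one induction over the order, with \<open>k\<close> arbitrary,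
  proves smoothness of every member.\<close>

definition bump :: "nat \<Rightarrow> real \<Rightarrow> real" where
  "bump k t = (if t > 0 then (1 / t) ^ k * exp (- (1 / t)) else 0)"

lemma bump_nonneg: "bump k t \<ge> 0" and bump_pos: "t > 0 \<Longrightarrow> bump k t > 0"
  and bump_zero: "t \<le> 0 \<Longrightarrow> bump k t = 0"
  by (auto simp: bump_def)

lemma bump_tendsto_0: "(bump k \<longlongrightarrow> 0) (at 0)"
proof -
  have "((\<lambda>t. (inverse t) ^ k / exp (inverse t)) \<longlongrightarrow> (0::real)) (at_right 0)"
    using tendsto_power_div_exp_0 filterlim_inverse_at_top_right
    by (rule filterlim_compose)
  then have "(bump k \<longlongrightarrow> 0) (at_right 0)"
    by (rule Lim_transform_eventually)
       (auto simp: bump_def exp_minus field_simps eventually_at_filter)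
  moreover have "(bump k \<longlongrightarrow> 0) (at_left 0)"
    by (rule tendsto_eventually) (auto simp: bump_def eventually_at_filter)
  ultimately show ?thesis by (simp add: filterlim_split_at)
qed

lemma bump_deriv:
  "(bump k has_real_derivative (- real k * bump (k + 1) t + bump (k + 2) t)) (at t)"
proof -
  consider "t > 0" | "t < 0" | "t = 0" by linarith
  then show ?thesis
  proof cases
    case 1
    have "((\<lambda>t. (1 / t) ^ k * exp (- (1 / t))) has_real_derivative
        (- real k * bump (k + 1) t + bump (k + 2) t)) (at t)"
    proof -
      define u where "u = 1 / t"
      have du: "((\<lambda>t. 1 / t) has_real_derivative - (u\<^sup>2)) (at t)"
        using 1 by (auto intro!: derivative_eq_intros simp: u_def power2_eq_square)
      have "((\<lambda>t. (1 / t) ^ k * exp (- (1 / t))) has_real_derivative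
          (of_nat k * (- (u\<^sup>2) * u ^ (k - Suc 0))) * exp (- u) + (exp (- u) * u\<^sup>2) * u ^ k) (at t)"
        by (rule derivative_eq_intros du refl)+ (simp add: u_def)
      moreover have "(of_nat k * (- (u\<^sup>2) * u ^ (k - Suc 0))) * exp (- u) + (exp (- u) * u\<^sup>2) * u ^ k =
          - real k * bump (k + 1) t + bump (k + 2) t"
        using 1 by (cases k) (auto simp: bump_def u_def[symmetric] power2_eq_square algebra_simps)
      ultimately show ?thesis by metis
    qed
    then show ?thesis
      by (rule has_field_derivative_transform_within_open[where S="{0<..}"])
         (use 1 in \<open>auto simp: bump_def\<close>)
  next
    case 2
    have "((\<lambda>t. 0) has_real_derivative (- real k * bump (k + 1) t + bump (k + 2) t)) (at t)"
      using 2 by (simp add: bump_zero)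
    then show ?thesis
      by (rule has_field_derivative_transform_within_open[where S="{..<0}"])
         (use 2 in \<open>auto simp: bump_def\<close>)
  next
    case 3
    \<comment> \<open>The difference quotient of \<open>bump k\<close> at \<open>0\<close> is
      \<open>bump (Suc k)\<close> itself, whose limit at \<open>0\<close> is already known.\<close>
    have "((\<lambda>h. (bump k (0 + h) - bump k 0) / h) \<longlongrightarrow> 0) (at 0)"
      by (rule Lim_transform_eventually[OF bump_tendsto_0[of "Suc k"]])
         (auto simp: bump_def eventually_at_filter)
    then show ?thesis
      using 3 by (simp add: DERIV_def bump_zero)
  qed
qed

lemma C_class_bump_affine: "C_class j (\<lambda>x::'a::euclidean_space. bump k (x \<bullet> b + c))"
proof (induction j arbitrary: k)
  case 0
  have "continuous_on UNIV (bump k)"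
    by (meson DERIV_continuous bump_deriv continuous_at_imp_continuous_on)
  then show ?case
    by (auto intro!: continuous_intros continuous_on_compose2[where t=UNIV and g="bump k"])
next
  case (Suc j)
  let ?D = "\<lambda>x::'a. - real k * bump (k + 1) (x \<bullet> b + c) + bump (k + 2) (x \<bullet> b + c)"
  show ?case
  proof (rule C_class_SucI)
    fix x :: 'a
    have "GDERIV (\<lambda>x. x \<bullet> b + c) x :> b"
      unfolding gderiv_def by (auto intro!: derivative_eq_intros)
    then show "GDERIV (\<lambda>x. bump k (x \<bullet> b + c)) x :> ?D x *\<^sub>R b"
      using bump_deriv by (rule GDERIV_DERIV_compose)
  next
    fix d :: 'a
    have "C_class j ?D"
      by (intro C_class_add C_class_mult C_class_const Suc)
    then have "C_class j (\<lambda>x. (b \<bullet> d) * ?D x)"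
      by (intro C_class_mult C_class_const)
    then show "C_class j (\<lambda>x. (?D x *\<^sub>R b) \<bullet> d)" by (simp add: mult.commute)
  qed
qed

lemma borel_integrable_bounded_support:
  fixes f :: "'a::euclidean_space \<Rightarrow> 'b::euclidean_space"
  assumes "continuous_on UNIV f" "\<And>x. norm x > R \<Longrightarrow> f x = 0"
  shows "integrable lborel f"
proof -
  have "integrable lborel (\<lambda>x. indicator (cball 0 R) x *\<^sub>R f x)"
    by (rule borel_integrable_compact) (auto intro: continuous_on_subset assms)
  moreover have "(\<lambda>x. indicator (cball 0 R) x *\<^sub>R f x) = f"
    using assms(2) by (force simp: indicator_def)
  ultimately show ?thesis by simp
qed

lemma lborel_integral_pos:
  fixes f :: "'a::euclidean_space \<Rightarrow> real"
  assumes "integrable lborel f" "\<And>x. 0 \<le> f x" "open U" "U \<noteq> {}" "\<And>x. x \<in> U \<Longrightarrow> 0 < f x"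
  shows "0 < integral\<^sup>L lborel f"
proof (rule ccontr)
  assume "\<not> 0 < integral\<^sup>L lborel f"
  then have "integral\<^sup>L lborel f = 0"
    using assms(2) by (simp add: Bochner_Integration.integral_nonneg order_antisym not_less)
  then have "AE x in lborel. f x = 0"
    using integral_nonneg_eq_0_iff_AE[OF assms(1)] assms(2) by auto
  then have "AE x in lborel. x \<notin> U"
    by eventually_elim (use assms(5) in force)
  then have "U \<in> null_sets lborel"
    using AE_iff_null_sets[of U lborel] assms(3) by simp
  then have "negligible U"
    using negligible_iff_null_sets null_sets_completionI by blast
  then show False
    using open_not_negligible assms(3,4) by blast
qed

section \<open>Existence of mollifiers\<close>

text \<open>The support radius is prescribed directly, instead of rescaling one fixed kernel; all
  later estimates are therefore uniform over the mollifiers of radius at most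
  \<open>\<delta>\<close>. Evenness allows \<open>\<rho> (x - y)\<close> to be centred at either
  variable.\<close>

definition mollifier :: "real \<Rightarrow> ('a::euclidean_space \<Rightarrow> real) \<Rightarrow> bool" where
  "mollifier d \<rho> \<longleftrightarrow> smooth \<rho> \<and> (\<forall>x. 0 \<le> \<rho> x) \<and> (\<forall>x. \<rho> (- x) = \<rho> x) \<and>
     (\<forall>x. d \<le> norm x \<longrightarrow> \<rho> x = 0) \<and> integral\<^sup>L lborel \<rho> = 1"

lemma mollifier_exists:
  assumes "d > 0"
  shows "\<exists>\<rho>::'a::euclidean_space \<Rightarrow> real. mollifier d \<rho>"
proof -
  \<comment> \<open>The product of one-dimensional bumps lives on the open cube of half-width
    \<open>e\<close>; this \<open>e\<close> gives its points an l1-norm, hence a Euclidean norm,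
    below \<open>d\<close>.\<close>
  define e where "e = d / DIM('a)"
  have e: "e > 0" using assms by (simp add: e_def)
  define R :: "'a \<Rightarrow> real" where
    "R x = (\<Prod>b\<in>Basis. bump 0 (x \<bullet> b + e) * bump 0 (x \<bullet> (- b) + e))" for x
  have CR: "C_class k R" for k
    unfolding R_def
    by (intro C_class_prod C_class_mult C_class_bump_affine) auto
  have R0: "R x \<ge> 0" for x
    unfolding R_def by (intro prod_nonneg mult_nonneg_nonneg) (auto simp: bump_nonneg)
  have Rev: "R (- x) = R x" for x
    unfolding R_def by (simp add: mult.commute)
  have Rs: "R x = 0" if "d \<le> norm x" for x
  proof (rule ccontr)
    assume "R x \<noteq> 0"
    then have *: "bump 0 (x \<bullet> b + e) * bump 0 (x \<bullet> (- b) + e) \<noteq> 0" if "b \<in> Basis" for b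
      using that by (auto simp: R_def)
    have "\<bar>x \<bullet> b\<bar> < e" if "b \<in> Basis" for b
    proof -
      have "x \<bullet> b + e > 0" "x \<bullet> (- b) + e > 0"
        using *[OF that] bump_zero[of "x \<bullet> b + e" 0] bump_zero[of "x \<bullet> (- b) + e" 0]
        by (metis mult_zero_left not_less, metis mult_zero_right not_less)
      then show ?thesis by auto
    qed
    then have "(\<Sum>b\<in>Basis. \<bar>x \<bullet> b\<bar>) < (\<Sum>b\<in>(Basis::'a set). e)"
      by (intro sum_strict_mono) auto
    then show False using norm_le_l1[of x] that by (simp add: e_def)
  qed
  have cR: "continuous_on UNIV R" using CR C_class_continuous by blast
  have iR: "integrable lborel R"
    by (rule borel_integrable_bounded_support[OF cR, of d]) (simp add: Rs)
  have "R 0 > 0" unfolding R_def by (auto intro!: prod_pos simp: bump_pos e)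
  have pos: "integral\<^sup>L lborel R > 0"
  proof (rule lborel_integral_pos[OF iR R0])
    show "open {x. R x > 0}" by (intro open_Collect_less cR continuous_on_const)
  qed (use \<open>R 0 > 0\<close> in auto)
  have "mollifier d (\<lambda>x. (1 / integral\<^sup>L lborel R) * R x)"
    unfolding mollifier_def smooth_def
    using pos R0 Rev Rs C_class_mult[OF C_class_const[of _ "1 / integral\<^sup>L lborel R"] CR] by auto
  then show ?thesis by blast
qed

section \<open>Convolution and \<open>C\<^sup>1\<close> test functions\<close>

lemma uniformly_continuous_bounded_support:
  fixes f :: "'a::euclidean_space \<Rightarrow> 'b::real_normed_vector"
  assumes "continuous_on UNIV f" "\<And>x. norm x > R \<Longrightarrow> f x = 0" "e > 0"
  obtains d where "d > 0" "\<And>x y. norm (x - y) < d \<Longrightarrow> norm (f x - f y) < e"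
proof -
  have "uniformly_continuous_on (cball 0 (R + 1)) f"
    by (intro compact_uniformly_continuous continuous_on_subset[OF assms(1)]) auto
  then obtain d where d: "d > 0"
    "\<And>x y. x \<in> cball 0 (R + 1) \<Longrightarrow> y \<in> cball 0 (R + 1) \<Longrightarrow> dist y x < d \<Longrightarrow> dist (f y) (f x) < e"
    using \<open>e > 0\<close> unfolding uniformly_continuous_on_def by meson
  show ?thesis
  proof (rule that[of "min d 1"])
    fix x y :: 'a assume xy: "norm (x - y) < min d 1"
    show "norm (f x - f y) < e"
    proof (cases "norm x > R \<and> norm y > R")
      case True
      then show ?thesis using assms(2,3) by simp
    next
      case False
      have "norm x \<le> R + 1" "norm y \<le> R + 1"
        using False xy norm_triangle_ineq2[of x y] norm_triangle_ineq3[of x y] by auto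
      then show ?thesis using d(2)[of y x] xy by (auto simp: dist_norm norm_minus_commute)
    qed
  qed (use d in auto)
qed

lemma bounded_bounded_support:
  fixes f :: "'a::euclidean_space \<Rightarrow> 'b::real_normed_vector"
  assumes "continuous_on UNIV f" "\<And>x. norm x > R \<Longrightarrow> f x = 0"
  obtains B where "B > 0" "\<And>x. norm (f x) \<le> B"
proof -
  have "compact (f ` cball 0 R)"
    by (intro compact_continuous_image continuous_on_subset[OF assms(1)]) auto
  then obtain B where B: "B > 0" "\<And>y. y \<in> f ` cball 0 R \<Longrightarrow> norm y \<le> B"
    using compact_imp_bounded bounded_pos by metis
  have "norm (f x) \<le> B" for x
    using B assms(2)[of x] by (cases "norm x > R") auto
  then show ?thesis using B(1) that by blast
qed

lemma integrable_lebesgue_scaleR_bounded: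
  fixes F :: "'a::euclidean_space \<Rightarrow> real" and k :: "'a \<Rightarrow> 'b::euclidean_space"
  assumes F: "integrable lebesgue F" and k: "continuous_on UNIV k" "\<And>x. norm (k x) \<le> B"
  shows "integrable lebesgue (\<lambda>x. F x *\<^sub>R k x)"
proof (rule Bochner_Integration.integrable_bound)
  show "integrable lebesgue (\<lambda>x. B * norm (F x))"
    using F by simp
  have "k \<in> borel_measurable lebesgue"
    using borel_measurable_continuous_onI[OF k(1)] by (simp add: measurable_completion)
  then show "(\<lambda>x. F x *\<^sub>R k x) \<in> borel_measurable lebesgue"
    using F by measurable
  show "AE x in lebesgue. norm (F x *\<^sub>R k x) \<le> norm (B * norm (F x))"
  proof (rule AE_I2)
    fix x
    have "B \<ge> 0" using k(2)[of x] norm_ge_zero order_trans by blast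
    then show "norm (F x *\<^sub>R k x) \<le> norm (B * norm (F x))"
      using mult_left_mono[OF k(2)[of x], of "\<bar>F x\<bar>"] by (simp add: abs_mult mult.commute)
  qed
qed

section \<open>Differentiation of convolutions\<close>

definition conv :: "('a::euclidean_space \<Rightarrow> real) \<Rightarrow> ('a \<Rightarrow> real) \<Rightarrow> 'a \<Rightarrow> real" where
  "conv F \<rho> x = (LINT y|lebesgue. F y * \<rho> (x - y))"

lemma continuous_on_reflect:
  assumes "continuous_on UNIV k"
  shows "continuous_on UNIV (\<lambda>y. k (x - y :: 'a::euclidean_space))"
  by (rule continuous_on_compose2[OF assms]) (auto intro!: continuous_intros)

lemma integrable_conv:
  fixes k :: "'a::euclidean_space \<Rightarrow> 'b::euclidean_space"
  assumes "integrable lebesgue F" "continuous_on UNIV k" "\<And>x. norm x > R \<Longrightarrow> k x = 0"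
  shows "integrable lebesgue (\<lambda>y. F y *\<^sub>R k (x - y))"
proof -
  obtain B where "\<And>x. norm (k x) \<le> B"
    using bounded_bounded_support[OF assms(2,3)] by blast
  then show ?thesis
    by (intro integrable_lebesgue_scaleR_bounded[where B=B] assms continuous_on_reflect)
qed

lemma continuous_conv:
  fixes F :: "'a::euclidean_space \<Rightarrow> real"
  assumes F: "integrable lebesgue F" and k: "continuous_on UNIV k" "\<And>x. norm x > R \<Longrightarrow> k x = 0"
  shows "continuous_on UNIV (conv F k)"
proof (rule continuous_on_iff[THEN iffD2], intro ballI allI impI)
  fix x :: 'a and e :: real assume "e > 0"
  \<comment> \<open>The summand \<open>1\<close> keeps \<open>C\<close> positive, so that
    \<open>e / C\<close> is meaningful even if \<open>F\<close> vanishes almost everywhere.\<close>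
  define C where "C = (LINT y|lebesgue. \<bar>F y\<bar>) + 1"
  have C: "C > 0" unfolding C_def by (smt (verit) Bochner_Integration.integral_nonneg abs_ge_zero)
  obtain d where d: "d > 0" "\<And>x y. norm (x - y) < d \<Longrightarrow> norm (k x - k y) < e / C"
    using uniformly_continuous_bounded_support[OF k, where e="e / C"] \<open>e > 0\<close> C by auto
  have i: "integrable lebesgue (\<lambda>y. F y * k (x - y))" for x
    using integrable_conv[OF F k] by simp
  have "dist (conv F k x') (conv F k x) < e" if "dist x' x < d" for x'
  proof -
    have "norm (conv F k x' - conv F k x) = norm (LINT y|lebesgue. F y * k (x' - y) - F y * k (x - y))"
      unfolding conv_def by (simp add: Bochner_Integration.integral_diff i)
    also have "\<dots> \<le> (LINT y|lebesgue. \<bar>F y\<bar> * (e / C))"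
    proof (rule Bochner_Integration.integral_norm_bound_integral)
      fix y
      have "norm (k (x' - y) - k (x - y)) < e / C"
        using d(2)[of "x' - y" "x - y"] that by (simp add: dist_norm)
      then have "\<bar>F y\<bar> * \<bar>k (x' - y) - k (x - y)\<bar> \<le> \<bar>F y\<bar> * (e / C)"
        by (intro mult_left_mono) auto
      then show "norm (F y * k (x' - y) - F y * k (x - y)) \<le> \<bar>F y\<bar> * (e / C)"
        by (simp add: right_diff_distrib[symmetric] abs_mult)
    qed (use F i in \<open>auto intro!: Bochner_Integration.integrable_diff\<close>)
    also have "\<dots> = (C - 1) * (e / C)" unfolding C_def by simp
    also have "\<dots> < e" using C \<open>e > 0\<close> by (simp add: field_simps)
    finally show ?thesis by (simp add: dist_norm)
  qed
  then show "\<exists>d>0. \<forall>x'\<in>UNIV. dist x' x < d \<longrightarrow> dist (conv F k x') (conv F k x) < e"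
    using d(1) by blast
qed

lemma GDERIV_line:
  fixes f :: "'a::euclidean_space \<Rightarrow> real"
  assumes "GDERIV f (x + t *\<^sub>R h) :> D"
  shows "((\<lambda>t. f (x + t *\<^sub>R h)) has_real_derivative (h \<bullet> D)) (at t)"
proof -
  have "((\<lambda>t. f (x + t *\<^sub>R h)) has_derivative (\<lambda>s. (s *\<^sub>R h) \<bullet> D)) (at t)"
    by (rule has_derivative_compose[where f="\<lambda>t. x + t *\<^sub>R h" and g=f])
       (use assms in \<open>auto intro!: derivative_eq_intros simp: gderiv_def\<close>)
  then show ?thesis
    by (simp add: has_field_derivative_def mult_commute_abs)
qed

lemma GDERIV_increment_le:
  fixes f :: "'a::euclidean_space \<Rightarrow> real"
  assumes D: "\<And>x. GDERIV f x :> D x"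
    and d: "\<And>x y. norm (x - y) < d \<Longrightarrow> norm (D x - D y) < e" and h: "norm h < d"
  shows "\<bar>f (x + h) - f x - h \<bullet> D x\<bar> \<le> e * norm h"
proof -
  obtain t where t: "0 < t" "t < 1" "f (x + 1 *\<^sub>R h) - f (x + 0 *\<^sub>R h) = (1 - 0) * (h \<bullet> D (x + t *\<^sub>R h))"
    using MVT2[of 0 1 "\<lambda>t. f (x + t *\<^sub>R h)" "\<lambda>t. h \<bullet> D (x + t *\<^sub>R h)"] GDERIV_line[OF D]
    by auto
  have "norm (t *\<^sub>R h) \<le> norm h" using t by (simp add: mult_left_le_one_le)
  then have "norm (D (x + t *\<^sub>R h) - D x) \<le> e"
    using d[of "x + t *\<^sub>R h" x] h by simp
  then have "\<bar>h \<bullet> (D (x + t *\<^sub>R h) - D x)\<bar> \<le> norm h * e"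
    by (meson Cauchy_Schwarz_ineq2 mult_left_mono norm_ge_zero order_trans)
  then show ?thesis using t by (simp add: inner_diff_right mult.commute)
qed

lemma GDERIV_zero_outside:
  assumes "\<And>x. GDERIV f x :> D x" "\<And>x. norm x > R \<Longrightarrow> f x = 0" "norm x > R"
  shows "D x = 0"
proof -
  have "open {x::'a. norm x > R}" by (intro open_Collect_less continuous_intros)
  then have "((\<lambda>x. 0) has_derivative (\<lambda>h. h \<bullet> D x)) (at x)"
    using has_derivative_transform_within_open[of f _ x UNIV "{x. norm x > R}" "\<lambda>x. 0"] assms
    by (auto simp: gderiv_def)
  then have "(\<lambda>h. h \<bullet> D x) = (\<lambda>h. 0)"
    using has_derivative_unique has_derivative_const by blast
  then show ?thesis by (metis inner_eq_zero_iff)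
qed

text \<open>Uniform continuity of \<open>D\<close> bounds the first-order Taylor remainder of
  \<open>k\<close> by a small multiple of the increment, uniformly in the base point. Integrating
  that bound against \<open>\<bar>F y\<bar>\<close> gives the remainder of the convolution.\<close>

lemma GDERIV_conv:
  fixes F :: "'a::euclidean_space \<Rightarrow> real"
  assumes F: "integrable lebesgue F" and D: "\<And>x. GDERIV k x :> D x"
    and cD: "continuous_on UNIV D" and R: "\<And>x. norm x > R \<Longrightarrow> k x = 0"
  shows "GDERIV (conv F k) x :> (LINT y|lebesgue. F y *\<^sub>R D (x - y))"
proof -
  have ck: "continuous_on UNIV k"
    using D differentiable_imp_continuous_within GDERIV_differentiable
    by (metis continuous_at_imp_continuous_on)
  have RD: "\<And>x. norm x > R \<Longrightarrow> D x = 0"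
    using GDERIV_zero_outside[OF D R] by blast
  have i: "integrable lebesgue (\<lambda>y. F y * k (x - y))" for x
    using integrable_conv[OF F ck R] by simp
  have iD: "integrable lebesgue (\<lambda>y. F y *\<^sub>R D (x - y))" for x
    using integrable_conv[OF F cD RD] by simp
  define C where "C = (LINT y|lebesgue. \<bar>F y\<bar>) + 1"
  have C: "C > 0" unfolding C_def by (smt (verit) Bochner_Integration.integral_nonneg abs_ge_zero)
  let ?I = "LINT y|lebesgue. F y *\<^sub>R D (x - y)"
  have "\<exists>d>0. \<forall>z. norm (z - x) < d \<longrightarrow>
      norm (conv F k z - conv F k x - (z - x) \<bullet> ?I) \<le> e * norm (z - x)" if "e > 0" for e
  proof -
    obtain d where d: "d > 0" "\<And>x y. norm (x - y) < d \<Longrightarrow> norm (D x - D y) < e / C"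
      using uniformly_continuous_bounded_support[OF cD RD, where e="e / C"] \<open>e > 0\<close> C by auto
    have "norm (conv F k z - conv F k x - (z - x) \<bullet> ?I) \<le> e * norm (z - x)"
      if "norm (z - x) < d" for z
    proof -
      have "(z - x) \<bullet> ?I = (LINT y|lebesgue. (z - x) \<bullet> (F y *\<^sub>R D (x - y)))"
        by (rule integral_inner_right[symmetric]) (rule iD)
      moreover have iDz: "integrable lebesgue (\<lambda>y. F y * ((z - x) \<bullet> D (x - y)))"
        using integrable_inner_right[of "z - x" lebesgue "\<lambda>y. F y *\<^sub>R D (x - y)"] iD by simp
      ultimately have "conv F k z - conv F k x - (z - x) \<bullet> ?I =
        (LINT y|lebesgue. F y * k (z - y) - F y * k (x - y) - (z - x) \<bullet> (F y *\<^sub>R D (x - y)))"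
        unfolding conv_def using i[of x] i[of z] iDz by simp
      then have "norm (conv F k z - conv F k x - (z - x) \<bullet> ?I) =
        norm (LINT y|lebesgue. F y * k (z - y) - F y * k (x - y) - (z - x) \<bullet> (F y *\<^sub>R D (x - y)))"
        by simp
      also have "\<dots> \<le> (LINT y|lebesgue. \<bar>F y\<bar> * (e / C * norm (z - x)))"
      proof (rule Bochner_Integration.integral_norm_bound_integral)
        fix y
        have "\<bar>k ((x - y) + (z - x)) - k (x - y) - (z - x) \<bullet> D (x - y)\<bar> \<le> e / C * norm (z - x)"
          by (rule GDERIV_increment_le[OF D d(2) that])
        then have "\<bar>F y\<bar> * \<bar>k (z - y) - k (x - y) - (z - x) \<bullet> D (x - y)\<bar> \<le> \<bar>F y\<bar> * (e / C * norm (z - x))"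
          by (intro mult_left_mono) auto
        moreover have "F y * k (z - y) - F y * k (x - y) - (z - x) \<bullet> (F y *\<^sub>R D (x - y)) =
            F y * (k (z - y) - k (x - y) - (z - x) \<bullet> D (x - y))"
          by (simp add: algebra_simps)
        ultimately show "norm (F y * k (z - y) - F y * k (x - y) - (z - x) \<bullet> (F y *\<^sub>R D (x - y)))
            \<le> \<bar>F y\<bar> * (e / C * norm (z - x))"
          by (simp add: abs_mult)
      qed (use F i iDz in \<open>auto intro!: Bochner_Integration.integrable_diff\<close>)
      also have "\<dots> = (C - 1) * (e / C * norm (z - x))" unfolding C_def by simp
      also have "\<dots> \<le> e * norm (z - x)" using C \<open>e > 0\<close> by (simp add: field_simps)
      finally show ?thesis .
    qed
    then show ?thesis using d(1) by blast
  qed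
  then show ?thesis
    unfolding gderiv_def has_derivative_at_alt by (simp add: bounded_linear_inner_left)
qed

text \<open>Every derivative falls on the kernel, so integrability of \<open>F\<close> suffices at
  each order.\<close>

lemma C_class_conv:
  fixes F :: "'a::euclidean_space \<Rightarrow> real"
  assumes F: "integrable lebesgue F"
  shows "C_class j k \<Longrightarrow> (\<And>x. norm x > R \<Longrightarrow> k x = 0) \<Longrightarrow> C_class j (conv F k)"
proof (induction j arbitrary: k)
  case 0
  then show ?case using continuous_conv[OF F, of k R] by simp
next
  case (Suc j)
  have D: "GDERIV k x :> grad k x" for x using Suc.prems by (simp add: GDERIV_grad)
  have Db: "C_class j (\<lambda>x. grad k x \<bullet> b)" if "b \<in> Basis" for b using Suc.prems that by simp
  have cD: "continuous_on UNIV (grad k)"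
    using Db C_class_continuous by (subst continuous_on_componentwise) auto
  have RD: "grad k x = 0" if "norm x > R" for x
    using GDERIV_zero_outside[OF D Suc.prems(2)] that by blast
  show ?case
  proof (rule C_class_SucI)
    show "GDERIV (conv F k) x :> (LINT y|lebesgue. F y *\<^sub>R grad k (x - y))" for x
      by (rule GDERIV_conv[OF F D cD Suc.prems(2)])
    fix b :: 'a assume b: "b \<in> Basis"
    have "C_class j (conv F (\<lambda>x. grad k x \<bullet> b))"
      by (rule Suc.IH[OF Db[OF b]]) (simp add: RD)
    moreover have "conv F (\<lambda>x. grad k x \<bullet> b) = (\<lambda>x. (LINT y|lebesgue. F y *\<^sub>R grad k (x - y)) \<bullet> b)"
      using integrable_conv[OF F cD, of R] RD
      by (auto simp: conv_def integral_inner_left[symmetric])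
    ultimately show "C_class j (\<lambda>x. (LINT y|lebesgue. F y *\<^sub>R grad k (x - y)) \<bullet> b)"
      by simp
  qed
qed

section \<open>Integration by parts without boundary terms\<close>

lemma lborel_integral_translate:
  fixes f :: "'a::euclidean_space \<Rightarrow> real"
  assumes "f \<in> borel_measurable borel"
  shows "(LINT x|lborel. f (x + c)) = integral\<^sup>L lborel f"
proof -
  have "integral\<^sup>L lborel f = integral\<^sup>L (distr lborel borel ((+) c)) f"
    by (simp add: lborel_distr_plus)
  also have "\<dots> = (LINT x|lborel. f (c + x))"
    using assms by (subst integral_distr) auto
  finally show ?thesis by (simp add: add.commute)
qed

text \<open>By translation invariance the difference quotients of \<open>f\<close> in direction
  \<open>b\<close> have integral zero. They converge to \<open>d\<close> uniformly and vanish
  outside one fixed ball, so the integral of \<open>d\<close> is zero as well.\<close>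

lemma integral_directional_derivative_eq_0:
  fixes f d :: "'a::euclidean_space \<Rightarrow> real"
  assumes f: "continuous_on UNIV f" "\<And>x. norm x > R \<Longrightarrow> f x = 0"
    and d: "continuous_on UNIV d" "\<And>y. ((\<lambda>s. f (y + s *\<^sub>R b)) has_real_derivative d y) (at 0)"
    and b: "b \<in> Basis"
  shows "integral\<^sup>L lborel d = 0"
proof -
  \<comment> \<open>The hypothesis speaks of the parameter \<open>0\<close> but of every base point;
    moving the base point along the line covers all parameters.\<close>
  have deriv: "((\<lambda>s. f (y + s *\<^sub>R b)) has_real_derivative d (y + s *\<^sub>R b)) (at s)" for y s
  proof -
    have "((\<lambda>t. f ((y + s *\<^sub>R b) + t *\<^sub>R b)) has_real_derivative d (y + s *\<^sub>R b)) (at 0)"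
      by (rule d(2))
    then have "((\<lambda>t. f (y + (t + s) *\<^sub>R b)) has_real_derivative d (y + s *\<^sub>R b)) (at 0)"
      by (simp add: algebra_simps)
    then show ?thesis
      using DERIV_shift[of "\<lambda>t. f (y + t *\<^sub>R b)" "d (y + s *\<^sub>R b)" 0 s] by simp
  qed
  have d0: "d x = 0" if x: "norm x > R" for x
  proof -
    have op: "open {s. norm (x + s *\<^sub>R b) > R}"
      by (intro open_Collect_less continuous_intros)
    have "((\<lambda>s. 0) has_real_derivative d x) (at 0)"
      by (rule has_field_derivative_transform_within_open[OF d(2) op]) (use x f(2) in auto)
    then show ?thesis using DERIV_unique DERIV_const by blast
  qed
  have fi: "integrable lborel f" by (rule borel_integrable_bounded_support[OF f])
  have di: "integrable lborel d" by (rule borel_integrable_bounded_support[OF d(1) d0])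
  define V where "V = measure lborel (cball (0::'a) (R + 1))"
  have "\<bar>integral\<^sup>L lborel d\<bar> \<le> e * V" if "e > 0" for e
  proof -
    obtain \<delta> where \<delta>: "\<delta> > 0" "\<And>x y. norm (x - y) < \<delta> \<Longrightarrow> norm (d x - d y) < e"
      using uniformly_continuous_bounded_support[OF d(1) d0 \<open>e > 0\<close>] by blast
    define s where "s = min (\<delta> / 2) 1"
    have s: "0 < s" "s < \<delta>" "s \<le> 1" using \<delta>(1) by (auto simp: s_def)
    have cs: "continuous_on UNIV (\<lambda>y. f (y + s *\<^sub>R b))"
      by (rule continuous_on_compose2[OF f(1)]) (auto intro!: continuous_intros)
    have nb: "norm (y + t *\<^sub>R b) \<ge> norm y - \<bar>t\<bar>" for y t
      using norm_triangle_ineq2[of y "- (t *\<^sub>R b)"] b by simp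
    have f0: "f (y + s *\<^sub>R b) = 0" if "norm y > R + 1" for y
      by (rule f(2)) (use nb[of y s] that s in simp)
    have fsi: "integrable lborel (\<lambda>y. f (y + s *\<^sub>R b))"
      by (rule borel_integrable_bounded_support[OF cs f0])
    have eq: "(LINT y|lborel. f (y + s *\<^sub>R b)) = integral\<^sup>L lborel f"
      by (rule lborel_integral_translate) (use f(1) borel_measurable_continuous_onI in blast)
    have bound: "\<bar>f (y + s *\<^sub>R b) - f y - s * d y\<bar> \<le> s * e * indicator (cball 0 (R + 1)) y" for y
    proof (cases "norm y > R + 1")
      case True
      then show ?thesis using f0 f(2)[of y] d0[of y] by (simp add: indicator_def)
    next
      case False
      obtain t where t: "0 < t" "t < s" "f (y + s *\<^sub>R b) - f (y + 0 *\<^sub>R b) = (s - 0) * d (y + t *\<^sub>R b)"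
        using MVT2[of 0 s "\<lambda>t. f (y + t *\<^sub>R b)" "\<lambda>t. d (y + t *\<^sub>R b)"] deriv s(1)
        by auto
      have "norm (d (y + t *\<^sub>R b) - d y) < e"
        by (rule \<delta>(2)) (use t s b in auto)
      then have "\<bar>s * (d (y + t *\<^sub>R b) - d y)\<bar> \<le> s * e"
        using s by (simp add: abs_mult)
      then show ?thesis using t False by (simp add: algebra_simps)
    qed
    have "s * \<bar>integral\<^sup>L lborel d\<bar> = \<bar>LINT y|lborel. f (y + s *\<^sub>R b) - f y - s * d y\<bar>"
      using fsi fi di eq s by (simp add: Bochner_Integration.integral_diff abs_mult)
    also have "\<dots> \<le> (LINT y|lborel. s * e * indicator (cball (0::'a) (R + 1)) y)"
      unfolding real_norm_def[symmetric]
      by (rule Bochner_Integration.integral_norm_bound_integral)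
         (use bound fsi fi di in \<open>auto intro!: integrable_real_indicator emeasure_lborel_cball_finite\<close>)
    also have "\<dots> = s * (e * V)" by (simp add: V_def)
    finally show ?thesis using s by simp
  qed
  then have "\<bar>integral\<^sup>L lborel d\<bar> \<le> 0 + e" if "e > 0" for e
  proof -
    have V: "V \<ge> 0" by (simp add: V_def)
    have "\<bar>integral\<^sup>L lborel d\<bar> \<le> e / (V + 1) * V"
      using \<open>\<And>e. e > 0 \<Longrightarrow> \<bar>integral\<^sup>L lborel d\<bar> \<le> e * V\<close>[of "e / (V + 1)"] V that by simp
    also have "\<dots> \<le> e" using V that by (simp add: field_simps)
    finally show ?thesis by simp
  qed
  then have "\<bar>integral\<^sup>L lborel d\<bar> \<le> 0" by (rule field_le_epsilon)
  then show ?thesis by simp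
qed

section \<open>Mollifications and their gradients\<close>

lemma mollifierD:
  assumes "mollifier d \<rho>"
  shows "smooth \<rho>" "\<And>x. 0 \<le> \<rho> x" "\<And>x. \<rho> (- x) = \<rho> x" "\<And>x. d \<le> norm x \<Longrightarrow> \<rho> x = 0"
    "integral\<^sup>L lborel \<rho> = 1" "\<And>x. norm x > d \<Longrightarrow> \<rho> x = 0" "continuous_on UNIV \<rho>"
    "\<And>x. GDERIV \<rho> x :> grad \<rho> x" "continuous_on UNIV (grad \<rho>)" "\<And>x. norm x > d \<Longrightarrow> grad \<rho> x = 0"
    "\<And>x y. \<rho> (x - y) = \<rho> (y - x)"
proof -
  show *: "smooth \<rho>" "\<And>x. 0 \<le> \<rho> x" "\<And>x. \<rho> (- x) = \<rho> x" "\<And>x. d \<le> norm x \<Longrightarrow> \<rho> x = 0"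
    "integral\<^sup>L lborel \<rho> = 1"
    using assms by (auto simp: mollifier_def)
  show z: "\<And>x. norm x > d \<Longrightarrow> \<rho> x = 0" using *(4) by auto
  have C: "C_class k \<rho>" for k using *(1) by (simp add: smooth_def)
  show "continuous_on UNIV \<rho>" using C C_class_continuous by blast
  have "C_class (Suc 0) \<rho>" by (rule C)
  then show g: "\<And>x. GDERIV \<rho> x :> grad \<rho> x" by (simp add: GDERIV_grad)
  show "continuous_on UNIV (grad \<rho>)"
    using \<open>C_class (Suc 0) \<rho>\<close> by (subst continuous_on_componentwise) auto
  show "\<And>x. norm x > d \<Longrightarrow> grad \<rho> x = 0"
    using GDERIV_zero_outside[of \<rho> "grad \<rho>" d] g z by blast
  show "\<And>x y. \<rho> (x - y) = \<rho> (y - x)"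
    using *(3) by (metis minus_diff_eq)
qed

lemma mollifier_integral_shift:
  assumes "mollifier d \<rho>"
  shows "integrable lborel (\<lambda>y. \<rho> (x - y))" "(LINT y|lborel. \<rho> (x - y)) = 1"
    "integrable lebesgue (\<lambda>y. \<rho> (x - y))" "(LINT y|lebesgue. \<rho> (x - y)) = 1"
proof -
  note m = mollifierD[OF assms]
  have c: "continuous_on UNIV (\<lambda>y. \<rho> (x - y))" by (rule continuous_on_reflect[OF m(7)])
  have b: "(\<lambda>y. \<rho> (x - y)) \<in> borel_measurable lborel" 
    using borel_measurable_continuous_onI[OF c] by simp
  have z: "\<rho> (x - y) = 0" if "norm y > norm x + d" for y
    by (rule m(6)) (use that norm_triangle_ineq2[of y x] in \<open>simp add: norm_minus_commute\<close>)
  show i: "integrable lborel (\<lambda>y. \<rho> (x - y))"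
    by (rule borel_integrable_bounded_support[OF c z])
  have "(LINT y|lborel. \<rho> (y + (- x))) = integral\<^sup>L lborel \<rho>"
    by (rule lborel_integral_translate) (rule borel_measurable_continuous_onI[OF m(7)])
  then show 1: "(LINT y|lborel. \<rho> (x - y)) = 1"
    using m(5) m(11)[of x] by simp
  show "integrable lebesgue (\<lambda>y. \<rho> (x - y))" using i b by (simp add: integrable_completion)
  show "(LINT y|lebesgue. \<rho> (x - y)) = 1" using 1 b by (simp add: integral_completion)
qed

text \<open>The kernel is a probability density concentrated within distance \<open>d\<close> of
  \<open>x\<close>, so the convolution is an average of values that differ from \<open>F x\<close>
  by at most \<open>e\<close>.\<close>

lemma conv_close:
  assumes \<rho>: "mollifier d \<rho>" and F: "integrable lebesgue F"
    and e: "\<And>y. norm (y - x) < d \<Longrightarrow> \<bar>F y - F x\<bar> \<le> e"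
  shows "\<bar>conv F \<rho> x - F x\<bar> \<le> e"
proof -
  note m = mollifierD[OF \<rho>] and s = mollifier_integral_shift[OF \<rho>, of x]
  have i: "integrable lebesgue (\<lambda>y. F y * \<rho> (x - y))"
    using integrable_conv[OF F m(7,6)] by simp
  have "conv F \<rho> x - F x = (LINT y|lebesgue. F y * \<rho> (x - y) - F x * \<rho> (x - y))"
    unfolding conv_def using i s by (simp add: Bochner_Integration.integral_diff)
  also have "norm \<dots> \<le> (LINT y|lebesgue. e * \<rho> (x - y))"
  proof (rule Bochner_Integration.integral_norm_bound_integral)
    fix y
    show "norm (F y * \<rho> (x - y) - F x * \<rho> (x - y)) \<le> e * \<rho> (x - y)"
    proof (cases "norm (y - x) < d")
      case True
      then show ?thesis
        using mult_right_mono[OF e[OF True] m(2)[of "x - y"]] m(2)[of "x - y"]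
        by (simp add: left_diff_distrib[symmetric] abs_mult)
    next
      case False
      then show ?thesis using m(4)[of "x - y"] by (simp add: norm_minus_commute)
    qed
  qed (use i s in \<open>auto intro!: Bochner_Integration.integrable_diff\<close>)
  also have "\<dots> = e" using s by simp
  finally show ?thesis by simp
qed

lemma integral_by_parts_compact:
  fixes f k :: "'a::euclidean_space \<Rightarrow> real"
  assumes f: "\<And>x. GDERIV f x :> Df x" "continuous_on UNIV Df" "\<And>x. norm x > R \<Longrightarrow> f x = 0"
    and k: "\<And>x. GDERIV k x :> Dk x" "continuous_on UNIV Dk"
    and b: "b \<in> Basis"
  shows "(LINT y|lborel. f y * (Dk y \<bullet> b)) = - (LINT y|lborel. k y * (Df y \<bullet> b))"
proof -
  have cf: "continuous_on UNIV f" and ck: "continuous_on UNIV k"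
    using f(1) k(1) differentiable_imp_continuous_within GDERIV_differentiable
    by (metis continuous_at_imp_continuous_on)+
  have Df0: "Df x = 0" if "norm x > R" for x using GDERIV_zero_outside[of f Df R] f that by blast
  have "LINT y|lborel. f y * (Dk y \<bullet> b) + k y * (Df y \<bullet> b) = 0" (is "integral\<^sup>L lborel ?d = 0")
  proof (rule integral_directional_derivative_eq_0[of "\<lambda>y. f y * k y" R ?d b])
    show "continuous_on UNIV (\<lambda>y. f y * k y)" by (intro continuous_intros cf ck)
    show "continuous_on UNIV ?d" by (intro continuous_intros cf ck f(2) k(2))
    fix y
    have "GDERIV (\<lambda>y. f y * k y) y :> f y *\<^sub>R Dk y + k y *\<^sub>R Df y"
      by (rule GDERIV_mult[OF f(1) k(1)])
    then have "GDERIV (\<lambda>y. f y * k y) (y + 0 *\<^sub>R b) :> f y *\<^sub>R Dk y + k y *\<^sub>R Df y"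
      by simp
    from GDERIV_line[OF this]
    show "((\<lambda>s. f (y + s *\<^sub>R b) * k (y + s *\<^sub>R b)) has_real_derivative ?d y) (at 0)"
      by (simp add: inner_add_right inner_commute[of b])
  qed (use f(3) b in auto)
  moreover have "integrable lborel (\<lambda>y. f y * (Dk y \<bullet> b))"
    by (rule borel_integrable_bounded_support[of _ R]) (auto intro!: continuous_intros cf k(2) simp: f(3))
  moreover have "integrable lborel (\<lambda>y. k y * (Df y \<bullet> b))"
    by (rule borel_integrable_bounded_support[of _ R]) (auto intro!: continuous_intros ck f(2) simp: Df0)
  ultimately show ?thesis by simp
qed

lemma GDERIV_reflect:
  assumes "GDERIV k (x - y) :> D"
  shows "GDERIV (\<lambda>y. k (x - y)) y :> - D"
proof -
  have "((\<lambda>y. k (x - y)) has_derivative (\<lambda>h. (- h) \<bullet> D)) (at y)"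
    by (rule has_derivative_compose[where f="\<lambda>y. x - y" and g=k])
       (use assms in \<open>auto intro!: derivative_eq_intros simp: gderiv_def\<close>)
  then show ?thesis by (simp add: gderiv_def)
qed

lemma lebesgue_integral_eq_lborel:
  fixes f :: "'a::euclidean_space \<Rightarrow> real"
  assumes "continuous_on UNIV f"
  shows "integral\<^sup>L lebesgue f = integral\<^sup>L lborel f"
    "integrable lborel f \<Longrightarrow> integrable lebesgue f"
proof -
  have "f \<in> borel_measurable lborel" using borel_measurable_continuous_onI[OF assms] by simp
  then show "integral\<^sup>L lebesgue f = integral\<^sup>L lborel f" "integrable lborel f \<Longrightarrow> integrable lebesgue f"
    by (simp_all add: integral_completion integrable_completion)
qed

lemma GDERIV_conv_mollifier:
  fixes F :: "'a::euclidean_space \<Rightarrow> real"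
  assumes \<rho>: "mollifier d \<rho>" and F: "integrable lebesgue F"
  shows "GDERIV (conv F \<rho>) x :> grad (conv F \<rho>) x"
    and "b \<in> Basis \<Longrightarrow> grad (conv F \<rho>) x \<bullet> b = (LINT y|lebesgue. F y * (grad \<rho> (x - y) \<bullet> b))"
    and "smooth (conv F \<rho>)"
proof -
  note m = mollifierD[OF \<rho>]
  have g: "GDERIV (conv F \<rho>) x :> (LINT y|lebesgue. F y *\<^sub>R grad \<rho> (x - y))"
    by (rule GDERIV_conv[OF F m(8,9,6)])
  then show "GDERIV (conv F \<rho>) x :> grad (conv F \<rho>) x" using grad_eq by metis
  have "integrable lebesgue (\<lambda>y. F y *\<^sub>R grad \<rho> (x - y))"
    by (rule integrable_conv[OF F m(9,10)])
  then show "grad (conv F \<rho>) x \<bullet> b = (LINT y|lebesgue. F y * (grad \<rho> (x - y) \<bullet> b))" if "b \<in> Basis"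
    using grad_eq[OF g] by (simp add: integral_inner_left[symmetric])
  show "smooth (conv F \<rho>)"
    unfolding smooth_def using C_class_conv[OF F, of _ \<rho> d] m(1,6) by (simp add: smooth_def)
qed

text \<open>The derivative moves from the kernel to \<open>f\<close>; the sign from reflecting the
  kernel cancels the one from integrating by parts.\<close>

lemma grad_conv_C1:
  fixes f :: "'a::euclidean_space \<Rightarrow> real"
  assumes \<rho>: "mollifier d \<rho>"
    and f: "\<And>x. GDERIV f x :> Df x" "continuous_on UNIV Df" "\<And>x. norm x > R \<Longrightarrow> f x = 0"
    and b: "b \<in> Basis"
  shows "grad (conv f \<rho>) x \<bullet> b = conv (\<lambda>y. Df y \<bullet> b) \<rho> x"
proof -
  note m = mollifierD[OF \<rho>]
  have cf: "continuous_on UNIV f"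
    using f(1) differentiable_imp_continuous_within GDERIV_differentiable
    by (metis continuous_at_imp_continuous_on)
  have fi: "integrable lebesgue f"
    by (intro lebesgue_integral_eq_lborel cf borel_integrable_bounded_support[of f R] f(3))
  have c1: "continuous_on UNIV (\<lambda>y. grad \<rho> (x - y))"
    by (rule continuous_on_reflect[OF m(9)])
  have c2: "continuous_on UNIV (\<lambda>y. \<rho> (x - y))"
    by (rule continuous_on_reflect[OF m(7)])
  have "grad (conv f \<rho>) x \<bullet> b = (LINT y|lebesgue. f y * (grad \<rho> (x - y) \<bullet> b))"
    by (rule GDERIV_conv_mollifier(2)[OF \<rho> fi b])
  also have "\<dots> = (LINT y|lborel. f y * (grad \<rho> (x - y) \<bullet> b))"
    by (rule lebesgue_integral_eq_lborel) (intro continuous_intros cf c1)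
  also have "\<dots> = - (LINT y|lborel. f y * (- grad \<rho> (x - y) \<bullet> b))"
    by simp
  also have "\<dots> = (LINT y|lborel. \<rho> (x - y) * (Df y \<bullet> b))"
    by (subst integral_by_parts_compact[where k="\<lambda>y. \<rho> (x - y)" and Dk="\<lambda>y. - grad \<rho> (x - y)", OF f])
       (auto intro!: continuous_intros c1 GDERIV_reflect m(8) b)
  also have "\<dots> = (LINT y|lebesgue. \<rho> (x - y) * (Df y \<bullet> b))"
    by (rule lebesgue_integral_eq_lborel(1)[symmetric]) (intro continuous_intros c2 f(2))
  finally show ?thesis by (simp add: conv_def mult.commute)
qed

lemma conv_nonzeroD:
  assumes "mollifier d \<rho>" "conv F \<rho> x \<noteq> 0"
  shows "\<exists>y. F y \<noteq> 0 \<and> norm (x - y) < d"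
proof (rule ccontr)
  assume *: "\<not> ?thesis"
  have "F y * \<rho> (x - y) = 0" for y
    using * mollifierD(4)[OF assms(1), of "x - y"] by (metis mult_eq_0_iff not_less)
  then have "conv F \<rho> x = 0" unfolding conv_def by (simp only: integral_zero)
  then show False using assms(2) by simp
qed

lemma integrable_lebesgue_inner:
  fixes A k :: "'a::euclidean_space \<Rightarrow> 'a"
  assumes A: "integrable lebesgue A" and k: "continuous_on UNIV k" "\<And>x. norm x > R \<Longrightarrow> k x = 0"
  shows "integrable lebesgue (\<lambda>x. A x \<bullet> k x)"
proof -
  obtain B where B: "\<And>x. norm (k x) \<le> B" using bounded_bounded_support[OF k] by blast
  show ?thesis
  proof (rule Bochner_Integration.integrable_bound[where f="\<lambda>x. B * norm (A x)"])
    show "integrable lebesgue (\<lambda>x. B * norm (A x))" using A by simp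
    have "k \<in> borel_measurable lebesgue"
      using borel_measurable_continuous_onI[OF k(1)] by (simp add: measurable_completion)
    then show "(\<lambda>x. A x \<bullet> k x) \<in> borel_measurable lebesgue" using A by measurable
    show "AE x in lebesgue. norm (A x \<bullet> k x) \<le> norm (B * norm (A x))"
    proof (rule AE_I2)
      fix x
      have "B \<ge> 0" using B[of x] norm_ge_zero order_trans by blast
      moreover have "\<bar>A x \<bullet> k x\<bar> \<le> norm (A x) * B"
        by (meson B Cauchy_Schwarz_ineq2 mult_left_mono norm_ge_zero order_trans)
      ultimately show "norm (A x \<bullet> k x) \<le> norm (B * norm (A x))" by (simp add: mult.commute)
    qed
  qed
qed

text \<open>Extends the weak inequality from smooth to \<open>C^1\<close> test functions. Mollifying
  \<open>f\<close> preserves nonnegativity, and the gradients converge uniformly to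
  \<open>Df\<close>, which is enough against an integrable \<open>A\<close>.\<close>

lemma nonneg_integral_C1_test:
  fixes A :: "'a::euclidean_space \<Rightarrow> 'a"
  assumes A: "integrable lebesgue A"
    and weak: "\<And>\<phi>. \<phi> \<in> test_functions \<Omega> \<Longrightarrow> (\<And>x. 0 \<le> \<phi> x) \<Longrightarrow> 0 \<le> (LINT x|lebesgue. A x \<bullet> grad \<phi> x)"
    and \<Omega>: "open \<Omega>"
    and S: "compact S" "S \<subseteq> \<Omega>"
    and f: "\<And>x. GDERIV f x :> Df x" "continuous_on UNIV Df" "\<And>x. x \<notin> S \<Longrightarrow> f x = 0" "\<And>x. 0 \<le> f x"
  shows "0 \<le> (LINT x|lebesgue. A x \<bullet> Df x)"
proof -
  obtain R where R: "\<And>x. x \<in> S \<Longrightarrow> norm x \<le> R"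
    using compact_imp_bounded[OF S(1)] bounded_pos by blast
  have fR: "f x = 0" if "norm x > R" for x using R f(3) that by force
  have DfR: "Df x = 0" if "norm x > R" for x using GDERIV_zero_outside[of f Df R] f(1) fR that by blast
  have cf: "continuous_on UNIV f"
    using f(1) differentiable_imp_continuous_within GDERIV_differentiable
    by (metis continuous_at_imp_continuous_on)
  have fi: "integrable lebesgue f"
    by (intro lebesgue_integral_eq_lborel cf borel_integrable_bounded_support[of f R] fR)
  obtain r where r: "r > 0" "\<And>x y. x \<in> S \<Longrightarrow> dist x y < r \<Longrightarrow> y \<in> \<Omega>"
  proof -
    obtain r where "r > 0" "(\<Union>x\<in>S. ball x r) \<subseteq> \<Omega>"
      using compact_subset_open_imp_ball_epsilon_subset[OF S(1) \<Omega> S(2)] by auto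
    moreover have "y \<in> (\<Union>x\<in>S. ball x r)" if "x \<in> S" "dist x y < r" for x y
      using that by auto
    ultimately show ?thesis by (intro that[of r]) blast+
  qed
  note iA = integrable_lebesgue_inner[OF A]
  define C where "C = (LINT x|lebesgue. norm (A x))"
  have C: "C \<ge> 0" by (simp add: C_def)
  have "0 \<le> (LINT x|lebesgue. A x \<bullet> Df x) + e" if "e > 0" for e
  proof -
    \<comment> \<open>Componentwise closeness \<open>e'\<close> costs a factor
      \<open>DIM('a)\<close> in norm and a factor \<open>C\<close> after integration; the product
      stays below \<open>e\<close>.\<close>
    define e' where "e' = e / ((C + 1) * DIM('a))"
    have e': "e' > 0" using C \<open>e > 0\<close> by (simp add: e'_def)
    obtain \<delta> where \<delta>: "\<delta> > 0" "\<And>x y. norm (x - y) < \<delta> \<Longrightarrow> norm (Df x - Df y) < e'"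
      using uniformly_continuous_bounded_support[OF f(2) DfR e'] by blast
    \<comment> \<open>The first bound controls the oscillation of \<open>Df\<close>, the second
      keeps the enlarged support \<open>S + cball 0 d\<close> inside
      \<open>\<Omega>\<close>.\<close>
    define d where "d = min \<delta> (r / 2)"
    have d: "d > 0" "d \<le> \<delta>" "d \<le> r / 2" using \<delta> r by (auto simp: d_def)
    obtain \<rho> :: "'a \<Rightarrow> real" where \<rho>: "mollifier d \<rho>" using mollifier_exists[OF d(1)] by blast
    note m = mollifierD[OF \<rho>]
    define \<phi> where "\<phi> = conv f \<rho>"
    let ?K = "{x + y |x y. x \<in> S \<and> y \<in> cball 0 d}"
    have K: "compact ?K" by (rule compact_sums[OF S(1) compact_cball])
    have \<phi>K: "{x. \<phi> x \<noteq> 0} \<subseteq> ?K"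
    proof
      fix x assume "x \<in> {x. \<phi> x \<noteq> 0}"
      then obtain y where "f y \<noteq> 0" "norm (x - y) < d"
        using conv_nonzeroD[OF \<rho>] by (auto simp: \<phi>_def)
      then have "x = y + (x - y)" "y \<in> S" "x - y \<in> cball 0 d" using f(3) by auto
      then show "x \<in> ?K" by blast
    qed
    then have cl: "closure {x. \<phi> x \<noteq> 0} \<subseteq> ?K" by (intro closure_minimal compact_imp_closed K)
    have "?K \<subseteq> \<Omega>" using r d by (auto simp: dist_norm)
    moreover have "compact (closure {x. \<phi> x \<noteq> 0})"
      using K \<phi>K bounded_subset compact_imp_bounded by (simp add: compact_closure) blast
    ultimately have \<phi>t: "\<phi> \<in> test_functions \<Omega>"
      using cl GDERIV_conv_mollifier(3)[OF \<rho> fi] by (auto simp: test_functions_def \<phi>_def)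
    have \<phi>0: "0 \<le> \<phi> x" for x
      unfolding \<phi>_def conv_def by (intro Bochner_Integration.integral_nonneg) (simp add: f(4) m(2))
    have \<phi>g: "GDERIV \<phi> x :> grad \<phi> x" for x
      unfolding \<phi>_def by (rule GDERIV_conv_mollifier(1)[OF \<rho> fi])
    have "C_class (Suc 0) \<phi>"
      using GDERIV_conv_mollifier(3)[OF \<rho> fi] by (simp add: smooth_def \<phi>_def del: C_class.simps)
    then have c\<phi>: "continuous_on UNIV (grad \<phi>)"
      by (subst continuous_on_componentwise) auto
    obtain R' where R': "\<And>x. x \<in> ?K \<Longrightarrow> norm x \<le> R'"
      using compact_imp_bounded[OF K] unfolding bounded_iff by blast
    have \<phi>R: "grad \<phi> x = 0" if "norm x > R'" for x
      using GDERIV_zero_outside[of \<phi> "grad \<phi>" R' x] \<phi>g \<phi>K R' that by force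
    have close: "norm (grad \<phi> x - Df x) \<le> DIM('a) * e'" for x
    proof -
      have "\<bar>(grad \<phi> x - Df x) \<bullet> b\<bar> \<le> e'" if b: "b \<in> Basis" for b
      proof -
        have "\<bar>conv (\<lambda>y. Df y \<bullet> b) \<rho> x - Df x \<bullet> b\<bar> \<le> e'"
        proof (rule conv_close[OF \<rho>])
          show "integrable lebesgue (\<lambda>y. Df y \<bullet> b)"
            by (intro lebesgue_integral_eq_lborel borel_integrable_bounded_support[of _ R])
               (auto intro!: continuous_intros f(2) simp: DfR)
          fix y assume "norm (y - x) < d"
          then have "norm (Df y - Df x) < e'" using \<delta>(2) d by auto
          then show "\<bar>Df y \<bullet> b - Df x \<bullet> b\<bar> \<le> e'"
            using Basis_le_norm[OF b, of "Df y - Df x"] by (simp add: inner_diff_left)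
        qed
        then show ?thesis
          using grad_conv_C1[OF \<rho> f(1,2) fR b] by (simp add: \<phi>_def inner_diff_left)
      qed
      then have "(\<Sum>b\<in>Basis. \<bar>(grad \<phi> x - Df x) \<bullet> b\<bar>) \<le> DIM('a) * e'"
        using sum_bounded_above[of Basis "\<lambda>b. \<bar>(grad \<phi> x - Df x) \<bullet> b\<bar>" e'] by simp
      then show ?thesis using norm_le_l1 order_trans by blast
    qed
    have "0 \<le> (LINT x|lebesgue. A x \<bullet> grad \<phi> x)" by (rule weak[OF \<phi>t \<phi>0])
    also have "\<dots> = (LINT x|lebesgue. A x \<bullet> Df x) + (LINT x|lebesgue. A x \<bullet> grad \<phi> x - A x \<bullet> Df x)"
      using iA[OF c\<phi> \<phi>R] iA[OF f(2) DfR] by (simp add: Bochner_Integration.integral_diff)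
    also have "(LINT x|lebesgue. A x \<bullet> grad \<phi> x - A x \<bullet> Df x) \<le> (LINT x|lebesgue. norm (A x) * (DIM('a) * e'))"
    proof (rule integral_mono)
      fix x
      have "A x \<bullet> (grad \<phi> x - Df x) \<le> norm (A x) * norm (grad \<phi> x - Df x)"
        by (rule norm_cauchy_schwarz)
      also have "\<dots> \<le> norm (A x) * (DIM('a) * e')" by (intro mult_left_mono close) auto
      finally show "A x \<bullet> grad \<phi> x - A x \<bullet> Df x \<le> norm (A x) * (DIM('a) * e')"
        by (simp add: inner_diff_right)
    qed (use A iA[OF c\<phi> \<phi>R] iA[OF f(2) DfR] in \<open>auto intro!: Bochner_Integration.integrable_diff\<close>)
    also have "\<dots> = C * (DIM('a) * e')" by (simp add: C_def)
    also have "DIM('a) * e' = e / (C + 1)" by (simp add: e'_def)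
    also have "C * (e / (C + 1)) \<le> e" using C \<open>e > 0\<close> by (simp add: field_simps)
    finally show ?thesis by simp
  qed
  then show ?thesis by (rule field_le_epsilon)
qed

section \<open>\<open>L\<^sup>2\<close> convergence of mollifications\<close>

text \<open>\<open>T M\<close> clamps values to [-M, M] and \<open>X M\<close> is a continuous
  spatial cutoff. Dominated convergence reduces \<open>F\<close> to a bounded function of bounded
  support, which is then approximated by continuous ones.\<close>

lemma L2_approx_continuous:
  fixes F :: "'a::euclidean_space \<Rightarrow> real"
  assumes F: "F \<in> borel_measurable lebesgue" "integrable lebesgue (\<lambda>x. (F x)\<^sup>2)" and "e > 0"
  obtains \<Phi> :: "'a \<Rightarrow> real" and R where "continuous_on UNIV \<Phi>" "\<And>x. norm x > R \<Longrightarrow> \<Phi> x = 0" "R > 0"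
    "integrable lebesgue (\<lambda>x. (F x - \<Phi> x)\<^sup>2)" "(LINT x|lebesgue. (F x - \<Phi> x)\<^sup>2) < e"
proof -
  define T where "T M t = max (- M) (min M t)" for M t :: real
  define X where "X M x = max 0 (min 1 (M + 1 - norm x))" for M and x :: 'a
  have TM: "\<bar>T M t\<bar> \<le> M" if "M \<ge> 0" for M t using that by (auto simp: T_def)
  have X01: "0 \<le> X M x" "X M x \<le> 1" for M and x :: 'a by (auto simp: X_def)
  have X0: "X M x = 0" if "norm x > M + 1" for M and x :: 'a using that by (auto simp: X_def)
  have contX: "continuous_on UNIV (X M)" for M
    unfolding X_def by (intro continuous_intros)
  have Xm: "X M \<in> borel_measurable lebesgue" for M
    using borel_measurable_continuous_onI[OF contX] by (simp add: measurable_completion)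
  have shrink: "\<bar>t - T M t * X M x\<bar> \<le> \<bar>t\<bar>" if M: "M \<ge> 0" for M t x
  proof (cases "t \<ge> 0")
    case True
    then have "0 \<le> T M t" "T M t \<le> t" using M by (auto simp: T_def)
    moreover have "0 \<le> T M t * X M x" using X01 calculation by simp
    moreover have "T M t * X M x \<le> T M t" using X01 calculation by (simp add: mult_left_le)
    ultimately show ?thesis by linarith
  next
    case False
    then have "0 \<ge> T M t" "T M t \<ge> t" using M by (auto simp: T_def)
    moreover have "0 \<ge> T M t * X M x" using X01 calculation by (simp add: mult_nonpos_nonneg)
    moreover have "T M t * X M x \<ge> T M t"
      using X01[of M x] calculation mult_left_mono_neg[of "X M x" 1 "T M t"] by simp
    ultimately show ?thesis by linarith
  qed
  have Tm: "(\<lambda>x. T M (k x)) \<in> borel_measurable lebesgue"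
    if "k \<in> borel_measurable lebesgue" for M and k :: "'a \<Rightarrow> real"
    using that unfolding T_def by measurable
  have "(\<lambda>n. LINT x|lebesgue. (F x - T (real n) (F x) * X (real n) x)\<^sup>2) \<longlonglongrightarrow> (LINT x|(lebesgue::'a measure). 0)"
  proof (rule integral_dominated_convergence[where w="\<lambda>x. (F x)\<^sup>2"])
    show "AE x in lebesgue. (\<lambda>n. (F x - T (real n) (F x) * X (real n) x)\<^sup>2) \<longlonglongrightarrow> 0"
    proof (rule AE_I2, rule tendsto_eventually)
      fix x :: 'a
      have "\<forall>\<^sub>F n in sequentially. real n \<ge> \<bar>F x\<bar> + norm x"
        using eventually_at_top_linorder real_arch_simple
        by (metis (mono_tags, lifting) eventually_ge_at_top filterlim_at_top filterlim_real_sequentially)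
      then show "\<forall>\<^sub>F n in sequentially. (F x - T (real n) (F x) * X (real n) x)\<^sup>2 = 0"
      proof eventually_elim
        case (elim n)
        have "\<bar>F x\<bar> \<le> real n" "norm x \<le> real n"
          using elim norm_ge_zero[of x] by linarith+
        then have "T (real n) (F x) = F x" "X (real n) x = 1"
          by (auto simp: T_def X_def)
        then show ?case by simp
      qed
    qed
    show "AE x in lebesgue. norm ((F x - T (real n) (F x) * X (real n) x)\<^sup>2) \<le> (F x)\<^sup>2" for n
      using shrink by (auto simp: abs_le_square_iff)
    show "(\<lambda>x. (F x - T (real n) (F x) * X (real n) x)\<^sup>2) \<in> borel_measurable lebesgue" for n
      using F(1) Tm[OF F(1)] Xm by measurable
  qed (use F in auto)
  from order_tendstoD(2)[OF this, of "e/4"] \<open>e > 0\<close>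
  obtain M :: nat where M: "(LINT x|lebesgue. (F x - T (real M) (F x) * X (real M) x)\<^sup>2) < e/4"
    by (auto simp: eventually_sequentially)
  define H where "H x = T (real M) (F x) * X (real M) x" for x
  have Hm: "H \<in> borel_measurable lebesgue"
    unfolding H_def using Tm[OF F(1)] Xm by measurable
  have FHm: "(\<lambda>x. (F x - H x)\<^sup>2) \<in> borel_measurable lebesgue"
    using F(1) Hm by measurable
  have FHi: "integrable lebesgue (\<lambda>x. (F x - H x)\<^sup>2)"
    by (rule Bochner_Integration.integrable_bound[OF F(2)])
       (use FHm in simp, use shrink in \<open>auto simp: H_def abs_le_square_iff\<close>)
  \<comment> \<open>This provides continuous functions converging to \<open>F\<close> off a
    negligible set, with no bound on them. Clamping and cutting them off exactly as \<open>F\<close>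
    supplies the dominating function \<open>?w\<close>.\<close>
  have "F measurable_on UNIV"
    by (rule lebesgue_measurable_imp_measurable_on[OF F(1)]) simp
  then obtain N k where N: "negligible N" and k: "\<And>n. continuous_on UNIV (k n)"
    "\<And>x. x \<notin> N \<Longrightarrow> (\<lambda>n. k n x) \<longlonglongrightarrow> F x"
    unfolding measurable_on_def by auto
  define \<Phi> where "\<Phi> n x = T (real M) (k n x) * X (real M) x" for n x
  have c\<Phi>: "continuous_on UNIV (\<Phi> n)" for n
    unfolding \<Phi>_def T_def by (intro continuous_intros contX k(1))
  have \<Phi>m: "\<Phi> n \<in> borel_measurable lebesgue" for n
    using borel_measurable_continuous_onI[OF c\<Phi>] by (simp add: measurable_completion)
  have \<Phi>0: "\<Phi> n x = 0" if "norm x > real M + 1" for n x using X0[OF that] by (simp add: \<Phi>_def)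
  let ?w = "\<lambda>x::'a. (2 * real M)\<^sup>2 * indicator (cball 0 (real M + 1)) x"
  have wi: "integrable lebesgue ?w"
    using emeasure_lborel_cball_finite[of "0::'a" "real M + 1"]
    by (intro integrable_mult_right integrable_real_indicator) auto
  have bound: "norm ((H x - \<Phi> n x)\<^sup>2) \<le> ?w x" for n x
  proof (cases "norm x > real M + 1")
    case True
    then show ?thesis using \<Phi>0 X0[OF True] by (simp add: H_def)
  next
    case False
    have "\<bar>H x\<bar> \<le> real M" "\<bar>\<Phi> n x\<bar> \<le> real M"
      using TM[of "real M"] X01[of M x] mult_mono[of "\<bar>T (real M) _\<bar>" "real M" "X (real M) x" 1]
      by (auto simp: H_def \<Phi>_def abs_mult)
    then have "\<bar>H x - \<Phi> n x\<bar> \<le> \<bar>2 * real M\<bar>" by linarith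
    then have "(H x - \<Phi> n x)\<^sup>2 \<le> (2 * real M)\<^sup>2" unfolding abs_le_square_iff .
    then show ?thesis using False by simp
  qed
  have "(\<lambda>n. LINT x|lebesgue. (H x - \<Phi> n x)\<^sup>2) \<longlonglongrightarrow> (LINT x|(lebesgue::'a measure). 0)"
  proof (rule integral_dominated_convergence[where w="?w"])
    have "N \<in> null_sets lebesgue" using N negligible_iff_null_sets by blast
    then have "AE x in lebesgue. x \<notin> N" by (rule AE_not_in)
    then show "AE x in lebesgue. (\<lambda>n. (H x - \<Phi> n x)\<^sup>2) \<longlonglongrightarrow> 0"
    proof eventually_elim
      case (elim x)
      have "(\<lambda>n. T (real M) (k n x)) \<longlonglongrightarrow> T (real M) (F x)"
        unfolding T_def by (intro tendsto_intros k(2) elim)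
      then have "(\<lambda>n. (H x - \<Phi> n x)\<^sup>2) \<longlonglongrightarrow> (H x - H x)\<^sup>2"
        unfolding \<Phi>_def H_def by (intro tendsto_intros)
      then show ?case by simp
    qed
    show "(\<lambda>x. (H x - \<Phi> n x)\<^sup>2) \<in> borel_measurable lebesgue" for n
      using Hm \<Phi>m by measurable
  qed (use wi bound in auto)
  from order_tendstoD(2)[OF this, of "e/4"] \<open>e > 0\<close>
  obtain n where n: "(LINT x|lebesgue. (H x - \<Phi> n x)\<^sup>2) < e/4"
    by (auto simp: eventually_sequentially)
  have HPi: "integrable lebesgue (\<lambda>x. (H x - \<Phi> n x)\<^sup>2)"
    by (rule Bochner_Integration.integrable_bound[OF wi]) (use bound Hm \<Phi>m in auto)
  have le: "(F x - \<Phi> n x)\<^sup>2 \<le> 2 * (F x - H x)\<^sup>2 + 2 * (H x - \<Phi> n x)\<^sup>2" for x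
    using sum_squares_bound[of "F x - H x" "H x - \<Phi> n x"]
    by (simp add: power2_eq_square algebra_simps)
  have si: "integrable lebesgue (\<lambda>x. 2 * (F x - H x)\<^sup>2 + 2 * (H x - \<Phi> n x)\<^sup>2)"
    using FHi HPi by simp
  have fi: "integrable lebesgue (\<lambda>x. (F x - \<Phi> n x)\<^sup>2)"
    by (rule Bochner_Integration.integrable_bound[OF si]) (use le F(1) \<Phi>m in auto)
  have "(LINT x|lebesgue. (F x - \<Phi> n x)\<^sup>2) \<le> (LINT x|lebesgue. 2 * (F x - H x)\<^sup>2 + 2 * (H x - \<Phi> n x)\<^sup>2)"
    by (rule integral_mono[OF fi si le])
  also have "\<dots> = 2 * (LINT x|lebesgue. (F x - H x)\<^sup>2) + 2 * (LINT x|lebesgue. (H x - \<Phi> n x)\<^sup>2)"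
    using FHi HPi by simp
  also have "\<dots> < e" using M n by (simp add: H_def)
  finally show ?thesis using that[of "\<Phi> n" "real M + 1"] c\<Phi> \<Phi>0 fi by auto
qed

text \<open>Jensen's inequality for the density \<open>\<rho> (x - y)\<close> in \<open>y\<close>,
  followed by Tonelli. The constant \<open>1\<close> does not depend on \<open>d\<close>, which is
  what the convergence proof relies on.\<close>

lemma conv_L2_le:
  fixes F :: "'a::euclidean_space \<Rightarrow> real"
  assumes \<rho>: "mollifier d \<rho>" and F: "integrable lebesgue F" "integrable lebesgue (\<lambda>x. (F x)\<^sup>2)"
  shows "integrable lebesgue (\<lambda>x. (conv F \<rho> x)\<^sup>2)"
    "(LINT x|lebesgue. (conv F \<rho> x)\<^sup>2) \<le> (LINT x|lebesgue. (F x)\<^sup>2)"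
proof -
  note m = mollifierD[OF \<rho>] and s = mollifier_integral_shift[OF \<rho>]
  have cc: "continuous_on UNIV (conv F \<rho>)" by (rule continuous_conv[OF F(1) m(7,6)])
  have cm: "conv F \<rho> \<in> borel_measurable borel" by (rule borel_measurable_continuous_onI[OF cc])
  have \<rho>m[measurable]: "\<rho> \<in> borel_measurable borel" by (rule borel_measurable_continuous_onI[OF m(7)])
  \<comment> \<open>Tonelli is applied to the product of two copies of \<open>lborel\<close>, so
    \<open>F\<close> is replaced by a Borel function equal to it almost everywhere.\<close>
  obtain F' where F'm[measurable]: "F' \<in> borel_measurable lborel" and ae: "AE x in lborel. F x = F' x"
    using completion_ex_borel_measurable_real[of F lborel] F(1) by auto
  have ae': "AE x in lebesgue. F x = F' x" using ae by (rule AE_completion)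
  have F2: "integrable lborel (\<lambda>x. (F' x)\<^sup>2)" "(LINT x|lborel. (F' x)\<^sup>2) = (LINT x|lebesgue. (F x)\<^sup>2)"
  proof -
    have m1: "(\<lambda>x. (F x)\<^sup>2) \<in> borel_measurable lebesgue" "(\<lambda>x. (F' x)\<^sup>2) \<in> borel_measurable lebesgue"
      using F(2) by (auto simp: measurable_completion)
    have "integrable lebesgue (\<lambda>x. (F x)\<^sup>2) = integrable lebesgue (\<lambda>x. (F' x)\<^sup>2)"
      by (rule integrable_cong_AE[OF m1]) (use ae' in auto)
    then show "integrable lborel (\<lambda>x. (F' x)\<^sup>2)"
      using F(2) by (simp add: integrable_completion)
    have "(LINT x|lebesgue. (F x)\<^sup>2) = (LINT x|lebesgue. (F' x)\<^sup>2)"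
      by (rule integral_cong_AE[OF m1]) (use ae' in auto)
    then show "(LINT x|lborel. (F' x)\<^sup>2) = (LINT x|lebesgue. (F x)\<^sup>2)"
      by (simp add: integral_completion)
  qed
  have jensen: "ennreal ((conv F \<rho> x)\<^sup>2) \<le> (\<integral>\<^sup>+ y. ennreal ((F' y)\<^sup>2 * \<rho> (x - y)) \<partial>lborel)" for x
  proof -
    define c where "c = conv F \<rho> x"
    have i1: "integrable lebesgue (\<lambda>y. F y * \<rho> (x - y))"
      using integrable_conv[OF F(1) m(7,6)] by simp
    have i2: "integrable lebesgue (\<lambda>y. (F y)\<^sup>2 * \<rho> (x - y))"
      using integrable_conv[OF F(2) m(7,6)] by simp
    \<comment> \<open>Jensen for the square is nonnegativity of the variance: \<open>c\<close> is
      the mean of \<open>F\<close> under this density.\<close>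
    have "0 \<le> (LINT y|lebesgue. (F y - c)\<^sup>2 * \<rho> (x - y))"
      by (intro Bochner_Integration.integral_nonneg mult_nonneg_nonneg m(2)) auto
    also have "\<dots> = (LINT y|lebesgue. (F y)\<^sup>2 * \<rho> (x - y) - 2 * c * (F y * \<rho> (x - y)) + c\<^sup>2 * \<rho> (x - y))"
      by (simp add: power2_eq_square algebra_simps)
    also have "\<dots> = (LINT y|lebesgue. (F y)\<^sup>2 * \<rho> (x - y)) - 2 * c * c + c\<^sup>2 * 1"
      using i1 i2 s(3,4)[of x] unfolding c_def conv_def by simp
    finally have "c\<^sup>2 \<le> (LINT y|lebesgue. (F y)\<^sup>2 * \<rho> (x - y))"
      by (simp add: power2_eq_square)
    also have "\<dots> = (LINT y|lebesgue. (F' y)\<^sup>2 * \<rho> (x - y))"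
      by (rule integral_cong_AE) (use i2 ae' in \<open>auto simp: measurable_completion\<close>)
    also have "\<dots> = (LINT y|lborel. (F' y)\<^sup>2 * \<rho> (x - y))"
      by (simp add: integral_completion)
    finally have "ennreal (c\<^sup>2) \<le> ennreal (LINT y|lborel. (F' y)\<^sup>2 * \<rho> (x - y))"
      by (rule ennreal_leI)
    also have "\<dots> = (\<integral>\<^sup>+ y. ennreal ((F' y)\<^sup>2 * \<rho> (x - y)) \<partial>lborel)"
    proof (rule nn_integral_eq_integral[symmetric])
      have "integrable lebesgue (\<lambda>y. (F' y)\<^sup>2 * \<rho> (x - y))"
        by (rule integrable_cong_AE_imp[OF i2]) (use ae' in \<open>auto simp: measurable_completion\<close>)
      then show "integrable lborel (\<lambda>y. (F' y)\<^sup>2 * \<rho> (x - y))" by (simp add: integrable_completion)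
    qed (simp add: m(2))
    finally show ?thesis by (simp add: c_def)
  qed
  have "(\<integral>\<^sup>+ x. ennreal ((conv F \<rho> x)\<^sup>2) \<partial>lborel)
      \<le> (\<integral>\<^sup>+ x. (\<integral>\<^sup>+ y. ennreal ((F' y)\<^sup>2 * \<rho> (x - y)) \<partial>lborel) \<partial>lborel)"
    by (intro nn_integral_mono jensen)
  also have "\<dots> = (\<integral>\<^sup>+ y. (\<integral>\<^sup>+ x. ennreal ((F' y)\<^sup>2 * \<rho> (x - y)) \<partial>lborel) \<partial>lborel)"
    by (rule lborel_pair.Fubini'[symmetric]) measurable
  also have "\<dots> = (\<integral>\<^sup>+ y. ennreal ((F' y)\<^sup>2) \<partial>lborel)"
  proof (intro nn_integral_cong)
    fix y
    have "(\<integral>\<^sup>+ x. ennreal ((F' y)\<^sup>2 * \<rho> (x - y)) \<partial>lborel) = (\<integral>\<^sup>+ x. ennreal ((F' y)\<^sup>2) * ennreal (\<rho> (y - x)) \<partial>lborel)"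
      using m(2,11) by (simp add: ennreal_mult')
    also have "\<dots> = ennreal ((F' y)\<^sup>2) * (\<integral>\<^sup>+ x. ennreal (\<rho> (y - x)) \<partial>lborel)"
      by (rule nn_integral_cmult) measurable
    also have "(\<integral>\<^sup>+ x. ennreal (\<rho> (y - x)) \<partial>lborel) = 1"
      using nn_integral_eq_integral[OF s(1)[of y]] s(2)[of y] m(2) by simp
    finally show "(\<integral>\<^sup>+ x. ennreal ((F' y)\<^sup>2 * \<rho> (x - y)) \<partial>lborel) = ennreal ((F' y)\<^sup>2)" by simp
  qed
  also have "\<dots> = ennreal (LINT x|lebesgue. (F x)\<^sup>2)"
    using nn_integral_eq_integral[OF F2(1)] F2(2) by simp
  finally have le: "(\<integral>\<^sup>+ x. ennreal ((conv F \<rho> x)\<^sup>2) \<partial>lborel) \<le> ennreal (LINT x|lebesgue. (F x)\<^sup>2)" .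
  have ci: "integrable lborel (\<lambda>x. (conv F \<rho> x)\<^sup>2)"
    by (rule integrableI_bounded) (use cm le in \<open>auto intro: le_less_trans\<close>)
  then show "integrable lebesgue (\<lambda>x. (conv F \<rho> x)\<^sup>2)"
    using cm by (simp add: integrable_completion)
  have "(LINT x|lborel. (conv F \<rho> x)\<^sup>2) \<le> (LINT x|lebesgue. (F x)\<^sup>2)"
    using le nn_integral_eq_integral[OF ci] by (simp add: ennreal_le_iff)
  then show "(LINT x|lebesgue. (conv F \<rho> x)\<^sup>2) \<le> (LINT x|lebesgue. (F x)\<^sup>2)"
    using cm by (simp add: integral_completion)
qed

text \<open>For a continuous \<open>\<Phi>\<close> of bounded support the mollifications converge
  uniformly; the remainder \<open>F - \<Phi>\<close> is handled by the L^2 contraction. The square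
  of a sum of three terms costs a factor \<open>3\<close>, whence the three portions of size
  \<open>e / 9\<close>.\<close>

lemma conv_L2_tendsto:
  fixes F :: "'a::euclidean_space \<Rightarrow> real"
  assumes F: "integrable lebesgue F" "integrable lebesgue (\<lambda>x. (F x)\<^sup>2)" and "e > 0"
  obtains \<delta> where "\<delta> > 0"
    "\<And>d \<rho>. mollifier d \<rho> \<Longrightarrow> d \<le> \<delta> \<Longrightarrow> integrable lebesgue (\<lambda>x. (conv F \<rho> x - F x)\<^sup>2) \<and>
       (LINT x|lebesgue. (conv F \<rho> x - F x)\<^sup>2) \<le> e"
proof -
  have Fm: "F \<in> borel_measurable lebesgue" using F(1) by simp
  obtain \<Phi> :: "'a \<Rightarrow> real" and R where \<Phi>: "continuous_on UNIV \<Phi>" "\<And>x. norm x > R \<Longrightarrow> \<Phi> x = 0" "R > 0"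
    and \<Phi>i: "integrable lebesgue (\<lambda>x. (F x - \<Phi> x)\<^sup>2)" and \<Phi>l: "(LINT x|lebesgue. (F x - \<Phi> x)\<^sup>2) < e / 9"
    using L2_approx_continuous[OF Fm F(2), of "e / 9"] \<open>e > 0\<close> by auto
  have P1: "integrable lebesgue \<Phi>"
    by (intro lebesgue_integral_eq_lborel \<Phi> borel_integrable_bounded_support[of \<Phi> R])
  define V where "V = measure lebesgue (cball (0::'a) (R + 1))"
  define \<eta> where "\<eta> = sqrt (e / (9 * (V + 1)))"
  have V: "V \<ge> 0" by (simp add: V_def)
  have \<eta>: "\<eta> > 0" using \<open>e > 0\<close> V by (simp add: \<eta>_def)
  have "\<eta>\<^sup>2 * V = e / (9 * (V + 1)) * V" using V \<open>e > 0\<close> by (simp add: \<eta>_def)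
  also have "\<dots> \<le> e / 9" using V \<open>e > 0\<close> by (simp add: field_simps)
  finally have \<eta>V: "\<eta>\<^sup>2 * V \<le> e / 9" .
  obtain \<delta> where \<delta>: "\<delta> > 0" "\<And>x y. norm (x - y) < \<delta> \<Longrightarrow> norm (\<Phi> x - \<Phi> y) < \<eta>"
    using uniformly_continuous_bounded_support[OF \<Phi>(1,2) \<eta>] by blast
  show ?thesis
  proof (rule that[of "min \<delta> 1"])
    fix d and \<rho> :: "'a \<Rightarrow> real" assume \<rho>: "mollifier d \<rho>" and d: "d \<le> min \<delta> 1"
    note m = mollifierD[OF \<rho>]
    have D1: "integrable lebesgue (\<lambda>x. F x - \<Phi> x)" using F(1) P1 by simp
    note L = conv_L2_le[OF \<rho> D1 \<Phi>i]
    let ?w = "\<lambda>x::'a. \<eta>\<^sup>2 * indicator (cball 0 (R + 1)) x"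
    have wi: "integrable lebesgue ?w"
      using emeasure_lborel_cball_finite[of "0::'a" "R + 1"]
      by (intro integrable_mult_right integrable_real_indicator) auto
    have mid: "(conv \<Phi> \<rho> x - \<Phi> x)\<^sup>2 \<le> ?w x" for x
    proof (cases "norm x > R + 1")
      case True
      have "conv \<Phi> \<rho> x = 0"
      proof (rule ccontr)
        assume "conv \<Phi> \<rho> x \<noteq> 0"
        then obtain y where "\<Phi> y \<noteq> 0" "norm (x - y) < d" using conv_nonzeroD[OF \<rho>] by blast
        then show False using \<Phi>(2)[of y] True d norm_triangle_ineq2[of x y] by force
      qed
      then show ?thesis using True \<Phi>(2)[of x] by simp
    next
      case False
      have "\<bar>conv \<Phi> \<rho> x - \<Phi> x\<bar> \<le> \<eta>"
        by (rule conv_close[OF \<rho> P1]) (use \<delta>(2) d in \<open>force intro: less_imp_le\<close>)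
      then have "(conv \<Phi> \<rho> x - \<Phi> x)\<^sup>2 \<le> \<eta>\<^sup>2" using \<eta> by (simp add: abs_le_square_iff[symmetric])
      then show ?thesis using False by simp
    qed
    have lin: "conv F \<rho> x = conv (\<lambda>x. F x - \<Phi> x) \<rho> x + conv \<Phi> \<rho> x" for x
      using integrable_conv[OF D1 m(7), of d x] integrable_conv[OF P1 m(7), of d x] m(6)
      unfolding conv_def
      by (subst Bochner_Integration.integral_add[symmetric]) (auto simp: algebra_simps)
    have sq3: "(a + b + c)\<^sup>2 \<le> 3 * a\<^sup>2 + 3 * b\<^sup>2 + 3 * c\<^sup>2" for a b c :: real
      using sum_squares_bound[of a b] sum_squares_bound[of b c] sum_squares_bound[of a c]
      by (simp add: power2_eq_square algebra_simps)
    let ?s = "\<lambda>x. 3 * (conv (\<lambda>x. F x - \<Phi> x) \<rho> x)\<^sup>2 + 3 * ?w x + 3 * (F x - \<Phi> x)\<^sup>2"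
    have le: "(conv F \<rho> x - F x)\<^sup>2 \<le> ?s x" for x
    proof -
      have "conv F \<rho> x - F x = conv (\<lambda>x. F x - \<Phi> x) \<rho> x + (conv \<Phi> \<rho> x - \<Phi> x) + (\<Phi> x - F x)"
        using lin by simp
      then have "(conv F \<rho> x - F x)\<^sup>2 \<le> 3 * (conv (\<lambda>x. F x - \<Phi> x) \<rho> x)\<^sup>2 +
          3 * (conv \<Phi> \<rho> x - \<Phi> x)\<^sup>2 + 3 * (\<Phi> x - F x)\<^sup>2" using sq3 by metis
      also have "\<dots> \<le> ?s x" using mid[of x] by (simp add: power2_commute)
      finally show ?thesis .
    qed
    have si: "integrable lebesgue ?s" using L(1) wi \<Phi>i by simp
    have cm: "conv F \<rho> \<in> borel_measurable lebesgue"
      using borel_measurable_continuous_onI[OF continuous_conv[OF F(1) m(7,6)]]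
      by (simp add: measurable_completion)
    have ci: "integrable lebesgue (\<lambda>x. (conv F \<rho> x - F x)\<^sup>2)"
      by (rule Bochner_Integration.integrable_bound[OF si]) (use le cm Fm in \<open>auto intro: order_trans\<close>)
    have "(LINT x|lebesgue. (conv F \<rho> x - F x)\<^sup>2) \<le> integral\<^sup>L lebesgue ?s"
      by (rule integral_mono[OF ci si le])
    also have "\<dots> = 3 * (LINT x|lebesgue. (conv (\<lambda>x. F x - \<Phi> x) \<rho> x)\<^sup>2) + 3 * (\<eta>\<^sup>2 * V)
        + 3 * (LINT x|lebesgue. (F x - \<Phi> x)\<^sup>2)"
      using L(1) wi \<Phi>i by (simp add: V_def)
    also have "\<dots> \<le> e" using L(2) \<eta>V \<Phi>l by simp
    finally show "integrable lebesgue (\<lambda>x. (conv F \<rho> x - F x)\<^sup>2) \<and>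
       (LINT x|lebesgue. (conv F \<rho> x - F x)\<^sup>2) \<le> e" using ci by simp
  qed (use \<delta> in simp)
qed

section \<open>Comparison with strict subsolutions\<close>

text \<open>Extension by zero makes convolution on the whole space possible. On a bounded set L^2
  embeds into L^1 through the elementary bound of \<open>\<bar>t\<bar>\<close> by
  \<open>1 + t^2\<close>.\<close>

lemma L2_on_components:
  fixes G :: "'a::euclidean_space \<Rightarrow> 'a"
  assumes "open \<Omega>" "bounded \<Omega>" "L2_on \<Omega> G"
  defines "G0 \<equiv> \<lambda>x. indicator \<Omega> x *\<^sub>R G x"
  shows "G0 \<in> borel_measurable lebesgue" "integrable lebesgue (\<lambda>x. (G0 x \<bullet> b)\<^sup>2)"
    "integrable lebesgue (\<lambda>x. G0 x \<bullet> b)"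
proof -
  show m: "G0 \<in> borel_measurable lebesgue"
    using assms(3) by (simp add: L2_on_def set_borel_measurable_def G0_def)
  have n: "integrable lebesgue (\<lambda>x. (norm (G0 x))\<^sup>2)"
  proof -
    have "(\<lambda>x. indicator \<Omega> x *\<^sub>R (norm (G x))\<^sup>2) = (\<lambda>x. (norm (G0 x))\<^sup>2)"
      by (auto simp: G0_def indicator_def)
    then show ?thesis using assms(3) by (simp add: L2_on_def set_integrable_def)
  qed
  have "(G0 x \<bullet> b)\<^sup>2 \<le> (norm b)\<^sup>2 * (norm (G0 x))\<^sup>2" for x
    using Cauchy_Schwarz_ineq[of "G0 x" b] by (simp add: power2_norm_eq_inner mult.commute)
  then show i2: "integrable lebesgue (\<lambda>x. (G0 x \<bullet> b)\<^sup>2)"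
    using m by (intro Bochner_Integration.integrable_bound[OF integrable_mult_right[OF n, of "(norm b)\<^sup>2"]]) auto
  have o: "integrable lebesgue (indicator \<Omega> :: 'a \<Rightarrow> real)"
    using emeasure_bounded_finite[OF assms(2)] assms(1)
    by (intro integrable_real_indicator) (auto simp: borel_open)
  have b: "\<bar>G0 x \<bullet> b\<bar> \<le> indicator \<Omega> x + (G0 x \<bullet> b)\<^sup>2" for x
  proof (cases "x \<in> \<Omega>")
    case True
    have "0 \<le> (\<bar>G0 x \<bullet> b\<bar> - 1)\<^sup>2" by simp
    then have "2 * \<bar>G0 x \<bullet> b\<bar> \<le> 1 + (G0 x \<bullet> b)\<^sup>2"
      by (simp add: power2_diff)
    then show ?thesis using True by simp
  qed (simp add: G0_def)
  show "integrable lebesgue (\<lambda>x. G0 x \<bullet> b)"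
    by (rule Bochner_Integration.integrable_bound[OF Bochner_Integration.integrable_add[OF o i2]])
       (use m b in auto)
qed

text \<open>If the ball fits into \<open>\<Omega>\<close>, the reflected kernel
  \<open>\<lambda>y. \<rho> (x - y)\<close> is itself a test function, and the claim is the
  definition of the weak gradient applied to it.\<close>

lemma grad_conv_weak_gradient:
  fixes u :: "'a::euclidean_space \<Rightarrow> real"
  assumes \<rho>: "mollifier d \<rho>" and u: "integrable lebesgue (\<lambda>x. indicator \<Omega> x * u x)"
    and G: "is_weak_gradient \<Omega> u G" and x: "cball x d \<subseteq> \<Omega>" and b: "b \<in> Basis"
  shows "grad (conv (\<lambda>x. indicator \<Omega> x * u x) \<rho>) x \<bullet> b = conv (\<lambda>y. (indicator \<Omega> y *\<^sub>R G y) \<bullet> b) \<rho> x"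
proof -
  note m = mollifierD[OF \<rho>]
  define \<phi> where "\<phi> = (\<lambda>y. \<rho> (x - y))"
  have \<phi>: "\<phi> = (\<lambda>y. \<rho> (y - x))" using m(11) by (simp add: \<phi>_def)
  have "smooth \<phi>" unfolding \<phi> using m(1) by (auto simp: smooth_def intro: C_class_shift)
  moreover have sub: "{y. \<phi> y \<noteq> 0} \<subseteq> cball x d"
  proof
    fix y assume "y \<in> {y. \<phi> y \<noteq> 0}"
    then have "\<not> d \<le> norm (x - y)" using m(4) by (auto simp: \<phi>_def)
    then show "y \<in> cball x d" by (simp add: dist_norm)
  qed
  moreover have "closure {y. \<phi> y \<noteq> 0} \<subseteq> cball x d"
    using sub by (intro closure_minimal) auto
  moreover have "compact (closure {y. \<phi> y \<noteq> 0})"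
    using sub bounded_subset bounded_cball by (simp add: compact_closure) blast
  ultimately have t: "\<phi> \<in> test_functions \<Omega>"
    using x by (auto simp: test_functions_def)
  have g: "grad \<phi> y = - grad \<rho> (x - y)" for y
    unfolding \<phi>_def by (rule grad_eq) (rule GDERIV_reflect, rule m(8))
  have "grad (conv (\<lambda>x. indicator \<Omega> x * u x) \<rho>) x \<bullet> b =
      (LINT y|lebesgue. indicator \<Omega> y * u y * (grad \<rho> (x - y) \<bullet> b))"
    by (rule GDERIV_conv_mollifier(2)[OF \<rho> u b])
  also have "\<dots> = - (LINT y:\<Omega>|lebesgue. u y * (grad \<phi> y \<bullet> b))"
    by (simp add: set_lebesgue_integral_def g mult.assoc)
  also have "\<dots> = (LINT y:\<Omega>|lebesgue. (G y \<bullet> b) * \<phi> y)"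
    using G t b by (simp add: is_weak_gradient_def)
  finally show ?thesis
    by (simp add: set_lebesgue_integral_def conv_def \<phi>_def mult.assoc)
qed

section \<open>Extension by zero and elementary inequalities\<close>

text \<open>The open sets \<open>V\<close> and \<open>- S\<close> cover the space and the glued
  function is zero on the second. This serves to make global functions out of expressions in the
  barrier, which is controlled on \<open>U\<close> alone.\<close>

lemma continuous_on_glue_zero:
  fixes f :: "'a::topological_space \<Rightarrow> 'b::{zero,topological_space}"
  assumes "open V" "closed S" "S \<subseteq> V" "continuous_on V f" "\<And>x. x \<in> V \<Longrightarrow> x \<notin> S \<Longrightarrow> f x = 0"
  shows "continuous_on UNIV (\<lambda>x. if x \<in> V then f x else 0)"
proof -
  have "continuous_on (V \<union> - S) (\<lambda>x. if x \<in> V then f x else 0)"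
  proof (rule continuous_on_open_Un)
    show "continuous_on V (\<lambda>x. if x \<in> V then f x else 0)"
      using assms(4) by (simp cong: continuous_on_cong)
    have "continuous_on (- S) (\<lambda>x. 0 :: 'b)" by simp
    then show "continuous_on (- S) (\<lambda>x. if x \<in> V then f x else 0)"
      by (rule continuous_on_eq) (use assms(5) in auto)
  qed (use assms in auto)
  moreover have "V \<union> - S = UNIV" using assms(3) by auto
  ultimately show ?thesis by simp
qed

lemma GDERIV_glue_zero:
  assumes "open V" "closed S" "S \<subseteq> V" "\<And>x. x \<in> V \<Longrightarrow> GDERIV f x :> D x"
    "\<And>x. x \<in> V \<Longrightarrow> x \<notin> S \<Longrightarrow> f x = 0 \<and> D x = 0"
  shows "GDERIV (\<lambda>x. if x \<in> V then f x else 0) x :> (if x \<in> V then D x else 0)"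
proof (cases "x \<in> V")
  case True
  have "(f has_derivative (\<lambda>h. h \<bullet> D x)) (at x)" using assms(4)[OF True] by (simp add: gderiv_def)
  then have "((\<lambda>x. if x \<in> V then f x else 0) has_derivative (\<lambda>h. h \<bullet> D x)) (at x)"
    by (rule has_derivative_transform_within_open[OF _ assms(1) True]) auto
  then show ?thesis using True by (simp add: gderiv_def)
next
  case False
  then have x: "x \<in> - S" using assms(3) by auto
  have "((\<lambda>x. 0) has_derivative (\<lambda>h. 0)) (at x)" by simp
  then have "((\<lambda>x. if x \<in> V then f x else 0) has_derivative (\<lambda>h. 0)) (at x)"
    by (rule has_derivative_transform_within_open[OF _ _ x]) (use assms(2,5) in auto)
  then show ?thesis using False by (simp add: gderiv_def)
qed

lemma max_0_square_deriv: "((\<lambda>t. (max 0 t)\<^sup>2) has_real_derivative 2 * max 0 t) (at (t::real))"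
proof -
  consider "t > 0" | "t < 0" | "t = 0" by linarith
  then show ?thesis
  proof cases
    case 1
    have "((\<lambda>t. t\<^sup>2) has_real_derivative 2 * max 0 t) (at t)"
      using 1 by (auto intro!: derivative_eq_intros)
    then show ?thesis
      by (rule has_field_derivative_transform_within_open[where S="{0<..}"]) (use 1 in auto)
  next
    case 2
    have "((\<lambda>t. 0) has_real_derivative 2 * max 0 t) (at t)" using 2 by simp
    then show ?thesis
      by (rule has_field_derivative_transform_within_open[where S="{..<0}"]) (use 2 in auto)
  next
    case 3
    have "((\<lambda>h. (max 0 (0 + h))\<^sup>2 / h) \<longlongrightarrow> 0) (at (0::real))"
    proof (rule Lim_null_comparison)
      show "\<forall>\<^sub>F h in at 0. norm ((max 0 (0 + h))\<^sup>2 / h) \<le> \<bar>h::real\<bar>"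
        by (auto simp: eventually_at_filter power2_eq_square max_def)
      show "((\<lambda>h. \<bar>h\<bar>) \<longlongrightarrow> 0) (at (0::real))" by (auto intro!: tendsto_eq_intros)
    qed
    then show ?thesis using 3 by (simp add: DERIV_def)
  qed
qed

text \<open>Young's inequality without the factor 1/2. A small \<open>t\<close> suppresses the
  quantity that is merely bounded, at the cost of a large factor on the one that tends to
  zero.\<close>

lemma weighted_product_le:
  fixes x y t :: real
  assumes "t > 0"
  shows "\<bar>x\<bar> * \<bar>y\<bar> \<le> t * x\<^sup>2 + y\<^sup>2 / t"
proof -
  have "0 \<le> (t * \<bar>x\<bar> - \<bar>y\<bar>)\<^sup>2" by simp
  then have "2 * t * (\<bar>x\<bar> * \<bar>y\<bar>) \<le> t\<^sup>2 * x\<^sup>2 + y\<^sup>2"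
    by (simp add: power2_diff power_mult_distrib algebra_simps)
  moreover have "0 \<le> t * (\<bar>x\<bar> * \<bar>y\<bar>)" using assms by simp
  ultimately have "t * (\<bar>x\<bar> * \<bar>y\<bar>) \<le> t\<^sup>2 * x\<^sup>2 + y\<^sup>2"
    by linarith
  also have "\<dots> = t * (t * x\<^sup>2 + y\<^sup>2 / t)"
    using assms by (simp add: power2_eq_square distrib_left)
  finally show ?thesis using assms by simp
qed

lemma inner_eq_sum_nth: "x \<bullet> y = (\<Sum>i\<in>UNIV. x $ i * y $ i)" for x y :: "real^'n"
  by (simp add: inner_vec_def)

text \<open>The test function is \<open>((v - u\<^sub>d - \<epsilon>)\<^sup>+)\<^sup>2\<close>, where \<open>u\<^sub>d\<close> is a mollification of \<open>u\<close>.
  Since \<open>v\<close> is a strict subsolution, the monotonicity of the flux is already contradicted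
  up to an error which is small with \<open>d\<close>.\<close>

lemma comparison_strict_subsolution:
  fixes \<Omega> U :: "(real^'n) set" and u v :: "real^'n \<Rightarrow> real" and G Dv :: "real^'n \<Rightarrow> real^'n"
    and a :: "'n \<Rightarrow> real \<Rightarrow> real" and q :: "'n \<Rightarrow> real^'n \<Rightarrow> real"
  assumes \<Omega>: "open \<Omega>" "bounded \<Omega>" and u: "continuous_on (closure \<Omega>) u"
    and G: "L2_on \<Omega> G" "is_weak_gradient \<Omega> u G"
    and a: "\<And>i. continuous_on UNIV (a i)" "\<And>i. mono (a i)" "\<And>i s. \<bar>a i s\<bar> \<le> C * \<bar>s\<bar>"
    and weak: "\<And>\<eta>. \<eta> \<in> test_functions \<Omega> \<Longrightarrow> (\<forall>x\<in>\<Omega>. 0 \<le> \<eta> x) \<Longrightarrow>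
       0 \<le> (LINT x:\<Omega>|lebesgue. (\<chi> i. a i (G x $ i)) \<bullet> grad \<eta> x)"
    and U: "open U" "U \<subseteq> \<Omega>"
    and v: "continuous_on (closure U) v" "\<And>x. x \<in> U \<Longrightarrow> GDERIV v x :> Dv x" "continuous_on U Dv"
    and q: "\<And>i x. x \<in> U \<Longrightarrow>
       ((\<lambda>s. a i (Dv (x + s *\<^sub>R axis i 1) $ i)) has_real_derivative q i x) (at 0)"
      "\<And>i. continuous_on U (q i)" "\<And>x. x \<in> U \<Longrightarrow> 0 < (\<Sum>i\<in>UNIV. q i x)"
    and bd: "\<And>x. x \<in> frontier U \<Longrightarrow> v x \<le> u x"
    and x0: "x0 \<in> U"
  shows "v x0 \<le> u x0"
proof (rule ccontr)
  assume "\<not> v x0 \<le> u x0"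
  define w where "w x = v x - u x" for x
  define \<epsilon> where "\<epsilon> = w x0 / 2"
  have \<epsilon>: "\<epsilon> > 0" "w x0 = 2 * \<epsilon>" using \<open>\<not> v x0 \<le> u x0\<close> by (auto simp: \<epsilon>_def w_def)
  have Ucl: "closure U \<subseteq> closure \<Omega>" by (rule closure_mono[OF U(2)])
  have cw: "continuous_on (closure U) w"
    unfolding w_def by (intro continuous_intros v continuous_on_subset[OF u Ucl])
  have bU: "bounded (closure U)" using \<Omega>(2) U(2) bounded_subset bounded_closure by blast
  have kU: "compact (closure U)" using bU by (simp add: compact_eq_bounded_closed)
  \<comment> \<open>The level \<open>\<epsilon> / 2\<close> leaves room for a mollification error of
    \<open>\<epsilon> / 4\<close>: off \<open>S\<close> the difference
    \<open>v - ud - \<epsilon>\<close> stays negative. On the frontier \<open>w\<close> is at most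
    zero, so \<open>S\<close> is a compact part of \<open>U\<close>.\<close>
  define S where "S = {x \<in> closure U. \<epsilon> / 2 \<le> w x}"
  have Scl: "closed S"
    unfolding S_def by (intro continuous_on_closed_Collect_le cw continuous_on_const) auto
  have Sk: "compact S"
    using compact_Int_closed[OF kU Scl] by (simp add: S_def Int_def conj_ac)
  have SU: "S \<subseteq> U"
  proof
    fix x assume x: "x \<in> S"
    show "x \<in> U"
    proof (rule ccontr)
      assume "x \<notin> U"
      then have "x \<in> frontier U" using x U(1) by (simp add: S_def frontier_def interior_open)
      then have "w x \<le> 0" using bd by (simp add: w_def)
      then show False using x \<epsilon> by (simp add: S_def)
    qed
  qed
  obtain e where e: "e > 0" "(\<Union>x\<in>S. ball x e) \<subseteq> U"
    using compact_subset_open_imp_ball_epsilon_subset[OF Sk U(1) SU] by blast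
  \<comment> \<open>One step of size \<open>r\<close> leads from \<open>S\<close> to
    \<open>V\<close>, another covers a kernel of radius at most \<open>r\<close>; together they stay
    within \<open>e\<close> of \<open>S\<close>, hence in \<open>U\<close>.\<close>
  define r where "r = e / 3"
  have r: "r > 0" using e by (simp add: r_def)
  define V where "V = (\<Union>x\<in>S. ball x r)"
  define K where "K = {x + y |x y. x \<in> S \<and> y \<in> cball 0 r}"
  have K: "compact K" unfolding K_def by (rule compact_sums[OF Sk compact_cball])
  have KD: "\<exists>x\<in>S. dist x y \<le> r" if y: "y \<in> K" for y
  proof -
    obtain x z where "y = x + z" "x \<in> S" "norm z \<le> r" using y by (auto simp: K_def)
    then show ?thesis by (intro bexI[of _ x]) (auto simp: dist_norm)
  qed
  have KU: "K \<subseteq> U"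
  proof
    fix y assume "y \<in> K"
    then obtain x where "x \<in> S" "y \<in> ball x e" using KD r by (force simp: r_def)
    then show "y \<in> U" using e(2) by blast
  qed
  have VK: "V \<subseteq> K"
  proof
    fix y assume "y \<in> V"
    then obtain x where x: "x \<in> S" "dist x y < r" by (auto simp: V_def)
    have "y = x + (y - x)" "y - x \<in> cball 0 r" using x by (auto simp: dist_norm norm_minus_commute)
    then show "y \<in> K" using x unfolding K_def by blast
  qed
  have Vo: "open V" by (auto simp: V_def)
  have SV: "S \<subseteq> V" using r by (force simp: V_def)
  have VU: "V \<subseteq> U" using VK KU by blast
  have x0V: "x0 \<in> V"
    using SV x0 \<epsilon> closure_subset[of U] by (auto simp: S_def)
  have cwV: "continuous_on V w"
    using VU closure_subset by (intro continuous_on_subset[OF cw]) blast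
  obtain B where B: "\<And>x. x \<in> S \<Longrightarrow> norm x \<le> B"
    using compact_imp_bounded[OF Sk] unfolding bounded_iff by blast
  obtain \<delta>1 where \<delta>1: "\<delta>1 > 0" and
    uc: "\<And>x y. x \<in> closure \<Omega> \<Longrightarrow> y \<in> closure \<Omega> \<Longrightarrow> dist y x < \<delta>1 \<Longrightarrow> dist (u y) (u x) < \<epsilon> / 4"
  proof -
    have "compact (closure \<Omega>)" using \<Omega>(2) by (simp add: compact_closure)
    then have "uniformly_continuous_on (closure \<Omega>) u" using u compact_uniformly_continuous by blast
    then show ?thesis
    proof (rule uniformly_continuous_onE)
      show "0 < \<epsilon> / 4" using \<epsilon>(1) by simp
    qed (use that in blast)
  qed

  \<comment> \<open>Integrability of \<open>u\<close>, its weak gradient and the flux\<close>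
  define u0 where "u0 = (\<lambda>x. indicator \<Omega> x * u x)"
  have u0i: "integrable lebesgue u0"
  proof -
    have "compact (u ` closure \<Omega>)"
      using \<Omega>(2) u by (intro compact_continuous_image) (auto simp: compact_closure)
    then have "bounded (u ` closure \<Omega>)" by (rule compact_imp_bounded)
    then obtain M where M: "\<And>x. x \<in> closure \<Omega> \<Longrightarrow> \<bar>u x\<bar> \<le> M"
      unfolding bounded_iff by auto
    have "u0 \<in> borel_measurable borel"
      using borel_measurable_continuous_on_indicator[of \<Omega> u] \<Omega>(1) continuous_on_subset[OF u closure_subset]
      by (simp add: u0_def borel_open)
    then have m: "u0 \<in> borel_measurable lebesgue" by (simp add: measurable_completion)
    have o: "integrable lebesgue (\<lambda>x. M * indicator \<Omega> x)"
      using emeasure_bounded_finite[OF \<Omega>(2)] \<Omega>(1)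
      by (intro integrable_mult_right integrable_real_indicator) (auto simp: borel_open)
    have bnd: "norm (u0 x) \<le> norm (M * indicator \<Omega> x)" for x
    proof (cases "x \<in> \<Omega>")
      case True
      then have "\<bar>u x\<bar> \<le> M" using M closure_subset by blast
      then show ?thesis using True by (simp add: u0_def)
    qed (simp add: u0_def)
    show ?thesis by (rule Bochner_Integration.integrable_bound[OF o m]) (use bnd in simp)
  qed
  define G0 where "G0 = (\<lambda>x. indicator \<Omega> x *\<^sub>R G x)"
  note L2 = L2_on_components[OF \<Omega> G(1), folded G0_def]
  have G0m: "G0 \<in> borel_measurable lebesgue" by (rule L2(1))
  have G0i: "integrable lebesgue (\<lambda>x. G0 x $ i)" "integrable lebesgue (\<lambda>x. (G0 x $ i)\<^sup>2)" for i
    using L2(2,3)[of "axis i 1"] by (simp_all add: inner_axis G0_def)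
  define A where "A = (\<lambda>x. \<chi> i. a i (G0 x $ i))"
  have Ai: "integrable lebesgue A"
  proof (rule Bochner_Integration.integrable_bound)
    show "integrable lebesgue (\<lambda>x. \<Sum>i\<in>UNIV. C * \<bar>G0 x $ i\<bar>)"
      using G0i by (intro Bochner_Integration.integrable_sum integrable_mult_right) auto
    have "continuous_on UNIV (\<lambda>p::real^'n. \<chi> i. a i (p $ i))"
      by (intro continuous_on_vec_lambda continuous_on_compose2[OF a(1)] continuous_intros) auto
    from measurable_compose[OF G0m borel_measurable_continuous_onI[OF this]]
    show "A \<in> borel_measurable lebesgue" by (simp add: A_def)
    show "AE x in lebesgue. norm (A x) \<le> norm (\<Sum>i\<in>UNIV. C * \<bar>G0 x $ i\<bar>)"
    proof (rule AE_I2)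
      fix x
      have "norm (A x) \<le> (\<Sum>i\<in>UNIV. \<bar>A x $ i\<bar>)" by (rule norm_le_l1_cart)
      also have "\<dots> \<le> (\<Sum>i\<in>UNIV. C * \<bar>G0 x $ i\<bar>)"
        by (intro sum_mono) (simp add: A_def a(3))
      finally show "norm (A x) \<le> norm (\<Sum>i\<in>UNIV. C * \<bar>G0 x $ i\<bar>)" by simp
    qed
  qed

  \<comment> \<open>Constants independent of the mollification\<close>
  obtain M where M: "\<And>x. x \<in> closure U \<Longrightarrow> \<bar>w x\<bar> \<le> M"
  proof -
    have "bounded (w ` closure U)"
      using compact_continuous_image[OF cw kU] by (rule compact_imp_bounded)
    then show ?thesis using that unfolding bounded_iff by auto
  qed
  have M0: "M \<ge> 0" using M[of x0] x0 closure_subset[of U] by (metis abs_ge_zero order_trans subsetD)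
  \<comment> \<open>An upper bound for the scalar factor \<open>2 * h x\<close> in the gradient of
    the test function, valid for every admissible mollification.\<close>
  define H where "H = 2 * (M + \<epsilon>)"
  have H: "H > 0" using M0 \<epsilon> by (simp add: H_def)
  have cB: "continuous_on U (\<lambda>x. a i (Dv x $ i))" for i
    by (intro continuous_on_compose2[OF a(1)] continuous_intros v(3)) auto
  obtain b0 where b0: "\<And>i x. x \<in> K \<Longrightarrow> \<bar>a i (Dv x $ i)\<bar> \<le> b0"
  proof -
    have "continuous_on K (\<lambda>x. \<chi> i. a i (Dv x $ i))"
      by (intro continuous_on_vec_lambda continuous_on_subset[OF cB KU])
    then have "bounded ((\<lambda>x. \<chi> i. a i (Dv x $ i)) ` K)"
      using K compact_continuous_image compact_imp_bounded by blast
    then obtain b0 where "\<And>x. x \<in> K \<Longrightarrow> norm (\<chi> i. a i (Dv x $ i)) \<le> b0"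
      unfolding bounded_iff by auto
    moreover have "\<bar>a i (Dv x $ i)\<bar> \<le> norm (\<chi> i. a i (Dv x $ i))" for i x
      using component_le_norm_cart[of "\<chi> i. a i (Dv x $ i)" i] by simp
    ultimately show ?thesis using that[of b0] order_trans by blast
  qed
  \<comment> \<open>An integrable majorant of the squared difference between the fluxes of
    \<open>u\<close> and of the barrier. The second summand is confined to the compact
    \<open>K\<close>, where the barrier flux is bounded.\<close>
  define Y where "Y = (\<lambda>i x. 2 * C\<^sup>2 * (G0 x $ i)\<^sup>2 + 2 * b0\<^sup>2 * indicator K x)"
  have Yi: "integrable lebesgue (Y i)" for i
    using emeasure_bounded_finite[OF compact_imp_bounded[OF K]] compact_imp_closed[OF K] G0i
    unfolding Y_def
    by (intro Bochner_Integration.integrable_add integrable_mult_right integrable_real_indicator) (auto simp: borel_closed)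
  have Y0: "Y i x \<ge> 0" for i x by (simp add: Y_def)
  define I where "I = (\<Sum>i\<in>UNIV. LINT x|lebesgue. Y i x)"
  have I0: "I \<ge> 0" unfolding I_def by (intro sum_nonneg Bochner_Integration.integral_nonneg Y0)
  let ?Q = "\<lambda>x. \<Sum>i\<in>UNIV. q i x"
  have cQ: "continuous_on U ?Q" by (intro continuous_intros q(2))
  \<comment> \<open>Where \<open>w > 3 * \<epsilon> / 2\<close>, subtracting
    \<open>\<epsilon>\<close> and the mollification error \<open>\<epsilon> / 4\<close> leaves
    \<open>h\<close> at least \<open>\<epsilon> / 4\<close>. This makes the gain
    \<open>\<kappa>\<close> independent of the radius \<open>d\<close>.\<close>
  have "open {x \<in> V. 3 * \<epsilon> / 2 < w x}"
    using continuous_open_preimage[OF cwV Vo, of "{3 * \<epsilon> / 2<..}"]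
    by (simp add: vimage_def Int_def)
  moreover have "x0 \<in> {x \<in> V. 3 * \<epsilon> / 2 < w x}" using x0V \<epsilon> by simp
  ultimately obtain r0 where r0: "r0 > 0" "cball x0 r0 \<subseteq> {x \<in> V. 3 * \<epsilon> / 2 < w x}"
    using open_contains_cball by blast
  obtain q0 where q0: "q0 > 0" "\<And>x. x \<in> cball x0 r0 \<Longrightarrow> q0 \<le> ?Q x"
  proof -
    have sub: "cball x0 r0 \<subseteq> U" using r0(2) VU by blast
    have "cball x0 r0 \<noteq> {}" using r0(1) by simp
    from continuous_attains_inf[OF compact_cball this continuous_on_subset[OF cQ sub]]
    obtain y where y: "y \<in> cball x0 r0" "\<forall>x\<in>cball x0 r0. ?Q y \<le> ?Q x" by blast
    show ?thesis
    proof (rule that[of "?Q y"])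
      show "0 < ?Q y" using q(3)[of y] y(1) sub by blast
    qed (use y(2) in blast)
  qed
  define K0 where "K0 = (\<lambda>x::real^'n. q0 * (\<epsilon> / 4)\<^sup>2 * indicator (ball x0 r0) x)"
  have K0i: "integrable lborel K0"
    unfolding K0_def using emeasure_lborel_ball_finite[of x0 r0]
    by (intro integrable_mult_right integrable_real_indicator) auto
  define \<kappa> where "\<kappa> = integral\<^sup>L lborel K0"
  have \<kappa>: "\<kappa> > 0"
    unfolding \<kappa>_def
    by (rule lborel_integral_pos[OF K0i, of "ball x0 r0"]) (use q0 r0 \<epsilon> in \<open>auto simp: K0_def\<close>)
  \<comment> \<open>The order of choice matters: \<open>\<theta>\<close> depends on
    \<open>\<kappa>\<close> and makes the majorant term at most \<open>\<kappa> / 4\<close>; then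
    \<open>e1\<close> depends on \<open>\<theta>\<close> and makes the convergence term
    \<open>\<kappa> / 4\<close>. Half of the gain survives.\<close>
  define \<theta> where "\<theta> = \<kappa> / (4 * H * (I + 1))"
  have \<theta>: "\<theta> > 0" using \<kappa> H I0 by (simp add: \<theta>_def)
  define e1 where "e1 = \<kappa> * \<theta> / (4 * H * real CARD('n))"
  have e1: "e1 > 0" using \<kappa> \<theta> H by (simp add: e1_def)
  define P where "P = (\<lambda>i \<delta>. \<delta> > 0 \<and> (\<forall>d \<rho>. mollifier d \<rho> \<longrightarrow> d \<le> \<delta> \<longrightarrow>
      integrable lebesgue (\<lambda>x. (conv (\<lambda>y. G0 y $ i) \<rho> x - G0 x $ i)\<^sup>2) \<and>
      (LINT x|lebesgue. (conv (\<lambda>y. G0 y $ i) \<rho> x - G0 x $ i)\<^sup>2) \<le> e1))"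
  have "\<exists>\<delta>. P i \<delta>" for i
    by (rule conv_L2_tendsto[OF G0i[of i] e1]) (unfold P_def, blast)
  then obtain \<delta>2 where "\<And>i. P i (\<delta>2 i)" using choice[of P] by blast
  then have \<delta>2: "\<And>i. \<delta>2 i > 0" "\<And>i d \<rho>. mollifier d \<rho> \<Longrightarrow> d \<le> \<delta>2 i \<Longrightarrow>
      integrable lebesgue (\<lambda>x. (conv (\<lambda>y. G0 y $ i) \<rho> x - G0 x $ i)\<^sup>2) \<and>
      (LINT x|lebesgue. (conv (\<lambda>y. G0 y $ i) \<rho> x - G0 x $ i)\<^sup>2) \<le> e1"
    by (simp_all add: P_def)

  \<comment> \<open>The mollified function near the contact set\<close>
  define d where "d = min (min r (\<delta>1 / 2)) (Min (range \<delta>2))"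
  have d: "d > 0" "d \<le> r" "d < \<delta>1" "\<And>i. d \<le> \<delta>2 i"
    using r \<delta>1 \<delta>2(1) by (auto simp: d_def min_le_iff_disj)
  obtain \<rho> :: "real^'n \<Rightarrow> real" where \<rho>: "mollifier d \<rho>" using mollifier_exists[OF d(1)] by blast
  note m = mollifierD[OF \<rho>]
  define ud where "ud = conv u0 \<rho>"
  define Z where "Z = (\<lambda>i x. (conv (\<lambda>y. G0 y $ i) \<rho> x - G0 x $ i)\<^sup>2)"
  have Z: "integrable lebesgue (Z i)" "(LINT x|lebesgue. Z i x) \<le> e1" for i
    using \<delta>2(2)[OF \<rho> d(4)] by (simp_all add: Z_def)
  have Z0: "Z i x \<ge> 0" for i x by (simp add: Z_def)
  have Vcb: "cball x d \<subseteq> U" if "x \<in> V" for x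
  proof
    fix y assume "y \<in> cball x d"
    moreover obtain s where "s \<in> S" "dist s x < r" using \<open>x \<in> V\<close> by (auto simp: V_def)
    ultimately have "dist s y < e" using d(2) r dist_triangle[of s y x] by (simp add: r_def)
    then have "y \<in> (\<Union>x\<in>S. ball x e)" using \<open>s \<in> S\<close> by auto
    then show "y \<in> U" using e(2) by blast
  qed
  have udc: "\<bar>ud x - u x\<bar> \<le> \<epsilon> / 4" if x: "x \<in> V" for x
  proof -
    have x\<Omega>: "x \<in> \<Omega>" using x VU U(2) by blast
    have "\<bar>conv u0 \<rho> x - u0 x\<bar> \<le> \<epsilon> / 4"
    proof (rule conv_close[OF \<rho> u0i])
      fix y assume y: "norm (y - x) < d"
      then have "y \<in> U" using Vcb[OF x] by (auto simp: dist_norm norm_minus_commute)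
      then have "y \<in> \<Omega>" using U(2) by blast
      then have "dist (u y) (u x) < \<epsilon> / 4"
        using uc[of x y] x\<Omega> closure_subset y d(3) by (auto simp: dist_norm)
      then show "\<bar>u0 y - u0 x\<bar> \<le> \<epsilon> / 4"
        using \<open>y \<in> \<Omega>\<close> x\<Omega> by (simp add: u0_def dist_real_def)
    qed
    then show ?thesis using x\<Omega> by (simp add: ud_def u0_def)
  qed
  have udg: "GDERIV ud x :> grad ud x" for x
    unfolding ud_def by (rule GDERIV_conv_mollifier(1)[OF \<rho> u0i])
  have cud: "continuous_on UNIV ud"
    using udg differentiable_imp_continuous_within GDERIV_differentiable
    by (metis continuous_at_imp_continuous_on)
  have cgud: "continuous_on UNIV (grad ud)"
  proof -
    have "C_class (Suc 0) ud"
      using GDERIV_conv_mollifier(3)[OF \<rho> u0i] by (simp add: smooth_def ud_def del: C_class.simps)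
    then show ?thesis by (subst continuous_on_componentwise) auto
  qed
  have gud: "grad ud x $ i = conv (\<lambda>y. G0 y $ i) \<rho> x" if x: "x \<in> V" for x i
  proof -
    have "cball x d \<subseteq> \<Omega>" using Vcb[OF x] U(2) by blast
    from grad_conv_weak_gradient[OF \<rho> u0i[unfolded u0_def] G(2) this, of "axis i 1"]
    show ?thesis by (simp add: ud_def u0_def G0_def inner_axis)
  qed

  \<comment> \<open>The test function and the weak inequality\<close>
  define h where "h = (\<lambda>x. max 0 (v x - ud x - \<epsilon>))"
  define E where "E = (\<lambda>x. if x \<in> V then (h x)\<^sup>2 else 0)"
  define DE where "DE = (\<lambda>x. if x \<in> V then (2 * h x) *\<^sub>R (Dv x - grad ud x) else 0)"
  have h0: "h x = 0" if "x \<in> V" "x \<notin> S" for x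
  proof -
    have "x \<in> closure U" using that VU closure_subset by blast
    then have "w x < \<epsilon> / 2" using that by (simp add: S_def not_le)
    then have "v x - ud x - \<epsilon> \<le> 0" using udc[OF that(1)] \<epsilon> unfolding w_def by linarith
    then show ?thesis by (simp add: h_def)
  qed
  have hH: "0 \<le> 2 * h x" "2 * h x \<le> H" if "x \<in> V" for x
  proof -
    have "x \<in> closure U" using that VU closure_subset by blast
    then have "v x - ud x - \<epsilon> \<le> M + \<epsilon>" using udc[OF that] M[of x] \<epsilon>(1) unfolding w_def by linarith
    then have "h x \<le> M + \<epsilon>" unfolding h_def using M0 \<epsilon>(1) by (intro max.boundedI) simp_all
    then show "2 * h x \<le> H" unfolding H_def by (rule mult_left_mono) simp
    show "0 \<le> 2 * h x" by (simp add: h_def)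
  qed
  have cv: "continuous_on V v"
    using VU closure_subset by (intro continuous_on_subset[OF v(1)]) blast
  have ch: "continuous_on V h"
    unfolding h_def by (intro continuous_intros cv continuous_on_subset[OF cud]) auto
  have Eg: "GDERIV E x :> DE x" for x
    unfolding E_def DE_def
  proof (rule GDERIV_glue_zero[OF Vo Scl SV])
    fix x assume x: "x \<in> V"
    have "GDERIV (\<lambda>x. v x - ud x) x :> Dv x - grad ud x"
      by (rule GDERIV_diff[OF v(2) udg]) (use x VU in blast)
    then have "GDERIV (\<lambda>x. v x - ud x - \<epsilon>) x :> Dv x - grad ud x - 0"
      by (rule GDERIV_diff[OF _ GDERIV_const])
    then have "GDERIV (\<lambda>x. (max 0 (v x - ud x - \<epsilon>))\<^sup>2) x :> (2 * max 0 (v x - ud x - \<epsilon>)) *\<^sub>R (Dv x - grad ud x - 0)"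
      by (rule GDERIV_DERIV_compose[OF _ max_0_square_deriv])
    then show "GDERIV (\<lambda>x. (h x)\<^sup>2) x :> (2 * h x) *\<^sub>R (Dv x - grad ud x)" by (simp add: h_def)
  qed (simp add: h0)
  have cDE: "continuous_on UNIV DE"
    unfolding DE_def
    by (rule continuous_on_glue_zero[OF Vo Scl SV])
       (auto intro!: continuous_intros ch continuous_on_subset[OF v(3) VU] continuous_on_subset[OF cgud] simp: h0)
  have cE: "continuous_on UNIV E"
    unfolding E_def
    by (rule continuous_on_glue_zero[OF Vo Scl SV]) (auto intro!: continuous_intros ch simp: h0)
  have ES: "E x = 0" "DE x = 0" if "x \<notin> S" for x using that h0 by (auto simp: E_def DE_def)
  have E0: "E x \<ge> 0" for x by (simp add: E_def)
  have weakA: "0 \<le> (LINT x|lebesgue. A x \<bullet> DE x)"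
  proof (rule nonneg_integral_C1_test[OF Ai _ \<Omega>(1) Sk _ Eg cDE ES(1) E0])
    show "S \<subseteq> \<Omega>" using SU U(2) by blast
    fix \<phi> :: "real^'n \<Rightarrow> real" assume "\<phi> \<in> test_functions \<Omega>" "\<And>x. 0 \<le> \<phi> x"
    then have "0 \<le> (LINT x:\<Omega>|lebesgue. (\<chi> i. a i (G x $ i)) \<bullet> grad \<phi> x)" using weak by blast
    also have "\<dots> = (LINT x|lebesgue. A x \<bullet> grad \<phi> x)"
    proof -
      \<comment> \<open>The growth bound at \<open>0\<close> makes the flux of the zero-extended
        gradient vanish outside \<open>\<Omega>\<close>, which turns the set integral into one over
        the whole space.\<close>
      have "a i 0 = 0" for i using a(3)[of i 0] by simp
      then have "indicator \<Omega> x *\<^sub>R ((\<chi> i. a i (G x $ i)) \<bullet> grad \<phi> x) = A x \<bullet> grad \<phi> x" for x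
        by (cases "x \<in> \<Omega>") (simp_all add: A_def G0_def inner_eq_sum_nth)
      then show ?thesis by (simp add: set_lebesgue_integral_def)
    qed
    finally show "0 \<le> (LINT x|lebesgue. A x \<bullet> grad \<phi> x)" .
  qed

  \<comment> \<open>The divergence identity for the barrier\<close>
  define QE where "QE = (\<lambda>x. if x \<in> V then ?Q x * E x else 0)"
  define BE where "BE = (\<lambda>x. if x \<in> V then \<Sum>i\<in>UNIV. a i (Dv x $ i) * DE x $ i else 0)"
  \<comment> \<open>\<open>D i\<close> is the \<open>i\<close>-th partial derivative of the
    compactly supported product of the \<open>i\<close>-th barrier flux and \<open>E\<close>, so it
    integrates to zero. Summed over \<open>i\<close> it is \<open>QE + BE\<close>, and the flux
    integral \<open>BE\<close> equals minus the gain.\<close>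
  define D where "D = (\<lambda>i x. if x \<in> V then q i x * E x + a i (Dv x $ i) * DE x $ i else 0)"
  have cEV: "continuous_on V E" "continuous_on V DE"
    using continuous_on_subset[OF cE] continuous_on_subset[OF cDE] by auto
  have cQE: "continuous_on UNIV QE"
    unfolding QE_def
    by (rule continuous_on_glue_zero[OF Vo Scl SV])
       (auto intro!: continuous_intros continuous_on_subset[OF q(2) VU] cEV simp: ES)
  have cBE: "continuous_on UNIV BE"
    unfolding BE_def
    by (rule continuous_on_glue_zero[OF Vo Scl SV])
       (auto intro!: continuous_intros continuous_on_subset[OF cB VU] cEV simp: ES)
  have cD: "continuous_on UNIV (D i)" for i
    unfolding D_def
    by (rule continuous_on_glue_zero[OF Vo Scl SV])
       (auto intro!: continuous_intros continuous_on_subset[OF q(2) VU] continuous_on_subset[OF cB VU] cEV simp: ES)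
  have outB: "x \<notin> S" if "norm x > B" for x using B[of x] that by auto
  have QEi: "integrable lborel QE"
    by (rule borel_integrable_bounded_support[OF cQE, of B]) (use outB ES in \<open>simp add: QE_def\<close>)
  have BEi: "integrable lborel BE"
    by (rule borel_integrable_bounded_support[OF cBE, of B]) (use outB ES in \<open>simp add: BE_def\<close>)
  have Di: "integrable lborel (D i)" for i
    by (rule borel_integrable_bounded_support[OF cD, of B]) (use outB ES in \<open>simp add: D_def\<close>)
  have D0: "integral\<^sup>L lborel (D i) = 0" for i
  proof (rule integral_directional_derivative_eq_0[where f="\<lambda>x. if x \<in> V then a i (Dv x $ i) * E x else 0" and R=B and b="axis i 1"])
    show "continuous_on UNIV (\<lambda>x. if x \<in> V then a i (Dv x $ i) * E x else 0)"
      by (rule continuous_on_glue_zero[OF Vo Scl SV])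
         (auto intro!: continuous_intros continuous_on_subset[OF cB VU] cEV simp: ES)
    show "(if x \<in> V then a i (Dv x $ i) * E x else 0) = 0" if "norm x > B" for x
      using outB[OF that] ES by simp
    show "axis i (1::real) \<in> Basis" by (simp add: axis_in_Basis_iff)
    fix y :: "real^'n"
    let ?l = "\<lambda>s. y + s *\<^sub>R axis i 1"
    show "((\<lambda>s. if ?l s \<in> V then a i (Dv (?l s) $ i) * E (?l s) else 0) has_real_derivative D i y) (at 0)"
    proof (cases "y \<in> V")
      case True
      have op: "open {s. ?l s \<in> V}"
        using open_vimage[OF Vo, of ?l] by (simp add: vimage_def continuous_intros)
      have "GDERIV E (?l 0) :> DE y" using Eg by simp
      from GDERIV_line[OF this]
      have "((\<lambda>s. E (?l s)) has_real_derivative DE y $ i) (at 0)" by (simp add: inner_axis' )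
      from DERIV_mult[OF q(1)[of y i] this]
      have "((\<lambda>s. a i (Dv (?l s) $ i) * E (?l s)) has_real_derivative D i y) (at 0)"
        using True VU by (auto simp: D_def algebra_simps)
      then show ?thesis
        by (rule has_field_derivative_transform_within_open[OF _ op]) (use True in auto)
    next
      case False
      have op: "open {s. ?l s \<in> - S}"
        using open_vimage[of "- S" ?l] Scl by (simp add: vimage_def continuous_intros open_Compl)
      have "((\<lambda>s. 0) has_real_derivative D i y) (at 0)" using False by (simp add: D_def)
      then show ?thesis
        by (rule has_field_derivative_transform_within_open[OF _ op]) (use False SV ES in auto)
    qed
  qed (rule cD)
  have "integral\<^sup>L lborel QE + integral\<^sup>L lborel BE = (LINT x|lborel. QE x + BE x)"
    using QEi BEi by simp
  also have "\<dots> = (LINT x|lborel. (\<Sum>i\<in>UNIV. D i x))"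
    by (rule arg_cong[where f="integral\<^sup>L lborel"])
       (auto simp: QE_def BE_def D_def fun_eq_iff sum.distrib sum_distrib_right)
  also have "\<dots> = 0" using Di D0 by simp
  finally have QB: "integral\<^sup>L lborel BE = - integral\<^sup>L lborel QE" by simp
  have "\<kappa> \<le> integral\<^sup>L lborel QE"
    unfolding \<kappa>_def
  proof (rule integral_mono[OF K0i QEi])
    fix x
    show "K0 x \<le> QE x"
    proof (cases "x \<in> ball x0 r0")
      case True
      then have x: "x \<in> V" "3 * \<epsilon> / 2 < w x" using r0(2) by (auto simp: subset_iff)
      have "\<epsilon> / 4 \<le> h x" using x udc[OF x(1)] unfolding h_def w_def by linarith
      then have "(\<epsilon> / 4)\<^sup>2 \<le> E x" using x \<epsilon> by (auto simp: E_def intro!: power_mono)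
      moreover have "q0 \<le> ?Q x" using q0(2)[of x] True by simp
      ultimately have "q0 * (\<epsilon> / 4)\<^sup>2 \<le> ?Q x * E x" using q0(1) by (intro mult_mono) auto
      then show ?thesis using True x by (simp add: K0_def QE_def)
    next
      case False
      have "0 \<le> ?Q x" if "x \<in> V" using q(3)[of x] VU that by (blast intro: less_imp_le)
      then have "0 \<le> QE x" using E0[of x] by (simp add: QE_def)
      then show ?thesis using False by (simp add: K0_def)
    qed
  qed
  then have BE\<kappa>: "integral\<^sup>L lebesgue BE \<le> - \<kappa>"
    using QB lebesgue_integral_eq_lborel(1)[OF cBE] by simp

  \<comment> \<open>Monotonicity, error estimate and contradiction\<close>
  have pw: "A x \<bullet> DE x \<le> BE x + (\<Sum>i\<in>UNIV. H * (\<theta> * Y i x + Z i x / \<theta>))" for x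
  proof (cases "x \<in> S")
    case False
    have "0 \<le> (\<Sum>i\<in>UNIV. H * (\<theta> * Y i x + Z i x / \<theta>))"
      using H \<theta> Y0 Z0 by (intro sum_nonneg mult_nonneg_nonneg add_nonneg_nonneg) auto
    then show ?thesis using ES(2)[OF False] by (simp add: BE_def)
  next
    case True
    then have x: "x \<in> V" using SV by blast
    have xK: "x \<in> K" using x VK by blast
    have "A x $ i * DE x $ i \<le> a i (Dv x $ i) * DE x $ i + H * (\<theta> * Y i x + Z i x / \<theta>)" for i
    proof -
      \<comment> \<open>The test gradient is split as \<open>(Dv - G0) + (G0 - grad ud)\<close>, up
        to the factor \<open>2 * h x\<close>. Monotonicity of \<open>a i\<close> gives the first
        part a sign; the second is estimated by Young's inequality with parameter
        \<open>\<theta>\<close>.\<close>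
      let ?p = "a i (G0 x $ i) - a i (Dv x $ i)" and ?z = "G0 x $ i - grad ud x $ i"
      have "?p * (Dv x $ i - G0 x $ i) \<le> 0"
      proof (cases "G0 x $ i \<le> Dv x $ i")
        case True
        then show ?thesis using monoD[OF a(2) True, of i] by (intro mult_nonpos_nonneg) auto
      next
        case False
        then have "Dv x $ i \<le> G0 x $ i" by simp
        from monoD[OF a(2) this, of i] False show ?thesis by (intro mult_nonneg_nonpos) auto
      qed
      then have "2 * h x * (?p * (Dv x $ i - G0 x $ i)) \<le> 0"
        by (rule mult_nonneg_nonpos[OF hH(1)[OF x]])
      moreover have "2 * h x * (?p * ?z) \<le> H * (\<theta> * Y i x + Z i x / \<theta>)"
      proof -
        have "?p * ?z \<le> \<bar>?p\<bar> * \<bar>?z\<bar>" by (metis abs_ge_self abs_mult)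
        also have "\<dots> \<le> \<theta> * ?p\<^sup>2 + ?z\<^sup>2 / \<theta>" by (rule weighted_product_le[OF \<theta>])
        also have "?z\<^sup>2 = Z i x" using gud[OF x, of i] by (simp add: Z_def power2_commute)
        also have "?p\<^sup>2 \<le> Y i x"
        proof -
          have "\<bar>a i (G0 x $ i)\<bar>\<^sup>2 \<le> (C * \<bar>G0 x $ i\<bar>)\<^sup>2" by (rule power_mono[OF a(3)]) simp
          then have 1: "(a i (G0 x $ i))\<^sup>2 \<le> C\<^sup>2 * (G0 x $ i)\<^sup>2" by (simp add: power_mult_distrib)
          have "\<bar>a i (Dv x $ i)\<bar>\<^sup>2 \<le> b0\<^sup>2" by (rule power_mono[OF b0[OF xK]]) simp
          then have 2: "(a i (Dv x $ i))\<^sup>2 \<le> b0\<^sup>2" by simp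
          have "?p\<^sup>2 \<le> 2 * (a i (G0 x $ i))\<^sup>2 + 2 * (a i (Dv x $ i))\<^sup>2"
            using zero_le_power2[of "a i (G0 x $ i) + a i (Dv x $ i)"]
            by (simp add: power2_sum power2_diff)
          then show ?thesis using 1 2 xK by (simp add: Y_def)
        qed
        finally have le: "?p * ?z \<le> \<theta> * Y i x + Z i x / \<theta>" using \<theta> by simp
        have nn: "0 \<le> \<theta> * Y i x + Z i x / \<theta>" using \<theta> Y0[of i x] Z0[of i x] by simp
        have "2 * h x * (?p * ?z) \<le> 2 * h x * (\<theta> * Y i x + Z i x / \<theta>)"
          by (rule mult_left_mono[OF le hH(1)[OF x]])
        also have "\<dots> \<le> H * (\<theta> * Y i x + Z i x / \<theta>)"
          by (rule mult_right_mono[OF hH(2)[OF x] nn])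
        finally show ?thesis .
      qed
      moreover have "A x $ i * DE x $ i - a i (Dv x $ i) * DE x $ i =
          2 * h x * (?p * (Dv x $ i - G0 x $ i)) + 2 * h x * (?p * ?z)"
        using x by (simp add: A_def DE_def algebra_simps)
      ultimately show ?thesis by linarith
    qed
    then have "(\<Sum>i\<in>UNIV. A x $ i * DE x $ i) \<le>
        (\<Sum>i\<in>UNIV. a i (Dv x $ i) * DE x $ i + H * (\<theta> * Y i x + Z i x / \<theta>))"
      by (rule sum_mono)
    then show ?thesis using x by (simp add: inner_eq_sum_nth BE_def sum.distrib)
  qed
  have i1: "integrable lebesgue (\<lambda>x. \<Sum>i\<in>UNIV. H * (\<theta> * Y i x + Z i x / \<theta>))"
    using Yi Z(1) by (intro Bochner_Integration.integrable_sum integrable_mult_right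
        Bochner_Integration.integrable_add integrable_divide) auto
  have i2: "integrable lebesgue BE"
    by (rule lebesgue_integral_eq_lborel(2)[OF cBE BEi])
  have i3: "integrable lebesgue (\<lambda>x. A x \<bullet> DE x)"
    by (rule integrable_lebesgue_inner[OF Ai cDE, of B]) (use outB ES in simp)
  have "0 \<le> (LINT x|lebesgue. A x \<bullet> DE x)" by (rule weakA)
  also have "\<dots> \<le> (LINT x|lebesgue. BE x + (\<Sum>i\<in>UNIV. H * (\<theta> * Y i x + Z i x / \<theta>)))"
    by (rule integral_mono[OF i3 Bochner_Integration.integrable_add[OF i2 i1] pw])
  also have "\<dots> = integral\<^sup>L lebesgue BE + (LINT x|lebesgue. (\<Sum>i\<in>UNIV. H * (\<theta> * Y i x + Z i x / \<theta>)))"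
    by (rule Bochner_Integration.integral_add[OF i2 i1])
  also have "(LINT x|lebesgue. (\<Sum>i\<in>UNIV. H * (\<theta> * Y i x + Z i x / \<theta>))) =
      (\<Sum>i\<in>UNIV. H * (\<theta> * (LINT x|lebesgue. Y i x) + (LINT x|lebesgue. Z i x) / \<theta>))"
    using Yi Z(1) by (simp add: Bochner_Integration.integral_sum)
  also have "\<dots> \<le> (\<Sum>i\<in>(UNIV::'n set). H * (\<theta> * (LINT x|lebesgue. Y i x) + e1 / \<theta>))"
    using H \<theta> Z(2) by (intro sum_mono mult_left_mono add_left_mono divide_right_mono) auto
  also have "\<dots> = H * \<theta> * I + H * real CARD('n) * e1 / \<theta>"
    by (simp add: I_def sum_distrib_left sum.distrib distrib_left mult.assoc)
  also have "H * real CARD('n) * e1 / \<theta> = \<kappa> / 4" using H \<theta> by (simp add: e1_def)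
  also have "H * \<theta> * I \<le> \<kappa> / 4"
  proof -
    have H\<theta>: "H * \<theta> = \<kappa> / (4 * (I + 1))" using H by (simp add: \<theta>_def)
    have "H * \<theta> * I \<le> H * \<theta> * (I + 1)" using H \<theta> by simp
    also have "\<dots> = \<kappa> / 4" unfolding H\<theta> using I0 by (simp add: divide_simps)
    finally show ?thesis .
  qed
  finally show False using BE\<kappa> \<kappa> by simp
qed

section \<open>The flux and the radial barrier\<close>

text \<open>The differential equation says exactly that half the second derivative of
  \<open>f (s^2) * s^2\<close> is \<open>g (s^2)\<close> for nonzero \<open>s\<close>. At
  \<open>s = 0\<close>, where it degenerates, the first derivative comes from boundedness of
  \<open>f\<close> and the second from continuity of \<open>g\<close>.\<close>

lemma flux_component_exists:
  fixes g f :: "real \<Rightarrow> real"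
  assumes g: "continuous_on {0..} g" and ode: "solves_ode g f"
    and bdd: "bounded (f ` {0..})" and conv: "strictly_convex_on UNIV (\<lambda>s::real. f (s\<^sup>2) * s\<^sup>2)"
  obtains a C where "\<And>s. ((\<lambda>s. f (s\<^sup>2) * s\<^sup>2) has_real_derivative 2 * a s) (at s)"
    "\<And>s. (a has_real_derivative g (s\<^sup>2)) (at s)" "\<And>s. \<bar>a s\<bar> \<le> C * \<bar>s\<bar>"
proof -
  define F where "F = (\<lambda>s::real. f (s\<^sup>2) * s\<^sup>2)"
  \<comment> \<open>Half the derivative of \<open>F\<close>. At \<open>s = 0\<close> the unspecified
    value \<open>deriv f 0\<close> is multiplied by zero.\<close>
  define a where "a = (\<lambda>s. s * f (s\<^sup>2) + s ^ 3 * deriv f (s\<^sup>2))"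
  obtain M0 where M0: "\<And>t. t \<ge> 0 \<Longrightarrow> \<bar>f t\<bar> \<le> M0"
    using bdd unfolding bounded_iff by auto
  define M where "M = max M0 1"
  have M: "\<bar>f t\<bar> \<le> M" if "t \<ge> 0" for t using M0[OF that] by (simp add: M_def)
  have M1: "M \<ge> 1" by (simp add: M_def)
  have FM: "\<bar>F s\<bar> \<le> M * s\<^sup>2" for s
    using mult_right_mono[OF M[of "s\<^sup>2"], of "s\<^sup>2"] by (simp add: F_def abs_mult)
  have f1: "(f has_real_derivative deriv f t) (at t)"
    and f2: "(deriv f has_real_derivative deriv (deriv f) t) (at t)"
    and fe: "g t = f t + 5 * t * deriv f t + 2 * t\<^sup>2 * deriv (deriv f) t" if "t > 0" for t
    using ode that by (auto simp: solves_ode_def DERIV_deriv_iff_real_differentiable)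
  have F0: "(F has_real_derivative 2 * a 0) (at 0)"
  proof -
    have "((\<lambda>h. F h / h) \<longlongrightarrow> 0) (at 0)"
    proof (rule Lim_null_comparison)
      show "\<forall>\<^sub>F h in at 0. norm (F h / h) \<le> M * \<bar>h\<bar>"
        using FM by (auto simp: eventually_at_filter field_simps power2_eq_square abs_mult)
      show "((\<lambda>h. M * \<bar>h\<bar>) \<longlongrightarrow> 0) (at (0::real))"
        by (auto intro!: tendsto_eq_intros)
    qed
    then show ?thesis by (simp add: DERIV_def F_def a_def)
  qed
  have F1: "(F has_real_derivative 2 * a s) (at s)" for s
  proof (cases "s = 0")
    case False
    then have "s\<^sup>2 > 0" by simp
    have "((\<lambda>s. f (s\<^sup>2)) has_real_derivative deriv f (s\<^sup>2) * (2 * s)) (at s)"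
      by (rule DERIV_chain2[where f=f and g="\<lambda>s. s\<^sup>2", OF f1[OF \<open>s\<^sup>2 > 0\<close>]]) (auto intro!: derivative_eq_intros)
    then have "(F has_real_derivative deriv f (s\<^sup>2) * (2 * s) * s\<^sup>2 + (2 * s) * f (s\<^sup>2)) (at s)"
      unfolding F_def by (auto intro!: derivative_eq_intros)
    then show ?thesis by (simp add: a_def power2_eq_square power3_eq_cube algebra_simps)
  qed (use F0 in simp)
  have a1: "(a has_real_derivative g (s\<^sup>2)) (at s)" if "s \<noteq> 0" for s
  proof -
    have s: "s\<^sup>2 > 0" using that by simp
    have "((\<lambda>s. f (s\<^sup>2)) has_real_derivative deriv f (s\<^sup>2) * (2 * s)) (at s)"
      by (rule DERIV_chain2[where f=f and g="\<lambda>s. s\<^sup>2", OF f1[OF s]]) (auto intro!: derivative_eq_intros)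
    moreover have "((\<lambda>s. deriv f (s\<^sup>2)) has_real_derivative deriv (deriv f) (s\<^sup>2) * (2 * s)) (at s)"
      by (rule DERIV_chain2[where f="deriv f" and g="\<lambda>s. s\<^sup>2", OF f2[OF s]]) (auto intro!: derivative_eq_intros)
    ultimately have "(a has_real_derivative (1 * f (s\<^sup>2) + deriv f (s\<^sup>2) * (2 * s) * s) +
        ((3 * s ^ 2) * deriv f (s\<^sup>2) + deriv (deriv f) (s\<^sup>2) * (2 * s) * s ^ 3)) (at s)"
      unfolding a_def by (auto intro!: derivative_eq_intros)
    moreover have "(1 * f (s\<^sup>2) + deriv f (s\<^sup>2) * (2 * s) * s) +
        ((3 * s ^ 2) * deriv f (s\<^sup>2) + deriv (deriv f) (s\<^sup>2) * (2 * s) * s ^ 3) = g (s\<^sup>2)"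
      using fe[OF s] by (simp add: power2_eq_square power3_eq_cube algebra_simps)
    ultimately show ?thesis by simp
  qed
  have cF: "convex_on UNIV F"
  proof (rule convex_onI)
    fix t x y :: real assume t: "0 < t" "t < 1"
    show "F ((1 - t) *\<^sub>R x + t *\<^sub>R y) \<le> (1 - t) * F x + t * F y"
    proof (cases "x = y")
      case True
      then show ?thesis by (simp add: algebra_simps)
    next
      case False
      then have "F ((1 - t) *\<^sub>R x + t *\<^sub>R y) < (1 - t) * F x + t * F y"
        using conv t unfolding strictly_convex_on_def F_def by simp
      then show ?thesis by simp
    qed
  qed simp
  have ab: "\<bar>a s\<bar> \<le> (5 * M) * \<bar>s\<bar>" for s
  proof -
    \<comment> \<open>The tangent at \<open>s\<close>, tested at \<open>2 * s\<close> and at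
      \<open>0\<close>, bounds \<open>a s * s\<close> from both sides by values of \<open>F\<close>,
      and these are of order \<open>s^2\<close>.\<close>
    have tan: "F y \<ge> F s + 2 * a s * (y - s)" for y
      using convex_on_imp_above_tangent[OF cF, of s y "2 * a s"] F1[of s] by simp
    have "2 * (a s * s) \<le> F (2 * s) - F s" "- 2 * (a s * s) \<le> F 0 - F s"
      using tan[of "2 * s"] tan[of 0] by (simp_all add: algebra_simps)
    moreover have "\<bar>F (2 * s)\<bar> \<le> 4 * (M * s\<^sup>2)" using FM[of "2 * s"] by (simp add: power_mult_distrib)
    moreover have "F 0 = 0" by (simp add: F_def)
    moreover have "M * s\<^sup>2 \<ge> 0" using M1 by simp
    ultimately have "\<bar>a s * s\<bar> \<le> 5 * (M * s\<^sup>2)" using FM[of s] by linarith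
    then have "\<bar>a s\<bar> * \<bar>s\<bar> \<le> (5 * M * \<bar>s\<bar>) * \<bar>s\<bar>"
      by (simp add: abs_mult power2_eq_square mult.assoc)
    then show ?thesis
      by (cases "s = 0") (auto simp: a_def mult_le_cancel_right)
  qed
  have a0: "(a has_real_derivative g 0) (at 0)"
  proof -
    have ca: "isCont a s" for s
    proof (cases "s = 0")
      case True
      have "(a \<longlongrightarrow> 0) (at 0)"
      proof (rule Lim_null_comparison)
        show "\<forall>\<^sub>F h in at 0. norm (a h) \<le> (5 * M) * \<bar>h\<bar>" using ab by simp
        show "((\<lambda>h. (5 * M) * \<bar>h\<bar>) \<longlongrightarrow> 0) (at (0::real))"
          by (auto intro!: tendsto_eq_intros)
      qed
      then show ?thesis using True by (simp add: isCont_def a_def)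
    next
      case False
      then show ?thesis using a1 DERIV_isCont by blast
    qed
    have ca': "continuous_on {x..y} a" for x y
      using ca by (simp add: continuous_at_imp_continuous_on)
    have ad: "a differentiable (at s)" if "0 < s \<and> s < y \<or> y < s \<and> s < 0" for s y
      using a1[of s] that real_differentiable_def by auto
    have "((\<lambda>h. g (h\<^sup>2)) \<longlongrightarrow> g (0\<^sup>2)) (at 0)"
    proof -
      have "continuous_on UNIV (\<lambda>h::real. g (h\<^sup>2))"
        by (rule continuous_on_compose2[OF g]) (auto intro!: continuous_intros)
      then have "isCont (\<lambda>h::real. g (h\<^sup>2)) 0"
        by (simp add: continuous_on_eq_continuous_within)
      then show ?thesis by (simp add: isCont_def)
    qed
    then have lim: "((\<lambda>h. g (h\<^sup>2)) \<longlongrightarrow> g 0) (at 0)" by simp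
    \<comment> \<open>By the mean value theorem this quotient is a value \<open>g (t^2)\<close> with
      \<open>t\<close> between \<open>0\<close> and \<open>h\<close>, so the equation is used at
      nonzero points.\<close>
    have "((\<lambda>h. a h / h) \<longlongrightarrow> g 0) (at 0)"
    proof (rule LIM_I)
      fix e :: real assume "e > 0"
      from LIM_D[OF lim this] obtain d where d: "d > 0"
          "\<And>h. h \<noteq> 0 \<and> norm (h - 0) < d \<Longrightarrow> norm (g (h\<^sup>2) - g 0) < e"
        by blast
      have "norm (a h / h - g 0) < e" if h: "h \<noteq> 0" "norm (h - 0) < d" for h
      proof -
        have "\<exists>t. t \<noteq> 0 \<and> \<bar>t\<bar> < d \<and> a h / h = g (t\<^sup>2)"
        proof (cases "h > 0")
          case True
          obtain l t where t: "0 < t" "t < h" "DERIV a t :> l" "a h - a 0 = (h - 0) * l"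
            using MVT[of 0 h a, OF True ca'] ad[of _ h] by auto
          then have "l = g (t\<^sup>2)" using a1[of t] DERIV_unique by blast
          then show ?thesis using t True h by (intro exI[of _ t]) (auto simp: a_def field_simps)
        next
          case False
          then have "h < 0" using h by simp
          obtain l t where t: "h < t" "t < 0" "DERIV a t :> l" "a 0 - a h = (0 - h) * l"
            using MVT[of h 0 a, OF \<open>h < 0\<close> ca'] ad[of _ h] by auto
          then have "l = g (t\<^sup>2)" using a1[of t] DERIV_unique by blast
          then show ?thesis using t \<open>h < 0\<close> h by (intro exI[of _ t]) (auto simp: a_def field_simps)
        qed
        then show ?thesis using d(2) by force
      qed
      then show "\<exists>s>0. \<forall>x. x \<noteq> 0 \<and> norm (x - 0) < s \<longrightarrow> norm (a x / x - g 0) < e"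
        using d(1) by blast
    qed
    then show ?thesis by (simp add: DERIV_def a_def)
  qed
  show ?thesis
  proof (rule that[of a "5 * M"])
    show "((\<lambda>s. f (s\<^sup>2) * s\<^sup>2) has_real_derivative 2 * a s) (at s)" for s
      using F1 by (simp add: F_def)
    show "(a has_real_derivative g (s\<^sup>2)) (at s)" for s
      using a0 a1 by (cases "s = 0") auto
    show "\<bar>a s\<bar> \<le> 5 * M * \<bar>s\<bar>" for s by (rule ab)
  qed
qed

lemma grad_lagrangian:
  fixes f :: "'n::finite \<Rightarrow> real \<Rightarrow> real"
  assumes "\<And>i s. ((\<lambda>s. f i (s\<^sup>2) * s\<^sup>2) has_real_derivative 2 * a i s) (at s)"
  shows "grad (lagrangian f) p = (\<chi> i. a i (p $ i))"
proof (rule grad_eq, unfold gderiv_def)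
  have "((\<lambda>p. f i ((p $ i)\<^sup>2) * (p $ i)\<^sup>2) has_derivative (\<lambda>h. (h $ i) * (2 * a i (p $ i)))) (at p)" for i
  proof -
    have 1: "((\<lambda>p. p $ i) has_derivative (\<lambda>h. h $ i)) (at p)"
      by (intro bounded_linear_imp_has_derivative bounded_linear_vec_nth)
    have 2: "((\<lambda>s. f i (s\<^sup>2) * s\<^sup>2) has_derivative (\<lambda>s. s * (2 * a i (p $ i)))) (at (p $ i))"
      using assms[of i "p $ i"] unfolding has_field_derivative_def mult_commute_abs .
    show ?thesis by (rule has_derivative_compose[OF 1 2])
  qed
  then have "(lagrangian f has_derivative (\<lambda>h. (1/2) * (\<Sum>i\<in>UNIV. (h $ i) * (2 * a i (p $ i))))) (at p)"
    unfolding lagrangian_def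
    by (intro has_derivative_mult_right has_derivative_sum)
  moreover have "(\<lambda>h. (1/2) * (\<Sum>i\<in>UNIV. (h $ i) * (2 * a i (p $ i)))) = (\<lambda>h. h \<bullet> (\<chi> i. a i (p $ i)))"
    by (simp add: inner_vec_def sum_distrib_left fun_eq_iff)
  ultimately show "(lagrangian f has_derivative (\<lambda>h. h \<bullet> (\<chi> i. a i (p $ i)))) (at p)"
    by metis
qed

section \<open>The radial profile\<close>

text \<open>\<open>Lim\<close> is a definite description, so its value carries information once
  convergence is known. The integrals increase as the lower end decreases and thus converge to their
  supremum, which would be finite if they were bounded.\<close>

lemma large_integral_near_0:
  fixes k :: "real \<Rightarrow> real"
  assumes k: "continuous_on {0<..} k" "\<And>t. t > 0 \<Longrightarrow> 0 \<le> k t" and "\<xi> > 0"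
    and lim: "Lim (at_right 0) (\<lambda>\<epsilon>. ereal (integral {\<epsilon>..\<xi>} k)) = \<infinity>"
  shows "\<exists>\<epsilon>. 0 < \<epsilon> \<and> \<epsilon> \<le> \<xi> \<and> B \<le> integral {\<epsilon>..\<xi>} k"
proof (rule ccontr)
  assume "\<not> ?thesis"
  then have B: "integral {\<epsilon>..\<xi>} k < B" if "0 < \<epsilon>" "\<epsilon> \<le> \<xi>" for \<epsilon> using that by force
  define l where "l = (SUP \<epsilon>\<in>{0<..\<xi>}. ereal (integral {\<epsilon>..\<xi>} k))"
  have "((\<lambda>\<epsilon>. ereal (integral {\<epsilon>..\<xi>} k)) \<longlongrightarrow> l) (at_right 0)"
  proof (rule increasing_tendsto)
    have "\<forall>\<^sub>F \<epsilon> in at_right 0. \<epsilon> \<in> {0<..<\<xi>}"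
      using \<open>\<xi> > 0\<close> by (rule eventually_at_right_real)
    then show "\<forall>\<^sub>F \<epsilon> in at_right 0. ereal (integral {\<epsilon>..\<xi>} k) \<le> l"
      by eventually_elim (auto simp: l_def intro!: SUP_upper)
    fix x assume "x < l"
    then obtain s where s: "0 < s" "s \<le> \<xi>" "x < ereal (integral {s..\<xi>} k)"
      unfolding l_def less_SUP_iff by auto
    have "\<forall>\<^sub>F \<epsilon> in at_right 0. \<epsilon> \<in> {0<..<s}"
      using \<open>s > 0\<close> by (rule eventually_at_right_real)
    then show "\<forall>\<^sub>F \<epsilon> in at_right 0. x < ereal (integral {\<epsilon>..\<xi>} k)"
    proof eventually_elim
      case (elim \<epsilon>)
      have "integral {s..\<xi>} k \<le> integral {\<epsilon>..\<xi>} k"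
        by (rule integral_subset_le)
           (use elim s k(2) in \<open>auto intro!: integrable_continuous_real continuous_on_subset[OF k(1)]\<close>)
      then show ?case using s(3) by (metis ereal_less_eq(3) less_le_trans)
    qed
  qed
  then have "Lim (at_right 0) (\<lambda>\<epsilon>. ereal (integral {\<epsilon>..\<xi>} k)) = l"
    by (intro tendsto_Lim) auto
  moreover have "l \<le> ereal B"
    unfolding l_def using B by (intro SUP_least) (auto intro: less_imp_le)
  ultimately show False using lim by simp
qed

text \<open>The profile is the inverse function of \<open>\<xi> \<mapsto> (r/2) exp (\<Gamma> \<xi> / K)\<close>, where \<open>\<Gamma> \<xi>\<close> is the integral
  of \<open>k\<close> over \<open>[\<xi>, \<xi>\<^sub>0]\<close>; the divergence of \<open>\<Gamma>\<close> at \<open>0\<close> keeps it positive up to radius \<open>r\<close>.\<close>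

lemma barrier_profile:
  fixes k :: "real \<Rightarrow> real"
  assumes k: "continuous_on {0<..} k" "\<And>t. t > 0 \<Longrightarrow> 0 \<le> k t" "\<And>t. 0 < t \<Longrightarrow> t \<le> \<xi>0 \<Longrightarrow> 0 < k t"
    and pos: "\<xi>0 > 0" "K > 0" "r > 0"
    and lim: "Lim (at_right 0) (\<lambda>\<epsilon>. ereal (integral {\<epsilon>..\<xi>0} k)) = \<infinity>"
  obtains W \<xi>1 where "0 < \<xi>1" "continuous_on {r/2..r} W"
    "\<And>\<rho>. r/2 \<le> \<rho> \<Longrightarrow> \<rho> \<le> r \<Longrightarrow> \<xi>1 \<le> W \<rho> \<and> W \<rho> \<le> \<xi>0"
    "\<And>\<rho>. r/2 < \<rho> \<Longrightarrow> \<rho> < r \<Longrightarrow> (W has_real_derivative - (K / (\<rho> * k (W \<rho>)))) (at \<rho>)"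
proof -
  define \<Gamma> where "\<Gamma> = (\<lambda>\<xi>. integral {\<xi>..\<xi>0} k)"
  define \<Theta> where "\<Theta> = (\<lambda>\<xi>. r / 2 * exp (\<Gamma> \<xi> / K))"
  \<comment> \<open>An increase of \<open>\<Gamma>\<close> by \<open>K * ln 2\<close> doubles
    \<open>\<Theta>\<close>, which is precisely the passage from radius \<open>r / 2\<close> to
    \<open>r\<close>.\<close>
  obtain \<epsilon> where \<epsilon>: "0 < \<epsilon>" "\<epsilon> \<le> \<xi>0" "K * ln 2 \<le> \<Gamma> \<epsilon>"
    using large_integral_near_0[OF k(1,2) pos(1) lim] unfolding \<Gamma>_def by blast
  have ck: "continuous_on {a..\<xi>0} k" if "a > 0" for a
    by (rule continuous_on_subset[OF k(1)]) (use that in auto)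
  have \<Gamma>d: "(\<Gamma> has_real_derivative - k \<xi>) (at \<xi> within {a..\<xi>0})" if "a > 0" "\<xi> \<in> {a..\<xi>0}" for a \<xi>
    unfolding \<Gamma>_def by (rule integral_has_real_derivative'[OF ck]) (use that in auto)
  have c\<Gamma>: "continuous_on {a..\<xi>0} \<Gamma>" if "a > 0" for a
    using \<Gamma>d[OF that] by (meson DERIV_continuous_on)
  have \<Gamma>0: "\<Gamma> \<xi>0 = 0" by (simp add: \<Gamma>_def)
  obtain \<xi>1 where \<xi>1: "\<epsilon> \<le> \<xi>1" "\<xi>1 \<le> \<xi>0" "\<Gamma> \<xi>1 = K * ln 2"
    using IVT2'[of \<Gamma> \<xi>0 "K * ln 2" \<epsilon>] \<epsilon> \<Gamma>0 pos c\<Gamma>[OF \<epsilon>(1)] by auto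
  have p1: "\<xi>1 > 0" using \<epsilon> \<xi>1 by simp
  let ?S = "{\<xi>1..\<xi>0}"
  have c\<Theta>: "continuous_on ?S \<Theta>"
    unfolding \<Theta>_def using c\<Gamma>[OF p1] pos by (intro continuous_intros) auto
  have \<Theta>d: "(\<Theta> has_real_derivative - (\<Theta> \<xi> * k \<xi> / K)) (at \<xi>)" if "\<xi>1 < \<xi>" "\<xi> < \<xi>0" for \<xi>
  proof -
    have "(\<Gamma> has_real_derivative - k \<xi>) (at \<xi>)"
      using \<Gamma>d[OF p1, of \<xi>] that at_within_interior[of \<xi> ?S] by simp
    from DERIV_cmult[OF DERIV_chain2[OF DERIV_exp DERIV_cdivide[OF this, of K]], of "r / 2"]
    show ?thesis unfolding \<Theta>_def by (simp add: field_simps)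
  qed
  have \<Theta>pos: "\<Theta> \<xi> > 0" for \<xi> using pos by (simp add: \<Theta>_def)
  have anti: "\<Theta> y < \<Theta> x" if "\<xi>1 \<le> x" "x < y" "y \<le> \<xi>0" for x y
  proof (rule DERIV_neg_imp_decreasing_open[OF that(2)])
    show "\<exists>D. (\<Theta> has_real_derivative D) (at t) \<and> D < 0" if t: "x < t" "t < y" for t
      using \<Theta>d[of t] t \<open>\<xi>1 \<le> x\<close> \<open>y \<le> \<xi>0\<close> \<Theta>pos[of t] k(3)[of t] pos p1
      by (intro exI[of _ "- (\<Theta> t * k t / K)"]) auto
    show "continuous_on {x..y} \<Theta>" by (rule continuous_on_subset[OF c\<Theta>]) (use that in auto)
  qed
  have inj: "inj_on \<Theta> ?S"
    by (rule linorder_inj_onI') (use anti in fastforce)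
  have ends: "\<Theta> \<xi>1 = r" "\<Theta> \<xi>0 = r / 2"
    using \<xi>1(3) \<Gamma>0 pos by (simp_all add: \<Theta>_def)
  have img: "\<Theta> ` ?S = {r/2..r}"
  proof
    show "\<Theta> ` ?S \<subseteq> {r/2..r}"
    proof
      fix y assume "y \<in> \<Theta> ` ?S"
      then obtain x where x: "x \<in> ?S" "y = \<Theta> x" by auto
      have "\<Theta> x \<le> \<Theta> \<xi>1" "\<Theta> \<xi>0 \<le> \<Theta> x"
        using x anti[of \<xi>1 x] anti[of x \<xi>0] by (cases "x = \<xi>1"; cases "x = \<xi>0"; force)+
      then show "y \<in> {r/2..r}" using x ends by simp
    qed
    show "{r/2..r} \<subseteq> \<Theta> ` ?S"
    proof
      fix y assume "y \<in> {r/2..r}"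
      then obtain x where "\<xi>1 \<le> x" "x \<le> \<xi>0" "\<Theta> x = y"
        using IVT2'[of \<Theta> \<xi>0 y \<xi>1] ends \<xi>1(2) c\<Theta> by auto
      then show "y \<in> \<Theta> ` ?S" by auto
    qed
  qed
  define W where "W = the_inv_into ?S \<Theta>"
  have W\<Theta>: "\<Theta> (W \<rho>) = \<rho>" and WS: "W \<rho> \<in> ?S" if "\<rho> \<in> {r/2..r}" for \<rho>
    using that f_the_inv_into_f[OF inj, of \<rho>] the_inv_into_into[OF inj, of \<rho> ?S] img
    by (auto simp: W_def)
  have cW: "continuous_on {r/2..r} W"
    using continuous_on_inv_into[OF c\<Theta> _ inj] img by (simp add: W_def)
  have "(W has_real_derivative - (K / (\<rho> * k (W \<rho>)))) (at \<rho>)" if \<rho>: "r/2 < \<rho>" "\<rho> < r" for \<rho>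
  proof -
    have "W \<rho> \<noteq> \<xi>1" "W \<rho> \<noteq> \<xi>0" using W\<Theta>[of \<rho>] \<rho> ends by auto
    then have w: "\<xi>1 < W \<rho>" "W \<rho> < \<xi>0" using WS[of \<rho>] \<rho> by auto
    then have kw: "k (W \<rho>) > 0" using k(3) p1 by simp
    have "(W has_real_derivative inverse (- (\<Theta> (W \<rho>) * k (W \<rho>) / K))) (at \<rho>)"
    proof (rule DERIV_inverse_function[where f=\<Theta> and g=W, OF \<Theta>d[OF w] _ \<rho>])
      show "- (\<Theta> (W \<rho>) * k (W \<rho>) / K) \<noteq> 0" using \<Theta>pos[of "W \<rho>"] kw pos by simp
      show "isCont W \<rho>" using continuous_on_interior[OF cW] \<rho> by simp
    qed (use W\<Theta> in auto)
    then show ?thesis using W\<Theta>[of \<rho>] \<rho> by (simp add: field_simps)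
  qed
  then show ?thesis using that[of \<xi>1 W] p1 cW WS by auto
qed

section \<open>Strict inequality for radial functions\<close>

text \<open>\<open>g t + g' t * t\<close> is the derivative of \<open>t * g t\<close>, so its
  monotonicity is convexity on the open interval. Continuity extends the tangent inequality to
  \<open>t = 0\<close>, which occurs when a component of the unit vector vanishes.\<close>

lemma tangent_below:
  fixes g g' :: "real \<Rightarrow> real"
  assumes g: "continuous_on {0..T} g"
    "\<And>t. t \<in> {0<..T} \<Longrightarrow> (g has_real_derivative g' t) (at t within {0<..T})"
    and mono: "mono_on {0<..T} (\<lambda>t. g t + g' t * t)"
    and s: "0 < s" "s < T" and t: "0 \<le> t" "t < T"
  shows "s * g s + (g s + g' s * s) * (t - s) \<le> t * g t"
proof -
  let ?h = "\<lambda>t. t * g t"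
  have d: "(?h has_real_derivative g t + g' t * t) (at t)" if "t \<in> {0<..<T}" for t
  proof -
    have "(g has_real_derivative g' t) (at t)"
      using g(2)[of t] that at_within_interior[of t "{0<..T}"] by simp
    then show ?thesis by (auto intro!: derivative_eq_intros)
  qed
  have conv: "convex_on {0<..<T} ?h"
    by (rule convex_on_realI[where f'="\<lambda>t. g t + g' t * t"])
       (use d mono in \<open>auto simp: mono_on_def\<close>)
  have tan: "s * g s + (g s + g' s * s) * (t - s) \<le> t * g t" if "t \<in> {0<..<T}" for t
    using convex_on_imp_above_tangent[OF conv, of s t "g s + g' s * s"] d[of s] s that
    by (auto simp: has_field_derivative_at_within algebra_simps)
  show ?thesis
  proof (cases "t = 0")
    case True
    have "((\<lambda>t. t * g t - (s * g s + (g s + g' s * s) * (t - s))) \<longlongrightarrow>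
        0 * g 0 - (s * g s + (g s + g' s * s) * (0 - s))) (at_right 0)"
    proof -
      have "continuous (at 0 within {0..T}) g"
        using g(1) s by (auto simp: continuous_on_eq_continuous_within)
      then have "(g \<longlongrightarrow> g 0) (at_right 0)"
        using s by (simp add: continuous_within at_within_Icc_at_right)
      then show ?thesis by (intro tendsto_intros)
    qed
    moreover have "\<forall>\<^sub>F t in at_right 0. t * g t - (s * g s + (g s + g' s * s) * (t - s)) \<ge> 0"
      using eventually_at_right_real[of 0 T] s tan by (auto elim: eventually_mono)
    ultimately have "0 * g 0 - (s * g s + (g s + g' s * s) * (0 - s)) \<ge> 0"
      by (rule tendsto_lowerbound) simp
    then show ?thesis using True by simp
  qed (use tan t in auto)
qed

text \<open>Since \<open>s\<close> is the mean of the numbers \<open>w^2 * (e i)^2\<close>, the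
  linear terms cancel when the tangent inequalities are summed: Jensen for \<open>t * g m t\<close>.
  The radial part is bounded below by \<open>g i >= g m\<close>, the angular part by
  \<open>g i <= 1\<close>. The choice of \<open>a\<close> makes the former at least
  \<open>N * w / \<rho>\<close>, against a loss of \<open>(N - 1) * w / \<rho>\<close>.\<close>

lemma radial_strict_subsolution:
  fixes e :: "'n::finite \<Rightarrow> real" and m :: 'n and g :: "'n \<Rightarrow> real \<Rightarrow> real"
  assumes g: "\<And>t i. 0 \<le> t \<Longrightarrow> t < T \<Longrightarrow> 0 \<le> g m t \<and> g m t \<le> g i t \<and> g i t \<le> 1"
    and tan: "\<And>t. 0 \<le> t \<Longrightarrow> t < T \<Longrightarrow> s * g m s + c * (t - s) \<le> t * g m t"
    and s: "s = w\<^sup>2 / real CARD('n)"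
    and w: "0 < w" "w\<^sup>2 < T" and \<rho>: "0 < \<rho>" and gs: "0 < g m s"
    and e: "(\<Sum>i\<in>UNIV. (e i)\<^sup>2) = 1"
    and a: "a = real CARD('n) * w / (\<rho> * g m s)"
  shows "w / \<rho> \<le> (\<Sum>i\<in>UNIV. g i (w\<^sup>2 * (e i)\<^sup>2) * (a * (e i)\<^sup>2 - w * (1 - (e i)\<^sup>2) / \<rho>))"
proof -
  let ?N = "real CARD('n)"
  have a0: "a \<ge> 0" using w \<rho> gs by (simp add: a)
  have e1: "(e i)\<^sup>2 \<le> 1" for i
    using e sum_nonneg_leq_bound[of UNIV "\<lambda>i. (e i)\<^sup>2" 1 i] by simp
  have r: "0 \<le> w\<^sup>2 * (e i)\<^sup>2" "w\<^sup>2 * (e i)\<^sup>2 < T" for i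
  proof -
    have "w\<^sup>2 * (e i)\<^sup>2 \<le> w\<^sup>2" by (rule mult_left_le[OF e1]) simp
    then show "w\<^sup>2 * (e i)\<^sup>2 < T" using w(2) by linarith
  qed simp
  have "?N * (s * g m s) = (\<Sum>i\<in>(UNIV::'n set). s * g m s) + c * ((\<Sum>i\<in>UNIV. w\<^sup>2 * (e i)\<^sup>2) - ?N * s)"
    using e by (simp add: sum_distrib_left[symmetric] s)
  also have "\<dots> = (\<Sum>i\<in>UNIV. s * g m s + c * (w\<^sup>2 * (e i)\<^sup>2 - s))"
    by (simp add: sum.distrib sum_subtractf sum_distrib_left[symmetric])
  also have "\<dots> \<le> (\<Sum>i\<in>UNIV. w\<^sup>2 * (e i)\<^sup>2 * g m (w\<^sup>2 * (e i)\<^sup>2))"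
    by (intro sum_mono tan r)
  also have "\<dots> = w\<^sup>2 * (\<Sum>i\<in>UNIV. (e i)\<^sup>2 * g m (w\<^sup>2 * (e i)\<^sup>2))"
    by (simp add: sum_distrib_left mult.assoc)
  finally have "w\<^sup>2 * g m s \<le> w\<^sup>2 * (\<Sum>i\<in>UNIV. (e i)\<^sup>2 * g m (w\<^sup>2 * (e i)\<^sup>2))"
    by (simp add: s)
  then have J: "g m s \<le> (\<Sum>i\<in>UNIV. (e i)\<^sup>2 * g m (w\<^sup>2 * (e i)\<^sup>2))"
    using w by simp
  have "w / \<rho> = a * g m s - w * (?N - 1) / \<rho>"
    using gs \<rho> by (simp add: a field_simps)
  also have "\<dots> \<le> a * (\<Sum>i\<in>UNIV. (e i)\<^sup>2 * g m (w\<^sup>2 * (e i)\<^sup>2)) - w * (?N - 1) / \<rho>"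
    using mult_left_mono[OF J a0] by simp
  also have "w * (?N - 1) / \<rho> = (\<Sum>i\<in>UNIV. w * (1 - (e i)\<^sup>2) / \<rho>)"
    using e by (simp add: sum_divide_distrib[symmetric] sum_distrib_left[symmetric] sum_subtractf)
  also have "a * (\<Sum>i\<in>UNIV. (e i)\<^sup>2 * g m (w\<^sup>2 * (e i)\<^sup>2)) - (\<Sum>i\<in>UNIV. w * (1 - (e i)\<^sup>2) / \<rho>)
      = (\<Sum>i\<in>UNIV. g m (w\<^sup>2 * (e i)\<^sup>2) * (a * (e i)\<^sup>2) - w * (1 - (e i)\<^sup>2) / \<rho>)"
    by (simp add: sum_distrib_left sum_subtractf algebra_simps)
  also have "\<dots> \<le> (\<Sum>i\<in>UNIV. g i (w\<^sup>2 * (e i)\<^sup>2) * (a * (e i)\<^sup>2 - w * (1 - (e i)\<^sup>2) / \<rho>))"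
  proof (rule sum_mono)
    fix i
    let ?t = "w\<^sup>2 * (e i)\<^sup>2"
    have gi: "g m ?t \<le> g i ?t" "g i ?t \<le> 1" using g[OF r] by auto
    have "g m ?t * (a * (e i)\<^sup>2) \<le> g i ?t * (a * (e i)\<^sup>2)"
      using gi a0 by (intro mult_right_mono) auto
    moreover have "g i ?t * (w * (1 - (e i)\<^sup>2) / \<rho>) \<le> w * (1 - (e i)\<^sup>2) / \<rho>"
      using gi w \<rho> e1[of i] mult_right_mono[of "g i ?t" 1 "w * (1 - (e i)\<^sup>2) / \<rho>"] by simp
    ultimately show "g m ?t * (a * (e i)\<^sup>2) - w * (1 - (e i)\<^sup>2) / \<rho>
        \<le> g i ?t * (a * (e i)\<^sup>2 - w * (1 - (e i)\<^sup>2) / \<rho>)"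
      by (simp add: right_diff_distrib)
  qed
  finally show ?thesis .
qed

text \<open>A diagonal Hessian entry of a radial function with slope \<open>- W\<close>: the
  eigenvalue is \<open>- W'\<close> along the radius and \<open>- W / norm y\<close> in the
  directions orthogonal to it.\<close>

lemma radial_partial_derivative:
  fixes y :: "real^'n" and W :: "real \<Rightarrow> real"
  assumes y: "y \<noteq> 0" and W: "(W has_real_derivative W') (at (norm y))"
  shows "((\<lambda>s. ((- W (norm (y + s *\<^sub>R axis i 1))) *\<^sub>R sgn (y + s *\<^sub>R axis i 1)) $ i) has_real_derivative
     (- W') * (sgn y $ i)\<^sup>2 - W (norm y) * (1 - (sgn y $ i)\<^sup>2) / norm y) (at 0)"
proof -
  let ?l = "\<lambda>s. y + s *\<^sub>R axis i 1"
  have r: "norm y > 0" using y by simp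
  have "GDERIV norm (?l 0) :> sgn y" using GDERIV_norm[OF y] by simp
  from GDERIV_line[OF this]
  have n: "((\<lambda>s. norm (?l s)) has_real_derivative sgn y $ i) (at 0)" by (simp add: inner_axis')
  have W0: "(W has_real_derivative W') (at (norm (?l 0)))" using W by simp
  have Wn: "((\<lambda>s. W (norm (?l s))) has_real_derivative W' * sgn y $ i) (at 0)"
    by (rule DERIV_chain2[where f=W and g="\<lambda>s. norm (?l s)", OF W0 n])
  have c: "((\<lambda>s. ?l s $ i) has_real_derivative 1) (at 0)"
    by (auto intro!: derivative_eq_intros)
  have "((\<lambda>s. - W (norm (?l s)) * (?l s $ i / norm (?l s))) has_real_derivative
      - (W' * sgn y $ i) * (y $ i / norm y) + (1 * norm y - y $ i * sgn y $ i) / (norm y * norm y) * - W (norm y)) (at 0)"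
    using DERIV_mult[OF DERIV_minus[OF Wn] DERIV_divide[OF c n]] y by simp
  moreover have "(\<lambda>s. - W (norm (?l s)) * (?l s $ i / norm (?l s))) =
      (\<lambda>s. ((- W (norm (?l s))) *\<^sub>R sgn (?l s)) $ i)"
    by (simp add: sgn_div_norm divide_inverse mult.commute mult.left_commute fun_eq_iff)
  moreover have "- (W' * sgn y $ i) * (y $ i / norm y) + (1 * norm y - y $ i * sgn y $ i) / (norm y * norm y) * - W (norm y)
      = (- W') * (sgn y $ i)\<^sup>2 - W (norm y) * (1 - (sgn y $ i)\<^sup>2) / norm y"
    using r by (simp add: sgn_div_norm field_simps power2_eq_square)
  ultimately show ?thesis by metis
qed

lemma radial_integral_barrier:
  fixes W :: "real \<Rightarrow> real"
  assumes W: "continuous_on {s..r} W" "\<forall>\<rho>\<in>{s..r}. \<xi>1 \<le> W \<rho> \<and> W \<rho> \<le> \<xi>0"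
    and s: "s < r"
  defines "V \<equiv> \<lambda>\<rho>. integral {\<rho>..r} W"
  shows "continuous_on {s..r} V" "\<And>\<rho>. s < \<rho> \<Longrightarrow> \<rho> < r \<Longrightarrow> (V has_real_derivative - W \<rho>) (at \<rho>)"
    "\<And>\<rho>. s \<le> \<rho> \<Longrightarrow> \<rho> \<le> r \<Longrightarrow> \<xi>1 * (r - \<rho>) \<le> V \<rho>" "V s \<le> \<xi>0 * (r - s)" "V r = 0"
proof -
  have d: "(V has_real_derivative - W \<rho>) (at \<rho> within {s..r})" if "\<rho> \<in> {s..r}" for \<rho>
    unfolding V_def using W(1) that by (rule integral_has_real_derivative')
  then show "continuous_on {s..r} V" by (meson DERIV_continuous_on)
  show "(V has_real_derivative - W \<rho>) (at \<rho>)" if "s < \<rho>" "\<rho> < r" for \<rho>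
    using d[of \<rho>] that at_within_interior[of \<rho> "{s..r}"] by simp
  have i: "W integrable_on {\<rho>..r}" if "s \<le> \<rho>" for \<rho>
    by (rule integrable_continuous_real, rule continuous_on_subset[OF W(1)]) (use that in auto)
  show "\<xi>1 * (r - \<rho>) \<le> V \<rho>" if "s \<le> \<rho>" "\<rho> \<le> r" for \<rho>
  proof -
    have "integral {\<rho>..r} (\<lambda>_. \<xi>1) \<le> V \<rho>"
      unfolding V_def by (rule integral_le) (use i W(2) that in auto)
    then show ?thesis using that by (simp add: mult.commute)
  qed
  have "V s \<le> integral {s..r} (\<lambda>_. \<xi>0)"
    unfolding V_def by (rule integral_le) (use i W(2) in auto)
  then show "V s \<le> \<xi>0 * (r - s)" using s by (simp add: mult.commute)
  show "V r = 0" by (simp add: V_def)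
qed

theorem lemma4:
  fixes \<Omega> :: "(real^'n) set"
    and m :: 'n
    and g f :: "'n \<Rightarrow> real \<Rightarrow> real"
    and u :: "real^'n \<Rightarrow> real"
    and z c :: "real^'n"
    and r D :: real
  assumes "CARD('n) \<ge> 2"
    and "connected \<Omega>" and "open \<Omega>" and "bounded \<Omega>"
    and "\<And>i. continuous_on {0..} (g i)"
    and "\<And>i t. t \<ge> 0 \<Longrightarrow> g i t \<ge> 0"
    and "assumption_L m g"
    and "\<And>i. solves_ode (g i) (f i)"
    and "assumption_G f"
    and "\<And>\<xi>. \<xi> > 0 \<Longrightarrow> G_integral m g \<xi> = \<infinity>"
    and "u \<in> W12 \<Omega>" and "continuous_on (closure \<Omega>) u"
    and "weak_supersolution f \<Omega> u"
    and "z \<in> frontier \<Omega>"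
    and "\<And>x. x \<in> \<Omega> \<Longrightarrow> u z < u x"
    and "r > 0" and "ball c r \<subseteq> \<Omega>" and "z \<in> frontier (ball c r)"
    and "has_normal_derivative u D ((z - c) /\<^sub>R r) z"
  shows "D < 0"
proof -
  note \<Omega> = \<open>open \<Omega>\<close> \<open>bounded \<Omega>\<close> and r = \<open>r > 0\<close> and g_cont = assms(5) and g_nonneg = assms(6)
  define N where "N = real CARD('n)"
  have N: "N \<ge> 2" using assms(1) by (simp add: N_def)
  have zc: "norm (z - c) = r"
    using \<open>z \<in> frontier (ball c r)\<close> r by (simp add: dist_norm norm_minus_commute)

  \<comment> \<open>Bounds near zero from assumption (L)\<close>
  obtain T g' where T: "T > 0"
    and L: "\<forall>t\<in>{0..T}. \<forall>i. i \<noteq> m \<longrightarrow> 0 \<le> g m t \<and> g m t \<le> g i t \<and> g i t \<le> 1"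
      "\<forall>t\<in>{0<..T}. 0 < g m t"
      "\<forall>t\<in>{0<..T}. (g m has_real_derivative g' t) (at t within {0<..T})"
    and gmc: "continuous_on {0..T} (g m)" and gmm: "mono_on {0<..T} (\<lambda>t. g m t + g' t * t)"
    using \<open>assumption_L m g\<close> unfolding assumption_L_def by blast
  have gT: "0 \<le> g m t \<and> g m t \<le> g i t \<and> g i t \<le> 1" if "0 \<le> t" "t \<le> T" "i \<noteq> m" for t i
    using L(1) that by simp
  have gmpos: "0 < g m t" if "0 < t" "t \<le> T" for t using L(2) that by simp
  have gmd: "(g m has_real_derivative g' t) (at t within {0<..T})" if "t \<in> {0<..T}" for t
    using L(3) that by blast
  \<comment> \<open>Assumption (L) bounds \<open>g m\<close> only by comparison with other indices;
    N >= 2 supplies such an index, and with it the bounds for \<open>i = m\<close>.\<close>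
  have "\<exists>j. j \<noteq> m"
  proof (rule ccontr)
    assume "\<nexists>j. j \<noteq> m"
    then have "(UNIV :: 'n set) = {m}" by auto
    then have "CARD('n) = 1" by (metis card_1_singleton_iff One_nat_def)
    then show False using assms(1) by simp
  qed
  then obtain j where "j \<noteq> m" by blast
  have gT': "0 \<le> g m t \<and> g m t \<le> g i t \<and> g i t \<le> 1" if "0 \<le> t" "t \<le> T" for t i
    using gT[OF that, of i] gT[OF that \<open>j \<noteq> m\<close>] by (cases "i = m") auto

  \<comment> \<open>The flux and the weak inequality in terms of it\<close>
  define flux where "flux = (\<lambda>i a C. (\<forall>s. ((\<lambda>s. f i (s\<^sup>2) * s\<^sup>2) has_real_derivative 2 * a s) (at s)) \<and>
      (\<forall>s. (a has_real_derivative g i (s\<^sup>2)) (at s)) \<and> (\<forall>s. \<bar>a s\<bar> \<le> C * \<bar>s\<bar>))"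
  have "\<exists>a C. flux i a C" for i
  proof -
    have "bounded (f i ` {0..})" "strictly_convex_on UNIV (\<lambda>s::real. f i (s\<^sup>2) * s\<^sup>2)"
      using \<open>assumption_G f\<close> by (auto simp: assumption_G_def)
    then show ?thesis
      by (rule flux_component_exists[OF g_cont assms(8)]) (unfold flux_def, blast)
  qed
  then obtain a C' where "\<And>i. flux i (a i) (C' i)" by metis
  then have a1: "((\<lambda>s. f i (s\<^sup>2) * s\<^sup>2) has_real_derivative 2 * a i s) (at s)"
    and a2: "(a i has_real_derivative g i (s\<^sup>2)) (at s)" and a3: "\<bar>a i s\<bar> \<le> C' i * \<bar>s\<bar>" for i s
    by (simp_all add: flux_def)
  define C where "C = (\<Sum>i\<in>UNIV. \<bar>C' i\<bar>)"
  have a3': "\<bar>a i s\<bar> \<le> C * \<bar>s\<bar>" for i s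
  proof -
    have "C' i \<le> C" unfolding C_def using member_le_sum[of i UNIV "\<lambda>i. \<bar>C' i\<bar>"] by simp
    then show ?thesis using a3[of i s] mult_right_mono[of "C' i" C "\<bar>s\<bar>"] by linarith
  qed
  have a_cont: "continuous_on UNIV (a i)" for i
    by (rule continuous_at_imp_continuous_on) (simp add: DERIV_isCont[OF a2])
  have a_mono: "mono (a i)" for i
  proof (rule monoI)
    fix x y :: real assume "x \<le> y"
    then show "a i x \<le> a i y"
      by (rule DERIV_nonneg_imp_nondecreasing) (meson a2 g_nonneg zero_le_power2)
  qed

  define G where "G = weak_grad \<Omega> u"
  have G: "L2_on \<Omega> G \<and> is_weak_gradient \<Omega> u G"
    using someI_ex[of "\<lambda>v. L2_on \<Omega> v \<and> is_weak_gradient \<Omega> u v"] \<open>u \<in> W12 \<Omega>\<close>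
    by (simp add: G_def weak_grad_def W12_def)
  have weak: "0 \<le> (LINT x:\<Omega>|lebesgue. (\<chi> i. a i (G x $ i)) \<bullet> grad \<eta> x)"
    if "\<eta> \<in> test_functions \<Omega>" "\<forall>x\<in>\<Omega>. 0 \<le> \<eta> x" for \<eta>
    using \<open>weak_supersolution f \<Omega> u\<close> that
    unfolding weak_supersolution_def G_def[symmetric] grad_lagrangian[where a=a, OF a1] by blast

  \<comment> \<open>Slope and profile of the barrier\<close>
  have sph: "sphere c (r / 2) \<subseteq> \<Omega>" using \<open>ball c r \<subseteq> \<Omega>\<close> r by (auto simp: subset_iff)
  obtain \<mu> where \<mu>: "\<mu> > 0" "\<And>x. norm (x - c) = r / 2 \<Longrightarrow> \<mu> \<le> u x - u z"
  proof -
    have ne: "sphere c (r / 2) \<noteq> {}" using r by simp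
    have "continuous_on (sphere c (r / 2)) u"
      by (rule continuous_on_subset[OF assms(12)]) (use sph closure_subset in blast)
    from continuous_attains_inf[OF compact_sphere ne this]
    obtain y where y: "y \<in> sphere c (r / 2)" "\<forall>x\<in>sphere c (r / 2). u y \<le> u x" by blast
    have "u z < u y" using assms(15) y(1) sph by blast
    then show ?thesis
      using that[of "u y - u z"] y(2) by (auto simp: dist_norm norm_minus_commute)
  qed

  \<comment> \<open>The first bound keeps all slopes in the range where (L) applies. The second
    keeps the height of the barrier on the inner sphere below \<open>\<mu>\<close>, the gap between
    \<open>u\<close> and \<open>u z\<close> there.\<close>
  define \<xi>0 where "\<xi>0 = min (sqrt T / 2) (\<mu> / r)"
  have \<xi>0: "\<xi>0 > 0" "\<xi>0 * (r - r / 2) \<le> \<mu>"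
  proof -
    show "\<xi>0 > 0" using T \<mu> r by (simp add: \<xi>0_def)
    have "\<xi>0 \<le> \<mu> / r" by (simp add: \<xi>0_def)
    then have "\<xi>0 * r \<le> \<mu>" using r by (simp add: field_simps)
    then show "\<xi>0 * (r - r / 2) \<le> \<mu>" using \<open>\<xi>0 > 0\<close> \<mu> r by (simp add: field_simps)
  qed
  have \<xi>T: "t\<^sup>2 < T" if "0 < t" "t \<le> \<xi>0" for t
  proof -
    have "t \<le> sqrt T / 2" using that by (simp add: \<xi>0_def)
    then have "t < sqrt T" using T by (smt (verit) field_sum_of_halves real_sqrt_gt_zero)
    then have "t\<^sup>2 < (sqrt T)\<^sup>2" using that by (intro power_strict_mono) auto
    then show ?thesis using T by simp
  qed
  have div_N: "0 < t\<^sup>2 / N" "t\<^sup>2 / N < T" if "0 < t" "t \<le> \<xi>0" for t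
  proof -
    show "0 < t\<^sup>2 / N" using that N by simp
    have "t\<^sup>2 / N \<le> t\<^sup>2 / 1" using N by (intro divide_left_mono) auto
    then show "t\<^sup>2 / N < T" using \<xi>T[OF that] by simp
  qed
  define k where "k = (\<lambda>\<zeta>. g m (\<zeta>\<^sup>2 / N) / \<zeta>)"
  have k: "continuous_on {0<..} k" "\<And>t. t > 0 \<Longrightarrow> 0 \<le> k t" "\<And>t. 0 < t \<Longrightarrow> t \<le> \<xi>0 \<Longrightarrow> 0 < k t"
  proof -
    show "continuous_on {0<..} k"
      unfolding k_def
      by (intro continuous_intros continuous_on_compose2[OF g_cont]) (use N in auto)
    show "0 \<le> k t" if "t > 0" for t using that N g_nonneg by (simp add: k_def)
    show "0 < k t" if "0 < t" "t \<le> \<xi>0" for t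
      using gmpos[OF div_N(1)[OF that]] div_N(2)[OF that] that by (simp add: k_def)
  qed
  have lim: "Lim (at_right 0) (\<lambda>\<epsilon>. ereal (integral {\<epsilon>..\<xi>0} k)) = \<infinity>"
    using assms(10)[OF \<xi>0(1)] by (simp add: G_integral_def k_def N_def)
  have "0 < N" using N by simp
  obtain W \<xi>1 where \<xi>1: "0 < \<xi>1" and Wc: "continuous_on {r/2..r} W"
    and Wb: "\<And>\<rho>. r/2 \<le> \<rho> \<Longrightarrow> \<rho> \<le> r \<Longrightarrow> \<xi>1 \<le> W \<rho> \<and> W \<rho> \<le> \<xi>0"
    and Wd: "\<And>\<rho>. r/2 < \<rho> \<Longrightarrow> \<rho> < r \<Longrightarrow> (W has_real_derivative - (N / (\<rho> * k (W \<rho>)))) (at \<rho>)"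
  proof (rule barrier_profile[of k \<xi>0 N r])
    fix W \<xi>1
    assume *: "0 < \<xi>1" "continuous_on {r/2..r} W"
      "\<And>\<rho>. r/2 \<le> \<rho> \<Longrightarrow> \<rho> \<le> r \<Longrightarrow> \<xi>1 \<le> W \<rho> \<and> W \<rho> \<le> \<xi>0"
      "\<And>\<rho>. r/2 < \<rho> \<Longrightarrow> \<rho> < r \<Longrightarrow> (W has_real_derivative - (N / (\<rho> * k (W \<rho>)))) (at \<rho>)"
    show thesis by (rule that) (use * in blast)+
  qed (use k \<xi>0(1) r lim \<open>0 < N\<close> in blast)+
  define V where "V = (\<lambda>\<rho>. integral {\<rho>..r} W)"
  have "r / 2 < r" using r by simp
  have "\<forall>\<rho>\<in>{r/2..r}. \<xi>1 \<le> W \<rho> \<and> W \<rho> \<le> \<xi>0" using Wb by simp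
  note Vp = radial_integral_barrier[OF Wc this \<open>r / 2 < r\<close>, folded V_def]

  \<comment> \<open>The barrier is a strict subsolution on the annulus\<close>
  define U where "U = {x. r / 2 < norm (x - c) \<and> norm (x - c) < r}"
  define v where "v = (\<lambda>x. u z + V (norm (x - c)))"
  define Dv where "Dv = (\<lambda>x. (- W (norm (x - c))) *\<^sub>R sgn (x - c))"
  define e where "e = (\<lambda>x i. sgn (x - c) $ i)"
  \<comment> \<open>The \<open>i\<close>-th term of the divergence of the barrier's flux:
    \<open>g i\<close> at the squared partial derivative times the diagonal Hessian entry, with
    \<open>W'\<close> replaced through its differential equation.\<close>
  define q where "q = (\<lambda>i x. g i ((W (norm (x - c)))\<^sup>2 * (e x i)\<^sup>2) *
    (N / (norm (x - c) * k (W (norm (x - c)))) * (e x i)\<^sup>2 - W (norm (x - c)) * (1 - (e x i)\<^sup>2) / norm (x - c)))"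
  have Uo: "open U"
    unfolding U_def by (intro open_Collect_conj open_Collect_less continuous_intros)
  have U\<Omega>: "U \<subseteq> \<Omega>"
    using \<open>ball c r \<subseteq> \<Omega>\<close> by (auto simp: U_def dist_norm norm_minus_commute subset_iff)
  have Ucl: "closure U \<subseteq> {x. r / 2 \<le> norm (x - c) \<and> norm (x - c) \<le> r}"
    by (rule closure_minimal)
       (auto simp: U_def intro!: closed_Collect_conj closed_Collect_le continuous_intros)
  have UW: "W (norm (x - c)) > 0" "W (norm (x - c)) \<le> \<xi>0" "norm (x - c) > 0" "x - c \<noteq> 0"
    "k (W (norm (x - c))) > 0" if "x \<in> U" for x
  proof -
    have x: "r / 2 < norm (x - c)" "norm (x - c) < r" using that by (auto simp: U_def)
    then show w: "W (norm (x - c)) > 0" "W (norm (x - c)) \<le> \<xi>0"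
      using Wb[of "norm (x - c)"] \<xi>1 by auto
    show "norm (x - c) > 0" using x r by linarith
    then show "x - c \<noteq> 0" by auto
    show "k (W (norm (x - c))) > 0" using k(3) w by blast
  qed
  have cWU: "continuous_on U (\<lambda>x. W (norm (x - c)))"
    by (rule continuous_on_compose2[OF Wc]) (auto intro!: continuous_intros simp: U_def)
  have ce: "continuous_on U (\<lambda>x. e x i)" for i
    unfolding e_def by (intro continuous_intros) (use UW in auto)
  have cDv: "continuous_on U Dv"
    unfolding Dv_def by (intro continuous_intros cWU) (use UW in auto)
  have cq: "continuous_on U (q i)" for i
  proof -
    have 1: "continuous_on U (\<lambda>x. g i ((W (norm (x - c)))\<^sup>2 * (e x i)\<^sup>2))"
      by (rule continuous_on_compose2[OF g_cont]) (auto intro!: continuous_intros cWU ce)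
    have 2: "continuous_on U (\<lambda>x. k (W (norm (x - c))))"
      by (rule continuous_on_compose2[OF k(1) cWU]) (use UW in auto)
    show ?thesis
      unfolding q_def by (intro continuous_intros 1 2 cWU ce) (use UW in \<open>auto simp: less_imp_neq[symmetric]\<close>)
  qed
  have dq: "((\<lambda>s. a i (Dv (x + s *\<^sub>R axis i 1) $ i)) has_real_derivative q i x) (at 0)" if x: "x \<in> U" for i x
  proof -
    have \<rho>: "r / 2 < norm (x - c)" "norm (x - c) < r" using x by (auto simp: U_def)
    have sh: "x + s *\<^sub>R axis i 1 - c = (x - c) + s *\<^sub>R axis i 1" for s by simp
    have 1: "((\<lambda>s. Dv (x + s *\<^sub>R axis i 1) $ i) has_real_derivative
        N / (norm (x - c) * k (W (norm (x - c)))) * (e x i)\<^sup>2 - W (norm (x - c)) * (1 - (e x i)\<^sup>2) / norm (x - c)) (at 0)"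
      using radial_partial_derivative[OF UW(4)[OF x] Wd[OF \<rho>], of i]
      unfolding Dv_def e_def sh by simp
    have sq: "(Dv (x + 0 *\<^sub>R axis i 1) $ i)\<^sup>2 = (W (norm (x - c)))\<^sup>2 * (e x i)\<^sup>2"
      by (simp add: Dv_def e_def power_mult_distrib)
    show ?thesis
      using DERIV_chain2[where f="a i" and g="\<lambda>s. Dv (x + s *\<^sub>R axis i 1) $ i", OF a2 1]
      unfolding q_def sq .
  qed
  have posq: "0 < (\<Sum>i\<in>UNIV. q i x)" if x: "x \<in> U" for x
  proof -
    define w \<rho> where "w = W (norm (x - c))" and "\<rho> = norm (x - c)"
    have w: "0 < w" "w \<le> \<xi>0" and \<rho>: "0 < \<rho>" using UW[OF x] by (auto simp: w_def \<rho>_def)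
    have s: "0 < w\<^sup>2 / N" "w\<^sup>2 / N < T" by (rule div_N[OF w])+
    have "(\<Sum>i\<in>UNIV. (e x i)\<^sup>2) = (norm (sgn (x - c)))\<^sup>2"
      by (simp add: e_def norm_vec_def L2_set_def sum_nonneg)
    also have "\<dots> = 1" using UW(4)[OF x] by (simp add: norm_sgn)
    finally have e1: "(\<Sum>i\<in>UNIV. (e x i)\<^sup>2) = 1" .
    \<comment> \<open>The slope passed for \<open>c\<close> is the derivative of
      \<open>t * g m t\<close> at \<open>w^2 / N\<close>; the coefficient
      \<open>N / (\<rho> * k w)\<close> is \<open>- W'\<close>, rewritten with the definition of
      \<open>k\<close>.\<close>
    have "w / \<rho> \<le> (\<Sum>i\<in>UNIV. g i (w\<^sup>2 * (e x i)\<^sup>2) * (N / (\<rho> * k w) * (e x i)\<^sup>2 - w * (1 - (e x i)\<^sup>2) / \<rho>))"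
    proof (rule radial_strict_subsolution[where m=m and T=T and s="w\<^sup>2 / N" and c="g m (w\<^sup>2 / N) + g' (w\<^sup>2 / N) * (w\<^sup>2 / N)"])
      show "0 \<le> g m t \<and> g m t \<le> g i t \<and> g i t \<le> 1" if "0 \<le> t" "t < T" for t i
        using gT' that by simp
      show "w\<^sup>2 / N * g m (w\<^sup>2 / N) + (g m (w\<^sup>2 / N) + g' (w\<^sup>2 / N) * (w\<^sup>2 / N)) * (t - w\<^sup>2 / N) \<le> t * g m t"
        if "0 \<le> t" "t < T" for t
        by (rule tangent_below[OF gmc gmd gmm s that])
      show "0 < g m (w\<^sup>2 / N)" using gmpos s by simp
      show "N / (\<rho> * k w) = real CARD('n) * w / (\<rho> * g m (w\<^sup>2 / N))"
        using w by (simp add: k_def N_def)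
    qed (use w \<xi>T \<rho> e1 in \<open>auto simp: N_def\<close>)
    moreover have "0 < w / \<rho>" using w \<rho> by simp
    ultimately show ?thesis by (simp add: q_def w_def \<rho>_def)
  qed

  \<comment> \<open>Boundary values and comparison\<close>
  have gv: "GDERIV v x :> Dv x" if x: "x \<in> U" for x
  proof -
    have \<rho>: "r / 2 < norm (x - c)" "norm (x - c) < r" using x by (auto simp: U_def)
    have "(norm has_derivative (\<lambda>h. h \<bullet> sgn (x - c))) (at (x - c))"
      using GDERIV_norm[OF UW(4)[OF x]] by (simp add: gderiv_def)
    then have "GDERIV (\<lambda>x. norm (x - c)) x :> sgn (x - c)"
      unfolding gderiv_def
      by (rule has_derivative_compose[where f="\<lambda>x. x - c", rotated]) (auto intro!: derivative_eq_intros)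
    from GDERIV_add[OF GDERIV_const GDERIV_DERIV_compose[OF this Vp(2)[OF \<rho>]]]
    show ?thesis by (simp add: v_def Dv_def)
  qed
  have cv: "continuous_on (closure U) v"
    unfolding v_def
    by (intro continuous_intros continuous_on_compose2[OF Vp(1)]) (use Ucl in auto)
  \<comment> \<open>The outer sphere may touch the frontier of \<open>\<Omega>\<close> at points
    other than \<open>z\<close>, so minimality is needed on the whole closure.\<close>
  have z_min: "u z \<le> u x" if "x \<in> closure \<Omega>" for x
    by (rule continuous_ge_on_closure[OF assms(12) that]) (use assms(15) in \<open>auto intro: less_imp_le\<close>)
  have bd: "v x \<le> u x" if x: "x \<in> frontier U" for x
  proof -
    have "x \<in> closure U" "x \<notin> U" using x Uo by (auto simp: frontier_def interior_open)
    then consider "norm (x - c) = r / 2" | "norm (x - c) = r"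
      using Ucl by (force simp: U_def)
    then show ?thesis
    proof cases
      case 1
      have "V (r / 2) \<le> \<mu>" using Vp(4) \<xi>0(2) unfolding V_def by linarith
      then show ?thesis using \<mu>(2)[OF 1] unfolding v_def 1 by linarith
    next
      case 2
      have "x \<in> closure \<Omega>" using \<open>x \<in> closure U\<close> closure_mono[OF U\<Omega>] by blast
      then show ?thesis using 2 z_min by (simp add: v_def V_def)
    qed
  qed
  have vu: "v x \<le> u x" if "x \<in> U" for x
    by (rule comparison_strict_subsolution[where \<Omega>=\<Omega> and U=U and u=u and v=v and G=G and Dv=Dv and a=a and C=C and q=q])
       (use \<Omega> assms(12) G a_cont a_mono a3' weak Uo U\<Omega> cv gv cDv dq cq posq bd that in auto)

  \<comment> \<open>The normal derivative\<close>
  \<comment> \<open>For \<open>h < r / 2\<close> the point at depth \<open>h\<close> below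
    \<open>z\<close> lies in the annulus at distance \<open>r - h\<close> from \<open>c\<close>.
    There the barrier exceeds \<open>u z\<close> by at least \<open>\<xi>1 * h\<close>, since
    \<open>W\<close> is at least \<open>\<xi>1\<close>.\<close>
  have "D \<le> - \<xi>1"
  proof (rule tendsto_upperbound)
    show "((\<lambda>h. (u z - u (z - h *\<^sub>R ((z - c) /\<^sub>R r))) / h) \<longlongrightarrow> D) (at_right 0)"
      using assms(19) by (simp only: has_normal_derivative_def)
    have "\<forall>\<^sub>F h in at_right 0. h \<in> {0<..<r / 2}"
      using r by (intro eventually_at_right_real) simp
    then show "\<forall>\<^sub>F h in at_right 0. (u z - u (z - h *\<^sub>R ((z - c) /\<^sub>R r))) / h \<le> - \<xi>1"
    proof eventually_elim
      case (elim h)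
      let ?x = "z - h *\<^sub>R ((z - c) /\<^sub>R r)"
      have "?x - c = (1 - h / r) *\<^sub>R (z - c)"
        by (simp add: scaleR_diff_left divide_inverse)
      then have "norm (?x - c) = \<bar>1 - h / r\<bar> * r" using zc by simp
      also have "\<dots> = r - h" using elim r by (simp add: field_simps)
      finally have n: "norm (?x - c) = r - h" .
      then have "?x \<in> U" using elim by (simp add: U_def)
      from vu[OF this] have "u z + V (r - h) \<le> u ?x" unfolding v_def n .
      moreover have "\<xi>1 * h \<le> V (r - h)" using Vp(3)[of "r - h"] elim by (simp add: V_def)
      ultimately have "u z - u ?x \<le> - \<xi>1 * h" by simp
      then show ?case using elim by (simp add: divide_le_eq)
    qed
  qed simp
  then show "D < 0" using \<xi>1 by simp
qed

end
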